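(* Let $T\in\mathcal F$ be a trigraph with no balanced skew-partition and let $X$ be a fragment of $T$ (in the sense including homogeneous pairs). Then the block of decomposition $T_X$ has no balanced skew-partition.
   Context: Trigraphs: finite $V(T)$ with $\theta:\binom{V(T)}{2}\to\{-1,0,1\}$; $u,v$ strongly adjacent if $\theta(uv)=1$, strongly antiadjacent if $-1$, a switchable pair if $0$; adjacent (neighbours) if $\theta\in\{0,1\}$, antiadjacent (antineighbours) if $\theta\in\{-1,0\}$. Complement $\overline T$: $-\theta$; $T|X$: induced trigraph. Strongly complete/anticomplete: strongly adjacent/antiadjacent to every vertex of a set. Full realization: graph on $V(T)$ of adjacent pairs. $X$ connected: full realization of $T|X$ connected; anticonnected: complement of graph on $X$ of strongly adjacent pairs connected; components = maximal connected subsets. Path: distinct $p_1,\dots,p_k$, consecutive adjacent, non-consecutive antiadjacent (length $k-1$, interior = inner vertices). Hole: $h_1,\dots,h_k$, $k\ge4$, $h_i,h_j$ adjacent iff $|i-j|\in\{1,k-1\}$, else antiadjacent. Antipath/antihole: complement is a path/hole in $\overline T$. Berge: no odd hole, no odd antihole. Skew-partition: partition $(A,B)$ of $V(T)$, $A$ not connected, $B$ not anticonnected; balanced if no path of odd length $>1$ with ends in $B$ and interior in $A$ and no antipath of odd length $>1$ with ends in $A$ and interior in $B$. $\mathcal F$: Berge trigraphs such that each component of the graph $\Sigma(T)$ of switchable pairs has at most two edges and each vertex $v$ of $\Sigma(T)$-degree two with $\Sigma(T)$-neighbours $x,y$ is either strongly complete to $V(T)\setminus\{v,x,y\}$ with $x,y$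 strongly adjacent, or strongly anticomplete to $V(T)\setminus\{v,x,y\}$ with $x,y$ strongly antiadjacent. $2$-join: partition $(X_1,X_2)$ with disjoint $A_1,B_1,C_1,A_2,B_2,C_2$ (split), $X_i=A_i\cup B_i\cup C_i$, $A_i,B_i\neq\emptyset$, no switchable pair between $X_1,X_2$, $A_1$ strongly complete to $A_2$, $B_1$ strongly complete to $B_2$, all other pairs between $X_1,X_2$ strongly antiadjacent, $|X_i|\ge3$, and if $|A_i|=|B_i|=1$ the full realization of $T|X_i$ is not a path of length two between the vertices of $A_i$ and $B_i$; proper if each component of $T|X_i$ meets $A_i$ and $B_i$. (Proper) complement $2$-join: (proper) $2$-join of $\overline T$, same split. In a Berge trigraph, for a proper $2$-join all paths from $A_i$ to $B_i$ with interior in $C_i$ ($i=1,2$) have the same length parity, called odd/even accordingly; complement $2$-joins have the parity of the $2$-join of $\overline T$. Proper homogeneous pair: disjoint nonempty $A,B\subseteq V(T)$ such that, letting $A_1$ ($A_2$) be the set of vertices of $V(T)\setminus(A\cup B)$ strongly complete (strongly anticomplete) to $A$ and $B_1,B_2$ likewise for $B$: $|A|>1$, $|B|>1$; $A_1\cup A_2=B_1\cup B_2=V(T)\setminus(A\cup B)$; every vertex of $A$ has a neighbour and an antineighbour in $B$ and vice versa; and $A_1\cap B_1$, $A_1\cap B_2$, $A_2\cap B_1$, $A_2\cap B_2$ are nonempty. Its split is $(A,B,C,D,E,F)$ with $C=A_1\cap B_2$, $D=A_2\cap B_1$, $E=A_1\cap B_1$, $F=A_2\cap B_2$. Fragment: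 $X\subseteq V(T)$ such that $(X,V(T)\setminus X)$ is a proper $2$-join or a proper complement $2$-join of $T$, or $X=A\cup B$ or $X=V(T)\setminus(A\cup B)$ for a proper homogeneous pair $(A,B)$. Blocks $T_X$, adding new marker vertices with all unspecified new pairs strongly antiadjacent. For $X=X_1$ of a $2$-join with split $(A_1,B_1,C_1,A_2,B_2,C_2)$, start from $T|X_1$: odd $2$-join: add $a,b$, $a$ strongly complete to $A_1$, $b$ strongly complete to $B_1$, $ab$ switchable; even $2$-join: add $a,b,c$, $a$ strongly complete to $A_1$, $b$ strongly complete to $B_1$, $ac,cb$ switchable; odd complement $2$-join: add $a,b$, $a$ strongly complete to $B_1\cup C_1$, $b$ strongly complete to $A_1\cup C_1$, $ab$ switchable; even complement $2$-join: add $a,b,c$, $a$ strongly complete to $B_1\cup C_1$, $b$ strongly complete to $A_1\cup C_1$, $c$ strongly complete to $X_1$, $ac,cb$ switchable, $ab$ strongly adjacent. For $X=A\cup B$: start from $T|(A\cup B)$, add $c$ strongly complete to $A$ and $d$ strongly complete to $B$ with $cd$ switchable. For $X=C\cup D\cup E\cup F$: start from $T|X$, add $a$ strongly complete to $C\cup E$ and $b$ strongly complete to $D\cup E$ with $ab$ switchable. *)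

theory Defs
  imports Main
begin

record 'a trigraph =
  verts :: "'a set"
  theta :: "'a \<Rightarrow> 'a \<Rightarrow> int"

text \<open>The function on unordered pairs is encoded as a curried symmetric function; its values on
  the diagonal and outside the vertex set are irrelevant.\<close>

definition trigraph :: "'a trigraph \<Rightarrow> bool" where
  "trigraph T \<longleftrightarrow> finite (verts T) \<and>
     (\<forall>u\<in>verts T. \<forall>v\<in>verts T. u \<noteq> v \<longrightarrow>
        theta T u v \<in> {-1, 0, 1} \<and> theta T u v = theta T v u)"

definition vpair :: "'a trigraph \<Rightarrow> 'a \<Rightarrow> 'a \<Rightarrow> bool" where
  "vpair T u v \<longleftrightarrow> u \<in> verts T \<and> v \<in> verts T \<and> u \<noteq> v"

definition strongly_adjacent :: "'a trigraph \<Rightarrow> 'a \<Rightarrow> 'a \<Rightarrow> bool" where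
  "strongly_adjacent T u v \<longleftrightarrow> vpair T u v \<and> theta T u v = 1"

definition strongly_antiadjacent :: "'a trigraph \<Rightarrow> 'a \<Rightarrow> 'a \<Rightarrow> bool" where
  "strongly_antiadjacent T u v \<longleftrightarrow> vpair T u v \<and> theta T u v = -1"

definition switchable :: "'a trigraph \<Rightarrow> 'a \<Rightarrow> 'a \<Rightarrow> bool" where
  "switchable T u v \<longleftrightarrow> vpair T u v \<and> theta T u v = 0"

definition adjacent :: "'a trigraph \<Rightarrow> 'a \<Rightarrow> 'a \<Rightarrow> bool" where
  "adjacent T u v \<longleftrightarrow> vpair T u v \<and> theta T u v \<in> {0, 1}"

definition antiadjacent :: "'a trigraph \<Rightarrow> 'a \<Rightarrow> 'a \<Rightarrow> bool" where
  "antiadjacent T u v \<longleftrightarrow> vpair T u v \<and> theta T u v \<in> {-1, 0}"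

definition complement :: "'a trigraph \<Rightarrow> 'a trigraph" where
  "complement T = \<lparr>verts = verts T, theta = (\<lambda>u v. - theta T u v)\<rparr>"

definition induced :: "'a trigraph \<Rightarrow> 'a set \<Rightarrow> 'a trigraph" where
  "induced T X = \<lparr>verts = verts T \<inter> X, theta = theta T\<rparr>"

text \<open>A graph is a trigraph without switchable pairs.\<close>

definition full_realization :: "'a trigraph \<Rightarrow> 'a trigraph" where
  "full_realization T =
     \<lparr>verts = verts T, theta = (\<lambda>u v. if adjacent T u v then 1 else -1)\<rparr>"

definition strongly_complete :: "'a trigraph \<Rightarrow> 'a \<Rightarrow> 'a set \<Rightarrow> bool" where
  "strongly_complete T v S \<longleftrightarrow> (\<forall>s\<in>S. strongly_adjacent T v s)"

definition strongly_anticomplete :: "'a trigraph \<Rightarrow> 'a \<Rightarrow> 'a set \<Rightarrow> bool" where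
  "strongly_anticomplete T v S \<longleftrightarrow> (\<forall>s\<in>S. strongly_antiadjacent T v s)"


definition graph_connected :: "('a \<Rightarrow> 'a \<Rightarrow> bool) \<Rightarrow> 'a set \<Rightarrow> bool" where
  "graph_connected E X \<longleftrightarrow>
     (\<forall>u\<in>X. \<forall>v\<in>X. (\<lambda>x y. x \<in> X \<and> y \<in> X \<and> E x y)\<^sup>*\<^sup>* u v)"

definition graph_component :: "('a \<Rightarrow> 'a \<Rightarrow> bool) \<Rightarrow> 'a set \<Rightarrow> 'a set \<Rightarrow> bool" where
  "graph_component E V K \<longleftrightarrow> K \<noteq> {} \<and> K \<subseteq> V \<and> graph_connected E K \<and>
     (\<forall>K'. K \<subseteq> K' \<and> K' \<subseteq> V \<and> graph_connected E K' \<longrightarrow> K' = K)"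

definition connected_in :: "'a trigraph \<Rightarrow> 'a set \<Rightarrow> bool" where
  "connected_in T X \<longleftrightarrow> graph_connected (adjacent T) X"

definition anticonnected_in :: "'a trigraph \<Rightarrow> 'a set \<Rightarrow> bool" where
  "anticonnected_in T X \<longleftrightarrow>
     graph_connected (\<lambda>u v. u \<noteq> v \<and> \<not> strongly_adjacent T u v) X"

definition component :: "'a trigraph \<Rightarrow> 'a set \<Rightarrow> bool" where
  "component T K \<longleftrightarrow> graph_component (adjacent T) (verts T) K"


text \<open>A path or hole is the list of its vertices in order; a path given by \<open>p\<close> has length
  \<open>length p - 1\<close> and interior \<open>interior p\<close>.\<close>

definition path :: "'a trigraph \<Rightarrow> 'a list \<Rightarrow> bool" where
  "path T p \<longleftrightarrow> p \<noteq> [] \<and> distinct p \<and> set p \<subseteq> verts T \<and>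
     (\<forall>i j. i < j \<and> j < length p \<longrightarrow>
        (if j = i + 1 then adjacent T (p ! i) (p ! j) else antiadjacent T (p ! i) (p ! j)))"

definition antipath :: "'a trigraph \<Rightarrow> 'a list \<Rightarrow> bool" where
  "antipath T p \<longleftrightarrow> path (complement T) p"

definition plength :: "'a list \<Rightarrow> nat" where
  "plength p = length p - 1"

definition interior :: "'a list \<Rightarrow> 'a set" where
  "interior p = set (butlast (tl p))"

text \<open>Both conditions are the weak ones, as for paths: a switchable pair may occur as an edge as
  well as a non-edge of a hole.\<close>

definition hole :: "'a trigraph \<Rightarrow> 'a list \<Rightarrow> bool" where
  "hole T h \<longleftrightarrow> length h \<ge> 4 \<and> distinct h \<and> set h \<subseteq> verts T \<and>
     (\<forall>i j. i < j \<and> j < length h \<longrightarrow>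
        (if j - i \<in> {1, length h - 1} then adjacent T (h ! i) (h ! j)
         else antiadjacent T (h ! i) (h ! j)))"

definition antihole :: "'a trigraph \<Rightarrow> 'a list \<Rightarrow> bool" where
  "antihole T h \<longleftrightarrow> hole (complement T) h"

definition Berge :: "'a trigraph \<Rightarrow> bool" where
  "Berge T \<longleftrightarrow> \<not> (\<exists>h. hole T h \<and> odd (length h)) \<and> \<not> (\<exists>h. antihole T h \<and> odd (length h))"


definition skew_partition :: "'a trigraph \<Rightarrow> 'a set \<Rightarrow> 'a set \<Rightarrow> bool" where
  "skew_partition T A B \<longleftrightarrow> A \<union> B = verts T \<and> A \<inter> B = {} \<and>
     \<not> connected_in T A \<and> \<not> anticonnected_in T B"

definition balanced_skew_partition :: "'a trigraph \<Rightarrow> 'a set \<Rightarrow> 'a set \<Rightarrow> bool" where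
  "balanced_skew_partition T A B \<longleftrightarrow> skew_partition T A B \<and>
     \<not> (\<exists>p. path T p \<and> odd (plength p) \<and> plength p > 1 \<and>
          hd p \<in> B \<and> last p \<in> B \<and> interior p \<subseteq> A) \<and>
     \<not> (\<exists>p. antipath T p \<and> odd (plength p) \<and> plength p > 1 \<and>
          hd p \<in> A \<and> last p \<in> A \<and> interior p \<subseteq> B)"

definition has_balanced_skew_partition :: "'a trigraph \<Rightarrow> bool" where
  "has_balanced_skew_partition T \<longleftrightarrow> (\<exists>A B. balanced_skew_partition T A B)"


definition class_F :: "'a trigraph set" where
  "class_F = {T. trigraph T \<and> Berge T \<and>
     (\<forall>K. graph_component (switchable T) (verts T) K \<longrightarrow>
        card {{u, v} | u v. u \<in> K \<and> v \<in> K \<and> switchable T u v} \<le> 2) \<and>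
     (\<forall>v\<in>verts T. \<forall>x y. x \<noteq> y \<and> {w. switchable T v w} = {x, y} \<longrightarrow>
        strongly_complete T v (verts T - {v, x, y}) \<and> strongly_adjacent T x y \<or>
        strongly_anticomplete T v (verts T - {v, x, y}) \<and> strongly_antiadjacent T x y)}"


definition two_join_side :: "'a trigraph \<Rightarrow> 'a set \<Rightarrow> 'a set \<Rightarrow> 'a set \<Rightarrow> 'a set \<Rightarrow> bool" where
  "two_join_side T X A B C \<longleftrightarrow> X = A \<union> B \<union> C \<and>
     A \<inter> B = {} \<and> A \<inter> C = {} \<and> B \<inter> C = {} \<and> A \<noteq> {} \<and> B \<noteq> {} \<and> card X \<ge> 3 \<and>
     (\<forall>a b. A = {a} \<and> B = {b} \<longrightarrow>
        \<not> (\<exists>p. path (full_realization (induced T X)) p \<and> set p = X \<and> plength p = 2 \<and>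
              hd p = a \<and> last p = b))"

definition two_join :: "'a trigraph \<Rightarrow> 'a set \<Rightarrow> 'a set \<Rightarrow>
    'a set \<Rightarrow> 'a set \<Rightarrow> 'a set \<Rightarrow> 'a set \<Rightarrow> 'a set \<Rightarrow> 'a set \<Rightarrow> bool" where
  "two_join T X1 X2 A1 B1 C1 A2 B2 C2 \<longleftrightarrow>
     X1 \<union> X2 = verts T \<and> X1 \<inter> X2 = {} \<and>
     two_join_side T X1 A1 B1 C1 \<and> two_join_side T X2 A2 B2 C2 \<and>
     (\<forall>x\<in>X1. \<forall>y\<in>X2. \<not> switchable T x y) \<and>
     (\<forall>x\<in>A1. strongly_complete T x A2) \<and>
     (\<forall>x\<in>B1. strongly_complete T x B2) \<and>
     (\<forall>x\<in>X1. \<forall>y\<in>X2. \<not> (x \<in> A1 \<and> y \<in> A2) \<and> \<not> (x \<in> B1 \<and> y \<in> B2) \<longrightarrow>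
        strongly_antiadjacent T x y)"

definition proper_two_join :: "'a trigraph \<Rightarrow> 'a set \<Rightarrow> 'a set \<Rightarrow>
    'a set \<Rightarrow> 'a set \<Rightarrow> 'a set \<Rightarrow> 'a set \<Rightarrow> 'a set \<Rightarrow> 'a set \<Rightarrow> bool" where
  "proper_two_join T X1 X2 A1 B1 C1 A2 B2 C2 \<longleftrightarrow>
     two_join T X1 X2 A1 B1 C1 A2 B2 C2 \<and>
     (\<forall>K. component (induced T X1) K \<longrightarrow> K \<inter> A1 \<noteq> {} \<and> K \<inter> B1 \<noteq> {}) \<and>
     (\<forall>K. component (induced T X2) K \<longrightarrow> K \<inter> A2 \<noteq> {} \<and> K \<inter> B2 \<noteq> {})"

definition proper_complement_two_join :: "'a trigraph \<Rightarrow> 'a set \<Rightarrow> 'a set \<Rightarrow>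
    'a set \<Rightarrow> 'a set \<Rightarrow> 'a set \<Rightarrow> 'a set \<Rightarrow> 'a set \<Rightarrow> 'a set \<Rightarrow> bool" where
  "proper_complement_two_join T X1 X2 A1 B1 C1 A2 B2 C2 \<longleftrightarrow>
     proper_two_join (complement T) X1 X2 A1 B1 C1 A2 B2 C2"

definition side_path :: "'a trigraph \<Rightarrow> 'a set \<Rightarrow> 'a set \<Rightarrow> 'a set \<Rightarrow> 'a list \<Rightarrow> bool" where
  "side_path T A B C p \<longleftrightarrow> path T p \<and> hd p \<in> A \<and> last p \<in> B \<and> interior p \<subseteq> C"

text \<open>For a proper 2-join of a Berge trigraph side paths exist and all of them have the same
  parity, so that exactly one of the following two predicates holds.\<close>

definition odd_split :: "'a trigraph \<Rightarrow>
    'a set \<Rightarrow> 'a set \<Rightarrow> 'a set \<Rightarrow> 'a set \<Rightarrow> 'a set \<Rightarrow> 'a set \<Rightarrow> bool" where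
  "odd_split T A1 B1 C1 A2 B2 C2 \<longleftrightarrow>
     (\<forall>p. side_path T A1 B1 C1 p \<or> side_path T A2 B2 C2 p \<longrightarrow> odd (plength p))"

definition even_split :: "'a trigraph \<Rightarrow>
    'a set \<Rightarrow> 'a set \<Rightarrow> 'a set \<Rightarrow> 'a set \<Rightarrow> 'a set \<Rightarrow> 'a set \<Rightarrow> bool" where
  "even_split T A1 B1 C1 A2 B2 C2 \<longleftrightarrow>
     (\<forall>p. side_path T A1 B1 C1 p \<or> side_path T A2 B2 C2 p \<longrightarrow> even (plength p))"


definition complete_outside :: "'a trigraph \<Rightarrow> 'a set \<Rightarrow> 'a set \<Rightarrow> 'a set \<Rightarrow> 'a set" where
  "complete_outside T A B S = {v \<in> verts T - (A \<union> B). strongly_complete T v S}"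

definition anticomplete_outside :: "'a trigraph \<Rightarrow> 'a set \<Rightarrow> 'a set \<Rightarrow> 'a set \<Rightarrow> 'a set" where
  "anticomplete_outside T A B S = {v \<in> verts T - (A \<union> B). strongly_anticomplete T v S}"

definition homogeneous_pair_split :: "'a trigraph \<Rightarrow> 'a set \<Rightarrow> 'a set \<Rightarrow>
    'a set \<Rightarrow> 'a set \<Rightarrow> 'a set \<Rightarrow> 'a set \<Rightarrow> bool" where
  "homogeneous_pair_split T A B C D E F \<longleftrightarrow>
     C = complete_outside T A B A \<inter> anticomplete_outside T A B B \<and>
     D = anticomplete_outside T A B A \<inter> complete_outside T A B B \<and>
     E = complete_outside T A B A \<inter> complete_outside T A B B \<and>
     F = anticomplete_outside T A B A \<inter> anticomplete_outside T A B B"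

definition proper_homogeneous_pair :: "'a trigraph \<Rightarrow> 'a set \<Rightarrow> 'a set \<Rightarrow> bool" where
  "proper_homogeneous_pair T A B \<longleftrightarrow>
     A \<subseteq> verts T \<and> B \<subseteq> verts T \<and> A \<noteq> {} \<and> B \<noteq> {} \<and> A \<inter> B = {} \<and> card A > 1 \<and> card B > 1 \<and>
     complete_outside T A B A \<union> anticomplete_outside T A B A = verts T - (A \<union> B) \<and>
     complete_outside T A B B \<union> anticomplete_outside T A B B = verts T - (A \<union> B) \<and>
     (\<forall>a\<in>A. (\<exists>b\<in>B. adjacent T a b) \<and> (\<exists>b\<in>B. antiadjacent T a b)) \<and>
     (\<forall>b\<in>B. (\<exists>a\<in>A. adjacent T b a) \<and> (\<exists>a\<in>A. antiadjacent T b a)) \<and>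
     (\<forall>C D E F. homogeneous_pair_split T A B C D E F \<longrightarrow>
        C \<noteq> {} \<and> D \<noteq> {} \<and> E \<noteq> {} \<and> F \<noteq> {})"


definition fragment :: "'a trigraph \<Rightarrow> 'a set \<Rightarrow> bool" where
  "fragment T X \<longleftrightarrow> X \<subseteq> verts T \<and>
     ((\<exists>A1 B1 C1 A2 B2 C2. proper_two_join T X (verts T - X) A1 B1 C1 A2 B2 C2) \<or>
      (\<exists>A1 B1 C1 A2 B2 C2. proper_complement_two_join T X (verts T - X) A1 B1 C1 A2 B2 C2) \<or>
      (\<exists>A B. proper_homogeneous_pair T A B \<and> (X = A \<union> B \<or> X = verts T - (A \<union> B))))"

text \<open>Blocks live on a disjoint sum, which makes the marker vertices new.\<close>

datatype marker = Ma | Mb | Mc | Md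

text \<open>\<open>T|X\<close> extended by the markers in \<open>M\<close>, where a marker \<open>m\<close> is strongly complete to \<open>N m\<close>,
  \<open>Sw\<close> and \<open>St\<close> are the switchable and the strongly adjacent pairs of markers, and all other
  new pairs are strongly antiadjacent.\<close>

fun marker_theta :: "'a trigraph \<Rightarrow> (marker \<Rightarrow> 'a set) \<Rightarrow> marker set set \<Rightarrow> marker set set \<Rightarrow>
    'a + marker \<Rightarrow> 'a + marker \<Rightarrow> int" where
  "marker_theta T N Sw St (Inl u) (Inl v) = theta T u v"
| "marker_theta T N Sw St (Inl u) (Inr m) = (if u \<in> N m then 1 else -1)"
| "marker_theta T N Sw St (Inr m) (Inl u) = (if u \<in> N m then 1 else -1)"
| "marker_theta T N Sw St (Inr m) (Inr n) =
     (if {m, n} \<in> Sw then 0 else if {m, n} \<in> St then 1 else -1)"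

definition add_markers :: "'a trigraph \<Rightarrow> 'a set \<Rightarrow> marker set \<Rightarrow> (marker \<Rightarrow> 'a set) \<Rightarrow>
    marker set set \<Rightarrow> marker set set \<Rightarrow> ('a + marker) trigraph" where
  "add_markers T X M N Sw St =
     \<lparr>verts = Inl ` (verts T \<inter> X) \<union> Inr ` M, theta = marker_theta T N Sw St\<rparr>"

text \<open>A set \<open>X\<close> may be a fragment in several ways, with different splits, so the blocks with
  respect to \<open>X\<close> are given by a relation.\<close>

inductive block :: "'a trigraph \<Rightarrow> 'a set \<Rightarrow> ('a + marker) trigraph \<Rightarrow> bool" for T where
  odd_two_join:
    "proper_two_join T X1 X2 A1 B1 C1 A2 B2 C2 \<Longrightarrow> odd_split T A1 B1 C1 A2 B2 C2 \<Longrightarrow>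
     block T X1 (add_markers T X1 {Ma, Mb}
       ((\<lambda>_. {})(Ma := A1, Mb := B1)) {{Ma, Mb}} {})"
| even_two_join:
    "proper_two_join T X1 X2 A1 B1 C1 A2 B2 C2 \<Longrightarrow> even_split T A1 B1 C1 A2 B2 C2 \<Longrightarrow>
     block T X1 (add_markers T X1 {Ma, Mb, Mc}
       ((\<lambda>_. {})(Ma := A1, Mb := B1)) {{Ma, Mc}, {Mc, Mb}} {})"
| odd_complement_two_join:
    "proper_complement_two_join T X1 X2 A1 B1 C1 A2 B2 C2 \<Longrightarrow>
     odd_split (complement T) A1 B1 C1 A2 B2 C2 \<Longrightarrow>
     block T X1 (add_markers T X1 {Ma, Mb}
       ((\<lambda>_. {})(Ma := B1 \<union> C1, Mb := A1 \<union> C1)) {{Ma, Mb}} {})"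
| even_complement_two_join:
    "proper_complement_two_join T X1 X2 A1 B1 C1 A2 B2 C2 \<Longrightarrow>
     even_split (complement T) A1 B1 C1 A2 B2 C2 \<Longrightarrow>
     block T X1 (add_markers T X1 {Ma, Mb, Mc}
       ((\<lambda>_. {})(Ma := B1 \<union> C1, Mb := A1 \<union> C1, Mc := X1)) {{Ma, Mc}, {Mc, Mb}} {{Ma, Mb}})"
| homogeneous_pair_inside:
    "proper_homogeneous_pair T A B \<Longrightarrow>
     block T (A \<union> B) (add_markers T (A \<union> B) {Mc, Md}
       ((\<lambda>_. {})(Mc := A, Md := B)) {{Mc, Md}} {})"
| homogeneous_pair_outside:
    "proper_homogeneous_pair T A B \<Longrightarrow> homogeneous_pair_split T A B C D E F \<Longrightarrow>
     X = C \<union> D \<union> E \<union> F \<Longrightarrow>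
     block T X (add_markers T X {Ma, Mb}
       ((\<lambda>_. {})(Ma := C \<union> E, Mb := D \<union> E)) {{Ma, Mb}} {})"

end

theory Submission
  imports Defs
begin

text \<open>A balanced skew-partition \<open>(P, Q)\<close> of the block is pulled back to \<open>T\<close>: every vertex outside
  the fragment is put on the side of a suitable marker. Markers joined by a switchable pair cannot lie
  in different parts of the same side, and a marker lying in \<open>P\<close> or \<open>Q\<close> forces the other part of
  that side into its non-neighbours or neighbours; this makes the pulled back pair a skew-partition.
  An odd path violating balance in \<open>T\<close> meets each class of vertices represented by a marker at most
  once, up to a run through the interior of one side of the 2-join that is replaced by a marker path of
  the same parity. It therefore yields an odd path violating balance in the block, except for some
  configurations that close up to an odd hole of \<open>T\<close>. Passing to complements handles complement
  2-joins and most of the antipaths.\<close>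

section \<open>Trigraphs, paths and complements\<close>

text \<open>The value 0 meets neither the condition \<open>-1\<close> between the two parts of
  \<open>P\<close> nor the condition \<open>1\<close> between the two parts of \<open>Q\<close>;
  this is why a switchable pair inside one side ties its ends to the same part. The obstacle is that
  a marker stands for a whole class of vertices, while a path may use it only once. Vertices of a
  class look alike from the other side of the decomposition, so a vertex through which a path enters
  or leaves the class is strongly adjacent to all of it, which leaves room for one member only. The
  argument fails when both ends of the path fall into one class, since their images coincide. There
  the block yields no path at all, and the contradiction has to come from \<open>T\<close>: a vertex
  off the path that is adjacent to its two ends and antiadjacent to its interior, or two side paths
  of different parity. A homogeneous pair of \<open>T\<close> is one of \<open>complement T\<close>,
  with complementary blocks, so antipaths come for free by duality. The complement of a 2-join is
  not a 2-join, hence antipaths need an argument of their own there.\<close>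

lemma adjacent_iff_theta:
  assumes "trigraph T"
  shows "adjacent T u v \<longleftrightarrow> vpair T u v \<and> theta T u v \<noteq> -1"
  using assms unfolding adjacent_def trigraph_def vpair_def by auto

lemma antiadjacent_iff_theta:
  assumes "trigraph T"
  shows "antiadjacent T u v \<longleftrightarrow> vpair T u v \<and> theta T u v \<noteq> 1"
  using assms unfolding antiadjacent_def trigraph_def vpair_def by auto

lemma theta_sym:
  "trigraph T \<Longrightarrow> u \<in> verts T \<Longrightarrow> v \<in> verts T \<Longrightarrow> theta T u v = theta T v u"
  unfolding trigraph_def by metis

lemma theta_complement [simp]: "theta (complement T) u v = - theta T u v"
  by (simp add: complement_def)

lemma verts_complement [simp]: "verts (complement T) = verts T"
  by (simp add: complement_def)

lemma complement_complement [simp]: "complement (complement T) = T"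
  by (simp add: complement_def)

lemma trigraph_complement: "trigraph T \<Longrightarrow> trigraph (complement T)"
  by (auto simp: trigraph_def)

lemma Berge_complement: "Berge T \<Longrightarrow> Berge (complement T)"
  by (auto simp: Berge_def antihole_def)

text \<open>Written with disequalities, both conditions leave the value 0 free, so that positions on
  a path can be read off from the values \<open>1\<close> and \<open>-1\<close> alone.\<close>

lemma path_iff_theta:
  assumes "trigraph T"
  shows "path T p \<longleftrightarrow> p \<noteq> [] \<and> distinct p \<and> set p \<subseteq> verts T \<and>
    (\<forall>i j. i < j \<and> j < length p \<longrightarrow>
      (j = Suc i \<longrightarrow> theta T (p ! i) (p ! j) \<noteq> -1) \<and>
      (j \<noteq> Suc i \<longrightarrow> theta T (p ! i) (p ! j) \<noteq> 1))" (is "_ \<longleftrightarrow> ?R")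
proof -
  have "vpair T (p ! i) (p ! j)" if "distinct p" "set p \<subseteq> verts T" "i < j" "j < length p" for i j
    using that unfolding vpair_def
    by (metis less_trans nat_neq_iff nth_eq_iff_index_eq nth_mem subsetD)
  then show ?thesis
    unfolding path_def adjacent_iff_theta[OF assms] antiadjacent_iff_theta[OF assms] by auto
qed

lemma path_nth_in_verts: "path T p \<Longrightarrow> i < length p \<Longrightarrow> p ! i \<in> verts T"
  unfolding path_def by (metis nth_mem subsetD)

lemma path_nth_eq: "path T p \<Longrightarrow> i < length p \<Longrightarrow> j < length p \<Longrightarrow> p ! i = p ! j \<Longrightarrow> i = j"
  unfolding path_def by (metis nth_eq_iff_index_eq)

text \<open>Most contradictions below arise here: a vertex strongly adjacent to two positions of a
  path must be next to both.\<close>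

lemma path_consecutive:
  assumes "trigraph T" "path T p" "i < length p" "j < length p" "i \<noteq> j"
    and "theta T (p ! i) (p ! j) = 1"
  shows "j = Suc i \<or> i = Suc j"
proof -
  have "theta T (p ! i) (p ! j) = theta T (p ! j) (p ! i)"
    using theta_sym[OF assms(1)] path_nth_in_verts[OF assms(2)] assms(3,4) by blast
  then show ?thesis
    using assms(2-6) unfolding path_iff_theta[OF assms(1)] by (metis linorder_neqE_nat)
qed

lemma path_not_consecutive:
  assumes "trigraph T" "path T p" "i < length p" "j < length p"
    and "theta T (p ! i) (p ! j) = -1"
  shows "j \<noteq> Suc i \<and> i \<noteq> Suc j"
proof -
  have "theta T (p ! i) (p ! j) = theta T (p ! j) (p ! i)"
    using theta_sym[OF assms(1)] path_nth_in_verts[OF assms(2)] assms(3,4) by blast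
  then show ?thesis
    using assms(2-5) unfolding path_iff_theta[OF assms(1)] by (metis lessI)
qed

lemma path_rev:
  assumes "trigraph T" "path T p"
  shows "path T (rev p)"
proof -
  have "(j = Suc i \<longrightarrow> theta T (rev p ! i) (rev p ! j) \<noteq> -1) \<and>
      (j \<noteq> Suc i \<longrightarrow> theta T (rev p ! i) (rev p ! j) \<noteq> 1)" if "i < j" "j < length p" for i j
  proof -
    have "length p - Suc i < length p" "length p - Suc j < length p" using that by linarith+
    moreover have "length p - Suc i = Suc (length p - Suc j) \<longleftrightarrow> j = Suc i"
      "length p - Suc j \<noteq> Suc (length p - Suc i)" "length p - Suc i \<noteq> length p - Suc j"
      using that by linarith+
    ultimately show ?thesis
      using that path_consecutive[OF assms, of "length p - Suc i" "length p - Suc j"]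
        path_not_consecutive[OF assms, of "length p - Suc i" "length p - Suc j"]
      by (simp add: rev_nth) blast
  qed
  then show ?thesis
    using assms(2) unfolding path_iff_theta[OF assms(1)] by auto
qed

lemma path_take_drop:
  assumes "path T p" "i \<le> j" "j < length p"
  shows "path T (take (Suc (j - i)) (drop i p))"
proof -
  have "set (take (Suc (j - i)) (drop i p)) \<subseteq> set p"
    by (meson order_trans set_drop_subset set_take_subset)
  then show ?thesis
    using assms unfolding path_def by auto
qed

text \<open>A switchable pair may serve both as an edge and as a non-edge, so it may stand in for any
  pair.\<close>

definition compatible :: "'a trigraph \<Rightarrow> 'b trigraph \<Rightarrow> ('a \<Rightarrow> 'b) \<Rightarrow> 'a set \<Rightarrow> bool" where
  "compatible T T' \<phi> S \<longleftrightarrow> (\<forall>u\<in>S. \<phi> u \<in> verts T') \<and>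
     (\<forall>u\<in>S. \<forall>v\<in>S. u \<noteq> v \<longrightarrow> \<phi> u \<noteq> \<phi> v \<and>
        (theta T' (\<phi> u) (\<phi> v) = theta T u v \<or> theta T' (\<phi> u) (\<phi> v) = 0))"

lemma compatible_complement:
  "compatible T T' \<phi> S \<Longrightarrow> compatible (complement T) (complement T') \<phi> S"
  by (auto simp: compatible_def)

text \<open>Every pair keeps its value or gets the value 0, and 0 meets the conditions for
  consecutive and for non-consecutive vertices.\<close>

lemma path_map_compatible:
  assumes "trigraph T" "trigraph T'" "path T p" "compatible T T' \<phi> (set p)"
  shows "path T' (map \<phi> p)"
proof -
  have inj: "inj_on \<phi> (set p)"
    using assms(4) unfolding compatible_def inj_on_def by auto
  have "(j = Suc i \<longrightarrow> theta T' (map \<phi> p ! i) (map \<phi> p ! j) \<noteq> -1) \<and>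
      (j \<noteq> Suc i \<longrightarrow> theta T' (map \<phi> p ! i) (map \<phi> p ! j) \<noteq> 1)" if "i < j" "j < length p" for i j
  proof -
    have "p ! i \<in> set p" "p ! j \<in> set p" "p ! i \<noteq> p ! j"
      using that path_nth_eq[OF assms(3), of i j] by auto
    then have "theta T' (\<phi> (p ! i)) (\<phi> (p ! j)) \<in> {theta T (p ! i) (p ! j), 0}"
      using assms(4) unfolding compatible_def by blast
    moreover have "(j = Suc i \<longrightarrow> theta T (p ! i) (p ! j) \<noteq> -1) \<and>
        (j \<noteq> Suc i \<longrightarrow> theta T (p ! i) (p ! j) \<noteq> 1)"
      using assms(3) that unfolding path_iff_theta[OF assms(1)] by blast
    ultimately show ?thesis using that by auto
  qed
  moreover have "set (map \<phi> p) \<subseteq> verts T'"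
    using assms(4) unfolding compatible_def by auto
  moreover have "map \<phi> p \<noteq> []" "distinct (map \<phi> p)"
    using assms(3) inj unfolding path_def by (auto simp: distinct_map)
  ultimately show ?thesis
    unfolding path_iff_theta[OF assms(2)] length_map by blast
qed

section \<open>Balanced skew-partitions\<close>

text \<open>The path that balance forbids: odd length above one means an even number of at least
  four vertices. The forbidden antipath is \<open>odd_span (complement T) Q P\<close>, so one
  predicate serves both halves of the definition.\<close>

definition odd_span :: "'a trigraph \<Rightarrow> 'a set \<Rightarrow> 'a set \<Rightarrow> 'a list \<Rightarrow> bool" where
  "odd_span T P Q p \<longleftrightarrow> path T p \<and> even (length p) \<and> 4 \<le> length p \<and>
     p ! 0 \<in> Q \<and> p ! (length p - 1) \<in> Q \<and> (\<forall>i. 0 < i \<and> i < length p - 1 \<longrightarrow> p ! i \<in> P)"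

text \<open>A witness that \<open>P1 \<union> P2\<close> is not connected. Over
  \<open>complement T\<close> the values become \<open>1\<close>, and it witnesses that the union is
  not anticonnected.\<close>

definition separated :: "'a trigraph \<Rightarrow> 'a set \<Rightarrow> 'a set \<Rightarrow> bool" where
  "separated T P1 P2 \<longleftrightarrow> P1 \<noteq> {} \<and> P2 \<noteq> {} \<and> P1 \<inter> P2 = {} \<and>
     (\<forall>u\<in>P1. \<forall>v\<in>P2. theta T u v = -1)"

lemma interior_subset_iff:
  "interior p \<subseteq> S \<longleftrightarrow> (\<forall>i. 0 < i \<and> i < length p - 1 \<longrightarrow> p ! i \<in> S)"
proof
  assume L: "interior p \<subseteq> S"
  show "\<forall>i. 0 < i \<and> i < length p - 1 \<longrightarrow> p ! i \<in> S"
  proof (intro allI impI)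
    fix i assume i: "0 < i \<and> i < length p - 1"
    then have "i - 1 < length (butlast (tl p))" by auto
    then have "butlast (tl p) ! (i - 1) \<in> interior p"
      unfolding interior_def using nth_mem by blast
    moreover have "butlast (tl p) ! (i - 1) = p ! i"
      using i by (auto simp: nth_butlast nth_tl)
    ultimately show "p ! i \<in> S" using L by auto
  qed
next
  assume R: "\<forall>i. 0 < i \<and> i < length p - 1 \<longrightarrow> p ! i \<in> S"
  show "interior p \<subseteq> S"
  proof
    fix x assume "x \<in> interior p"
    then obtain i where i: "i < length (butlast (tl p))" "butlast (tl p) ! i = x"
      unfolding interior_def by (metis in_set_conv_nth)
    then have "p ! Suc i = x" by (auto simp: nth_butlast nth_tl)
    then show "x \<in> S" using R i(1) by auto
  qed
qed

lemma odd_span_iff: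
  "odd_span T P Q p \<longleftrightarrow> path T p \<and> odd (plength p) \<and> plength p > 1 \<and>
     hd p \<in> Q \<and> last p \<in> Q \<and> interior p \<subseteq> P"
proof (cases "p = []")
  case True
  then show ?thesis by (simp add: odd_span_def path_def)
next
  case False
  obtain n where n: "length p = Suc n" using False by (cases p) auto
  have "even (length p) \<and> 4 \<le> length p \<longleftrightarrow> odd (plength p) \<and> plength p > 1"
    unfolding plength_def n by (simp, presburger)
  then show ?thesis
    using False unfolding odd_span_def interior_subset_iff
    by (auto simp: hd_conv_nth last_conv_nth)
qed

lemma odd_span_rev:
  assumes "trigraph T" "odd_span T P Q p"
  shows "odd_span T P Q (rev p)"
proof -
  have "rev p ! i \<in> P" if "0 < i" "i < length p - 1" for i
  proof -
    have "0 < length p - Suc i" "length p - Suc i < length p - 1" using that by linarith+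
    then show ?thesis using assms(2) that unfolding odd_span_def by (simp add: rev_nth)
  qed
  then show ?thesis
    using assms path_rev unfolding odd_span_def by (auto simp: rev_nth)
qed

lemma odd_span_map:
  assumes "trigraph T" "trigraph T'" "odd_span T P Q p" "compatible T T' \<phi> (set p)"
    and "\<And>x. x \<in> P \<Longrightarrow> \<phi> x \<in> P'" "\<And>x. x \<in> Q \<Longrightarrow> \<phi> x \<in> Q'"
  shows "odd_span T' P' Q' (map \<phi> p)"
proof -
  have p: "path T p" "even (length p)" "4 \<le> length p" "p ! 0 \<in> Q" "p ! (length p - 1) \<in> Q"
    "\<And>i. 0 < i \<Longrightarrow> i < length p - 1 \<Longrightarrow> p ! i \<in> P" using assms(3) unfolding odd_span_def by auto
  have "path T' (map \<phi> p)" by (rule path_map_compatible[OF assms(1,2) p(1) assms(4)])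
  moreover have "map \<phi> p ! i = \<phi> (p ! i)" if "i < length p" for i using that by simp
  moreover have "0 < length p" "length p - 1 < length p" using p(3) by linarith+
  moreover have "i < length p" if "i < length p - 1" for i using that by linarith
  ultimately show ?thesis using p assms(5,6) unfolding odd_span_def length_map by metis
qed

text \<open>The list \<open>w # p\<close> would be a hole, and \<open>length p + 1\<close> is
  odd.\<close>

lemma Berge_no_closing_vertex:
  assumes T: "trigraph T" "Berge T" and p: "odd_span T P Q p"
    and w: "w \<in> verts T" "w \<notin> set p"
    and ends: "theta T w (p ! 0) \<noteq> -1" "theta T w (p ! (length p - 1)) \<noteq> -1"
    and mid: "\<And>i. 0 < i \<Longrightarrow> i < length p - 1 \<Longrightarrow> theta T w (p ! i) \<noteq> 1"
  shows False
proof -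
  have pp: "path T p" "even (length p)" "4 \<le> length p" using p unfolding odd_span_def by auto
  have "if j - i \<in> {1, length (w # p) - 1} then adjacent T ((w # p) ! i) ((w # p) ! j)
         else antiadjacent T ((w # p) ! i) ((w # p) ! j)" if ij: "i < j" "j < length (w # p)" for i j
  proof (cases i)
    case 0
    obtain k where k: "j = Suc k" using ij by (cases j) auto
    have "vpair T w (p ! k)"
      using w ij k path_nth_in_verts[OF pp(1), of k] nth_mem[of k p] unfolding vpair_def by force
    moreover have "j - i \<in> {1, length (w # p) - 1} \<longleftrightarrow> k = 0 \<or> k = length p - 1"
      using 0 k ij pp(3) by auto
    moreover have "theta T w (p ! k) \<noteq> 1" if "k \<noteq> 0" "k \<noteq> length p - 1"
      using mid[of k] that k ij by simp
    ultimately show ?thesis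
      using 0 k ends unfolding adjacent_iff_theta[OF T(1)] antiadjacent_iff_theta[OF T(1)]
      by auto
  next
    case (Suc l)
    obtain k where k: "j = Suc k" using ij by (cases j) auto
    \<comment> \<open>Two positions of \<open>p\<close> never differ by \<open>length p\<close>, so
      the wrap-around pair of the hole occurs only between \<open>w\<close> and the last
      vertex.\<close>
    have "k - l \<in> {1, length p} \<longleftrightarrow> k = l + 1" using Suc k ij by auto
    then show ?thesis
      using pp(1) Suc k ij unfolding path_def by auto
  qed
  moreover have "4 \<le> length (w # p)" "distinct (w # p)" "set (w # p) \<subseteq> verts T"
    using pp w unfolding path_def by auto
  ultimately have "hole T (w # p)" unfolding hole_def by blast
  then show False using T(2) pp(2) unfolding Berge_def by auto
qed

section \<open>Skew-partitions expressed by separated parts\<close>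

lemma not_graph_connected_iff:
  assumes "\<And>u v. E u v \<Longrightarrow> E v u"
  shows "\<not> graph_connected E X \<longleftrightarrow>
    (\<exists>X1 X2. X = X1 \<union> X2 \<and> X1 \<noteq> {} \<and> X2 \<noteq> {} \<and> X1 \<inter> X2 = {} \<and> (\<forall>u\<in>X1. \<forall>v\<in>X2. \<not> E u v))"
    (is "_ \<longleftrightarrow> ?R")
proof
  let ?E = "\<lambda>x y. x \<in> X \<and> y \<in> X \<and> E x y"
  assume "\<not> graph_connected E X"
  then obtain u v where uv: "u \<in> X" "v \<in> X" "\<not> ?E\<^sup>*\<^sup>* u v"
    unfolding graph_connected_def by auto
  define X1 where "X1 = {w\<in>X. ?E\<^sup>*\<^sup>* u w}"
  have "\<not> E x y" if "x \<in> X1" "y \<in> X - X1" for x y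
    using that unfolding X1_def by (auto dest: rtranclp.rtrancl_into_rtrancl)
  moreover have "u \<in> X1" "v \<in> X - X1" "X = X1 \<union> (X - X1)" using uv unfolding X1_def by auto
  ultimately show ?R by blast
next
  assume ?R
  then obtain X1 X2 u v where X: "X = X1 \<union> X2" "u \<in> X1" "v \<in> X2" "X1 \<inter> X2 = {}"
    "\<forall>u\<in>X1. \<forall>v\<in>X2. \<not> E u v" by auto
  have "w \<in> X1" if "(\<lambda>x y. x \<in> X \<and> y \<in> X \<and> E x y)\<^sup>*\<^sup>* u w" for w
    using that by induction (use X in auto)
  then show "\<not> graph_connected E X" using X unfolding graph_connected_def by blast
qed

lemma not_connected_in_iff:
  assumes "trigraph T" "P \<subseteq> verts T"
  shows "\<not> connected_in T P \<longleftrightarrow> (\<exists>P1 P2. P = P1 \<union> P2 \<and> separated T P1 P2)"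
proof -
  have "adjacent T u v \<Longrightarrow> adjacent T v u" for u v
    using assms(1) theta_sym[OF assms(1), of u v] unfolding adjacent_def vpair_def by auto
  then have *: "\<not> connected_in T P \<longleftrightarrow> (\<exists>X1 X2. P = X1 \<union> X2 \<and> X1 \<noteq> {} \<and> X2 \<noteq> {} \<and> X1 \<inter> X2 = {} \<and>
      (\<forall>u\<in>X1. \<forall>v\<in>X2. \<not> adjacent T u v))"
    unfolding connected_in_def by (rule not_graph_connected_iff)
  have theta: "(\<forall>u\<in>X1. \<forall>v\<in>X2. \<not> adjacent T u v) \<longleftrightarrow> (\<forall>u\<in>X1. \<forall>v\<in>X2. theta T u v = -1)"
    if "P = X1 \<union> X2" "X1 \<inter> X2 = {}" for X1 X2
  proof -
    have "u \<noteq> v \<and> u \<in> verts T \<and> v \<in> verts T" if "u \<in> X1" "v \<in> X2" for u v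
      using that \<open>P = X1 \<union> X2\<close> \<open>X1 \<inter> X2 = {}\<close> assms(2) by auto
    then show ?thesis unfolding adjacent_iff_theta[OF assms(1)] vpair_def by blast
  qed
  show ?thesis unfolding * separated_def by (intro iff_exI conj_cong refl theta)
qed

lemma anticonnected_in_complement:
  assumes "trigraph T" "Q \<subseteq> verts T"
  shows "anticonnected_in T Q \<longleftrightarrow> connected_in (complement T) Q"
proof -
  have "(\<lambda>x y. x \<in> Q \<and> y \<in> Q \<and> x \<noteq> y \<and> \<not> strongly_adjacent T x y) =
        (\<lambda>x y. x \<in> Q \<and> y \<in> Q \<and> adjacent (complement T) x y)"
    using assms(2)
    unfolding adjacent_iff_theta[OF trigraph_complement[OF assms(1)]] strongly_adjacent_def vpair_def
    by (auto simp: fun_eq_iff)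
  then show ?thesis
    unfolding anticonnected_in_def connected_in_def graph_connected_def by simp
qed

lemma balanced_skew_partition_iff:
  assumes "trigraph T"
  shows "balanced_skew_partition T P Q \<longleftrightarrow> P \<union> Q = verts T \<and> P \<inter> Q = {} \<and>
    (\<exists>P1 P2. P = P1 \<union> P2 \<and> separated T P1 P2) \<and>
    (\<exists>Q1 Q2. Q = Q1 \<union> Q2 \<and> separated (complement T) Q1 Q2) \<and>
    (\<nexists>p. odd_span T P Q p) \<and> (\<nexists>p. odd_span (complement T) Q P p)"
proof -
  have "skew_partition T P Q \<longleftrightarrow> P \<union> Q = verts T \<and> P \<inter> Q = {} \<and>
    (\<exists>P1 P2. P = P1 \<union> P2 \<and> separated T P1 P2) \<and>
    (\<exists>Q1 Q2. Q = Q1 \<union> Q2 \<and> separated (complement T) Q1 Q2)"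
    unfolding skew_partition_def
    using not_connected_in_iff[OF assms, of P] anticonnected_in_complement[OF assms, of Q]
      not_connected_in_iff[OF trigraph_complement[OF assms], of Q, unfolded verts_complement]
    by (metis Un_upper1 Un_upper2)
  then show ?thesis
    unfolding balanced_skew_partition_def odd_span_iff antipath_def by blast
qed

lemma balanced_skew_partition_complement:
  assumes "trigraph T" "balanced_skew_partition T P Q"
  shows "balanced_skew_partition (complement T) Q P"
  using assms unfolding balanced_skew_partition_iff[OF assms(1)]
    balanced_skew_partition_iff[OF trigraph_complement[OF assms(1)]] complement_complement
  by (simp add: Un_commute Int_commute)

lemma has_balanced_skew_partition_complement:
  "trigraph T \<Longrightarrow> has_balanced_skew_partition (complement T) \<longleftrightarrow> has_balanced_skew_partition T"
  unfolding has_balanced_skew_partition_def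
  by (metis balanced_skew_partition_complement trigraph_complement complement_complement)

lemma separated_commute:
  assumes "trigraph T" "P1 \<union> P2 \<subseteq> verts T"
  shows "separated T P1 P2 \<longleftrightarrow> separated T P2 P1"
  using assms theta_sym[OF assms(1)] unfolding separated_def
  by (metis Int_commute le_sup_iff subsetD)

text \<open>Consecutive interior vertices are adjacent, so the interior cannot step from one part to
  the other.\<close>

lemma odd_span_interior_in_part:
  assumes "trigraph T" "odd_span T P Q p" "P = P1 \<union> P2" "P \<subseteq> verts T"
    and "\<forall>u\<in>P1. \<forall>v\<in>P2. theta T u v = -1"
  shows "(\<forall>i. 0 < i \<and> i < length p - 1 \<longrightarrow> p ! i \<in> P1) \<or>
         (\<forall>i. 0 < i \<and> i < length p - 1 \<longrightarrow> p ! i \<in> P2)"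
proof -
  have p: "path T p" "4 \<le> length p" and P: "\<And>i. 0 < i \<Longrightarrow> i < length p - 1 \<Longrightarrow> p ! i \<in> P1 \<union> P2"
    using assms(2,3) unfolding odd_span_def by auto
  have R: "\<forall>u\<in>R1. \<forall>v\<in>R2. theta T u v = -1 \<Longrightarrow>
      (\<And>i. 0 < i \<Longrightarrow> i < length p - 1 \<Longrightarrow> p ! i \<in> R1 \<union> R2) \<Longrightarrow> p ! 1 \<in> R1 \<Longrightarrow>
      Suc i < length p - 1 \<Longrightarrow> p ! Suc i \<in> R1" for R1 R2 i
  proof (induction i)
    case (Suc i)
    then have "p ! Suc i \<in> R1" by auto
    moreover have "theta T (p ! Suc i) (p ! Suc (Suc i)) \<noteq> -1"
      using path_not_consecutive[OF assms(1) p(1), of "Suc i" "Suc (Suc i)"] Suc.prems(4)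
      by linarith
    ultimately show ?case using Suc.prems(1) Suc.prems(2)[of "Suc (Suc i)"] Suc.prems(4) by blast
  qed simp
  have sym: "\<forall>u\<in>P2. \<forall>v\<in>P1. theta T u v = -1"
    using assms theta_sym[OF assms(1)] by (metis UnCI subsetD)
  have "p ! 1 \<in> P1 \<or> p ! 1 \<in> P2" using P[of 1] p(2) by auto
  then show ?thesis
  proof
    assume "p ! 1 \<in> P1"
    then have "p ! i \<in> P1" if "0 < i" "i < length p - 1" for i
      using R[of P1 P2 "i - 1"] assms(5) P that by auto
    then show ?thesis by blast
  next
    assume "p ! 1 \<in> P2"
    then have "p ! i \<in> P2" if "0 < i" "i < length p - 1" for i
      using R[of P2 P1 "i - 1"] sym P that by auto
    then show ?thesis by blast
  qed
qed

section \<open>Ends, entries into a vertex set, and concatenation of paths\<close>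

lemma rev_nth_0: "p \<noteq> [] \<Longrightarrow> rev p ! 0 = p ! (length p - 1)"
  by (simp add: rev_nth)

lemma rev_nth_last: "p \<noteq> [] \<Longrightarrow> rev p ! (length p - 1) = p ! 0"
  by (simp add: rev_nth)

lemma interior_eq_Diff:
  assumes "distinct p"
  shows "interior p = set p - {hd p, last p}"
proof (cases p rule: rev_cases)
  case (snoc q y)
  then show ?thesis using assms by (cases q) (auto simp: interior_def)
qed (simp add: interior_def)

text \<open>A form without indices, suited to paths that are assembled from several lists.\<close>

lemma odd_span_iff_Diff:
  "odd_span T P Q p \<longleftrightarrow> path T p \<and> even (length p) \<and> 4 \<le> length p \<and>
     hd p \<in> Q \<and> last p \<in> Q \<and> set p - {hd p, last p} \<subseteq> P"
proof (cases "path T p")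
  case True
  then have "p \<noteq> []" "distinct p" unfolding path_def by auto
  then show ?thesis
    unfolding odd_span_def interior_subset_iff[symmetric]
    by (simp add: interior_eq_Diff hd_conv_nth last_conv_nth)
qed (simp add: odd_span_def)

text \<open>All positions before \<open>i\<close> are outside \<open>H\<close>, so a strong
  neighbour of \<open>p ! (i - 1)\<close> on the path that lies in \<open>H\<close> can only be its
  successor. Hence a class inside \<open>H\<close> to which \<open>p ! (i - 1)\<close> is strongly
  complete is met at \<open>i\<close> or not at all.\<close>

lemma first_entry:
  assumes T: "trigraph T" and p: "path T p" "p ! 0 \<notin> H" and k: "k < length p" "p ! k \<in> H"
  obtains i where "0 < i" "i < length p" "p ! i \<in> H" "\<forall>l<i. p ! l \<notin> H"
    "theta T (p ! (i - 1)) (p ! i) \<noteq> -1"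
    "\<forall>l<length p. p ! l \<in> H \<longrightarrow> theta T (p ! (i - 1)) (p ! l) = 1 \<longrightarrow> l = i"
proof -
  define i where "i = (LEAST k. p ! k \<in> H)"
  have i: "p ! i \<in> H" "i \<le> k" unfolding i_def using k(2) by (auto intro: LeastI Least_le)
  have before: "\<forall>l<i. p ! l \<notin> H" unfolding i_def using not_less_Least by blast
  have "i \<noteq> 0" using i(1) p(2) by (cases i) auto
  then have i1: "i - 1 < length p" "i < length p" "0 < i" "Suc (i - 1) = i" "i - 1 < i"
    using i(2) k(1) by auto
  have theta: "theta T (p ! (i - 1)) (p ! i) \<noteq> -1"
    using path_not_consecutive[OF T p(1) i1(1,2)] i1(4) by auto
  have "l = i" if l: "l < length p" "p ! l \<in> H" "theta T (p ! (i - 1)) (p ! l) = 1" for l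
  proof -
    have "i - 1 \<noteq> l" using l(2) before i1(5) by blast
    then have "l = i \<or> i - 1 = Suc l" using path_consecutive[OF T p(1) i1(1) l(1) _ l(3)] i1(4) by auto
    moreover have "\<not> l < i" using before l(2) by blast
    ultimately show ?thesis using i1(3) by linarith
  qed
  then show ?thesis using that i1(2,3) i(1) before theta by blast
qed

lemma last_entry:
  assumes T: "trigraph T" and p: "path T p" "p ! (length p - 1) \<notin> H" and k: "k < length p" "p ! k \<in> H"
  obtains j where "Suc j < length p" "p ! j \<in> H" "\<forall>l<length p. j < l \<longrightarrow> p ! l \<notin> H"
    "theta T (p ! Suc j) (p ! j) \<noteq> -1"
    "\<forall>l<length p. p ! l \<in> H \<longrightarrow> theta T (p ! Suc j) (p ! l) = 1 \<longrightarrow> l = j"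
proof -
  have ne: "p \<noteq> []" using k by auto
  have mirror: "rev p ! (length p - Suc l) = p ! l" if "l < length p" for l
    using that by (simp add: rev_nth)
  have r0: "rev p ! 0 \<notin> H" using rev_nth_0[OF ne] p(2) by simp
  have k': "length p - Suc k < length (rev p)" "rev p ! (length p - Suc k) \<in> H"
    using k mirror[OF k(1)] by auto
  obtain i where i: "0 < i" "i < length (rev p)" "rev p ! i \<in> H" "\<forall>l<i. rev p ! l \<notin> H"
    "theta T (rev p ! (i - 1)) (rev p ! i) \<noteq> -1"
    "\<forall>l<length (rev p). rev p ! l \<in> H \<longrightarrow> theta T (rev p ! (i - 1)) (rev p ! l) = 1 \<longrightarrow> l = i"
    by (rule first_entry[OF T path_rev[OF T p(1)] r0 k']) (rule that)
  let ?j = "length p - Suc i"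
  have j: "Suc ?j < length p" "rev p ! i = p ! ?j" "rev p ! (i - 1) = p ! Suc ?j"
    using i(1,2) by (auto simp: rev_nth intro: arg_cong[where f = "(!) p"])
  have after: "\<forall>l<length p. ?j < l \<longrightarrow> p ! l \<notin> H"
  proof (intro allI impI)
    fix l assume l: "l < length p" "?j < l"
    then have "length p - Suc l < i" by linarith
    then show "p ! l \<notin> H" using i(4) mirror[OF l(1)] by metis
  qed
  have "\<forall>l<length p. p ! l \<in> H \<longrightarrow> theta T (p ! Suc ?j) (p ! l) = 1 \<longrightarrow> l = ?j"
  proof (intro allI impI)
    fix l assume l: "l < length p" "p ! l \<in> H" "theta T (p ! Suc ?j) (p ! l) = 1"
    have "length p - Suc l < length (rev p)" using l(1) by auto
    then have "length p - Suc l = i" using i(6) mirror[OF l(1)] j(3) l(2,3) by metis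
    then show "l = ?j" using l(1) by linarith
  qed
  then show ?thesis using that[of ?j] j after i(3,5) by metis
qed

text \<open>The path conditions on the pairs with one vertex in each list; the junction is the only
  edge among them.\<close>

definition linked :: "'a trigraph \<Rightarrow> 'a list \<Rightarrow> 'a list \<Rightarrow> bool" where
  "linked T p q \<longleftrightarrow> (\<forall>i<length p. \<forall>j<length q.
     theta T (p ! i) (q ! j) \<noteq> (if Suc i = length p \<and> j = 0 then -1 else 1))"

lemma path_append_iff:
  assumes "trigraph T"
  shows "path T (p @ q) \<longleftrightarrow> p @ q \<noteq> [] \<and> (p \<noteq> [] \<longrightarrow> path T p) \<and> (q \<noteq> [] \<longrightarrow> path T q) \<and>
    set p \<inter> set q = {} \<and> linked T p q"
proof -
  \<comment> \<open>\<open>W\<close> is the path condition on values alone; unlike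
    \<open>path\<close> it holds for the empty list, so empty pieces need no separate
    treatment.\<close>
  define W where "W r \<longleftrightarrow> (\<forall>i j. i < j \<longrightarrow> j < length r \<longrightarrow>
      theta T (r ! i) (r ! j) \<noteq> (if j = Suc i then -1 else 1))" for r
  have W: "path T r \<longleftrightarrow> r \<noteq> [] \<and> distinct r \<and> set r \<subseteq> verts T \<and> W r" for r
    unfolding path_iff_theta[OF assms] W_def by auto
  have W_Nil: "W []" unfolding W_def by simp
  have "W (p @ q) \<longleftrightarrow> W p \<and> W q \<and> linked T p q"
  proof
    assume L: "W (p @ q)"
    have "W p" unfolding W_def
    proof (intro allI impI)
      fix i j assume "i < j" "j < length p"
      then show "theta T (p ! i) (p ! j) \<noteq> (if j = Suc i then -1 else 1)"
        using L[unfolded W_def, rule_format, of i j] by (simp add: nth_append)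
    qed
    moreover have "W q" unfolding W_def
    proof (intro allI impI)
      fix i j assume "i < j" "j < length q"
      then show "theta T (q ! i) (q ! j) \<noteq> (if j = Suc i then -1 else 1)"
        using L[unfolded W_def, rule_format, of "length p + i" "length p + j"] by simp
    qed
    moreover have "linked T p q" unfolding linked_def
    proof (intro allI impI)
      fix i j assume ij: "i < length p" "j < length q"
      moreover have "length p + j = Suc i \<longleftrightarrow> Suc i = length p \<and> j = 0" using ij by auto
      ultimately show "theta T (p ! i) (q ! j) \<noteq> (if Suc i = length p \<and> j = 0 then -1 else 1)"
        using L[unfolded W_def, rule_format, of i "length p + j"] by (simp add: nth_append)
    qed
    ultimately show "W p \<and> W q \<and> linked T p q" by simp
  next
    assume R: "W p \<and> W q \<and> linked T p q"
    show "W (p @ q)" unfolding W_def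
    proof (intro allI impI)
      fix i j assume ij: "i < j" "j < length (p @ q)"
      consider "j < length p" | "i < length p" "length p \<le> j" | "length p \<le> i" by linarith
      then show "theta T ((p @ q) ! i) ((p @ q) ! j) \<noteq> (if j = Suc i then -1 else 1)"
      proof cases
        case 1
        then show ?thesis using R[unfolded W_def] ij by (simp add: nth_append)
      next
        case 2
        then have "j = Suc i \<longleftrightarrow> Suc i = length p \<and> j - length p = 0" by auto
        then show ?thesis
          using 2 ij R[unfolded linked_def, THEN conjunct2, THEN conjunct2, rule_format, of i "j - length p"]
          by (simp add: nth_append)
      next
        case 3
        then have "j = Suc i \<longleftrightarrow> j - length p = Suc (i - length p)" using ij by auto
        then show ?thesis
          using 3 ij R[unfolded W_def, THEN conjunct2, THEN conjunct1, rule_format,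
              of "i - length p" "j - length p"]
          by (simp add: nth_append)
      qed
    qed
  qed
  then show ?thesis unfolding W using W_Nil by auto
qed

section \<open>Blocks of 2-joins\<close>

text \<open>One setting for both parities; a complement 2-join enters with
  \<open>complement T\<close> in place of \<open>T\<close>. The list \<open>ms\<close> holds the
  inner vertices of the marker path from \<open>a\<close> to \<open>b\<close>: none for an odd
  2-join, one for an even 2-join. So \<open>a # ms @ [b]\<close> and a side path through
  \<open>X2\<close> have the same number of vertices modulo 2.\<close>

locale two_join_block =
  fixes T :: "'a trigraph" and X1 A1 B1 X2 A2 B2 C2 :: "'a set"
    and T' :: "'b trigraph" and f :: "'a \<Rightarrow> 'b" and a b :: 'b and ms :: "'b list"
  assumes T: "trigraph T" "Berge T"
    and verts_T: "verts T = X1 \<union> X2" and X12: "X1 \<inter> X2 = {}"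
    and X1: "A1 \<subseteq> X1" "B1 \<subseteq> X1" "A1 \<inter> B1 = {}" "A1 \<noteq> {}" "B1 \<noteq> {}"
    and X2: "X2 = A2 \<union> B2 \<union> C2" "A2 \<inter> B2 = {}" "A2 \<inter> C2 = {}" "B2 \<inter> C2 = {}" "A2 \<noteq> {}" "B2 \<noteq> {}"
    and cross: "\<And>x y. x \<in> X1 \<Longrightarrow> y \<in> X2 \<Longrightarrow>
      theta T x y = (if x \<in> A1 \<and> y \<in> A2 \<or> x \<in> B1 \<and> y \<in> B2 then 1 else -1)"
    and T': "trigraph T'" "verts T' = f ` X1 \<union> {a, b} \<union> set ms"
    and f: "inj_on f X1" "a \<notin> f ` X1" "b \<notin> f ` X1" "set ms \<inter> f ` X1 = {}"
    and markers: "a \<noteq> b" "a \<notin> set ms" "b \<notin> set ms"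
    and theta_f: "\<And>u v. u \<in> X1 \<Longrightarrow> v \<in> X1 \<Longrightarrow> u \<noteq> v \<Longrightarrow> theta T' (f u) (f v) = theta T u v"
    and theta_a: "\<And>u. u \<in> X1 \<Longrightarrow> theta T' a (f u) = (if u \<in> A1 then 1 else -1)"
    and theta_b: "\<And>u. u \<in> X1 \<Longrightarrow> theta T' b (f u) = (if u \<in> B1 then 1 else -1)"
    and theta_ms: "\<And>m u. m \<in> set ms \<Longrightarrow> u \<in> X1 \<Longrightarrow> theta T' m (f u) = -1"
    and length_ms: "length ms \<le> 1"
    and theta_ms_ab: "\<And>m. m \<in> set ms \<Longrightarrow> theta T' m a = 0 \<and> theta T' m b = 0"
    and theta_ab: "theta T' a b = (if ms = [] then 0 else -1)"
    and parity: "\<And>s. side_path T A2 B2 C2 s \<Longrightarrow> even (length s) \<longleftrightarrow> even (length ms)"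
begin

text \<open>Reduces the case \<open>b \<in> P\<close> to the case \<open>a \<in> P\<close>. Side
  paths have to be reversed for the parity assumption.\<close>

lemma swapped: "two_join_block T X1 B1 A1 X2 B2 A2 C2 T' f b a (rev ms)"
proof
  fix s assume s: "side_path T B2 A2 C2 s"
  then have "side_path T A2 B2 C2 (rev s)"
    using path_rev[OF T(1)] unfolding side_path_def
    by (auto simp: interior_eq_Diff path_def hd_rev last_rev)
  then show "even (length s) = even (length (rev ms))" using parity by fastforce
next
  show "theta T' b a = (if rev ms = [] then 0 else - 1)"
    using theta_ab theta_sym[OF T'(1), of a b] T'(2) by auto
qed (use T verts_T X12 X1 X2 cross T' f markers theta_f theta_a theta_b theta_ms length_ms
    theta_ms_ab in auto)

lemma cross':
  assumes "x \<in> X1" "y \<in> X2"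
  shows "theta T y x = (if x \<in> A1 \<and> y \<in> A2 \<or> x \<in> B1 \<and> y \<in> B2 then 1 else -1)"
  using cross[OF assms] theta_sym[OF T(1), of x y] assms verts_T by auto

lemma theta_X1_C2: "x \<in> X1 \<Longrightarrow> y \<in> C2 \<Longrightarrow> theta T x y = -1 \<and> theta T y x = -1"
  using cross[of x y] cross'[of x y] X2 by (auto split: if_splits)

lemma theta_X1_A2: "x \<in> X1 \<Longrightarrow> y \<in> A2 \<Longrightarrow> theta T x y = (if x \<in> A1 then 1 else -1)"
  using cross[of x y] X2 by auto

lemma theta_X1_B2: "x \<in> X1 \<Longrightarrow> y \<in> B2 \<Longrightarrow> theta T x y = (if x \<in> B1 then 1 else -1)"
  using cross[of x y] X2 by auto

lemma theta_a': "u \<in> X1 \<Longrightarrow> theta T' (f u) a = (if u \<in> A1 then 1 else -1)"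
  using theta_a[of u] theta_sym[OF T'(1), of a "f u"] T'(2) by auto

lemma theta_b': "u \<in> X1 \<Longrightarrow> theta T' (f u) b = (if u \<in> B1 then 1 else -1)"
  using theta_b[of u] theta_sym[OF T'(1), of b "f u"] T'(2) by auto

lemma theta_ms': "m \<in> set ms \<Longrightarrow> u \<in> X1 \<Longrightarrow> theta T' (f u) m = -1"
  using theta_ms[of m u] theta_sym[OF T'(1), of m "f u"] T'(2) by auto

text \<open>The marker for \<open>C2\<close> only records the side of the partition: \<open>a\<close> is always assumed to lie in
  \<open>P\<close> below, and paths through \<open>C2\<close> are contracted before \<open>phi\<close> is applied.\<close>

definition phi :: "'a \<Rightarrow> 'b" where
  "phi x = (if x \<in> X1 then f x else if x \<in> B2 then b else a)"

lemma phi_simps [simp]: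
  "x \<in> X1 \<Longrightarrow> phi x = f x" "x \<in> A2 \<Longrightarrow> phi x = a" "x \<in> B2 \<Longrightarrow> phi x = b" "x \<in> C2 \<Longrightarrow> phi x = a"
  using X12 X2 unfolding phi_def by auto

text \<open>In the odd case \<open>a\<close> and \<open>b\<close> are switchable. In the even case
  an adjacent pair between \<open>A2\<close> and \<open>B2\<close> would be a side path with a
  single edge.\<close>

lemma theta_A2_B2:
  assumes "x \<in> A2" "y \<in> B2"
  shows "theta T' a b = theta T x y \<or> theta T' a b = 0"
proof (cases "ms = []")
  case False
  then have m: "odd (length ms)" using length_ms by (cases ms) auto
  have xy: "x \<noteq> y" "x \<in> verts T" "y \<in> verts T" using assms X2 verts_T by auto
  have "theta T x y = -1"
  proof (rule ccontr)
    assume "theta T x y \<noteq> -1"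
    then have "path T [x, y]"
      unfolding path_iff_theta[OF T(1)] using xy by (auto simp: less_Suc_eq nth_Cons')
    then have "side_path T A2 B2 C2 [x, y]"
      using assms unfolding side_path_def by (simp add: interior_def)
    then show False using parity[of "[x, y]"] m by simp
  qed
  then show ?thesis using theta_ab by simp
qed (simp add: theta_ab)

text \<open>Vertices of \<open>X1\<close> see \<open>A2\<close> and \<open>B2\<close> as they see
  \<open>a\<close> and \<open>b\<close>. The uniqueness assumptions make \<open>phi\<close>
  injective on \<open>S\<close>.\<close>

lemma compatible_phi:
  assumes S: "S \<subseteq> verts T" "S \<inter> C2 = {}"
    and unique: "\<And>x y. x \<in> S \<inter> A2 \<Longrightarrow> y \<in> S \<inter> A2 \<Longrightarrow> x = y" "\<And>x y. x \<in> S \<inter> B2 \<Longrightarrow> y \<in> S \<inter> B2 \<Longrightarrow> x = y"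
  shows "compatible T T' phi S"
proof -
  have S': "x \<in> X1 \<or> x \<in> A2 \<or> x \<in> B2" if "x \<in> S" for x using that S verts_T X2(1) by auto
  have sym: "theta T x y = theta T y x" if "x \<in> S" "y \<in> S" for x y
    using theta_sym[OF T(1)] S that by blast
  have ba: "theta T' b a = theta T' a b" using theta_sym[OF T'(1), of a b] T'(2) by auto
  have "phi u \<noteq> phi v \<and> (theta T' (phi u) (phi v) = theta T u v \<or> theta T' (phi u) (phi v) = 0)"
    if uv: "u \<in> S" "v \<in> S" "u \<noteq> v" for u v
  proof -
    consider "u \<in> X1" "v \<in> X1" | "u \<in> X1" "v \<in> A2" | "u \<in> X1" "v \<in> B2" | "u \<in> A2" "v \<in> X1"
      | "u \<in> B2" "v \<in> X1" | "u \<in> A2" "v \<in> B2" | "u \<in> B2" "v \<in> A2"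
      using S'[OF uv(1)] S'[OF uv(2)] unique uv by blast
    then show ?thesis
    proof cases
      case 1 then show ?thesis using theta_f uv f(1) by (auto dest: inj_onD)
    next
      case 2
      then have "v \<in> X2" "v \<notin> B2" using X2 by auto
      then show ?thesis using 2 theta_a'[of u] cross[of u v] f(2) by auto
    next
      case 3
      then have "v \<in> X2" "v \<notin> A2" using X2 by auto
      then show ?thesis using 3 theta_b'[of u] cross[of u v] f(3) by auto
    next
      case 4
      then have "u \<in> X2" "u \<notin> B2" using X2 by auto
      then show ?thesis using 4 theta_a[of v] cross'[of v u] f(2) by auto
    next
      case 5
      then have "u \<in> X2" "u \<notin> A2" using X2 by auto
      then show ?thesis using 5 theta_b[of v] cross'[of v u] f(3) by auto
    next
      case 6 then show ?thesis using theta_A2_B2[of u v] markers by auto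
    next
      case 7 then show ?thesis using theta_A2_B2[of v u] markers ba sym[OF uv(1,2)] by auto
    qed
  qed
  moreover have "phi u \<in> verts T'" if "u \<in> S" for u
    using S'[OF that] T'(2) by auto
  ultimately show ?thesis unfolding compatible_def by blast
qed

section \<open>Replacing a run through the second side by the marker path\<close>

lemma path_markers: "path T' (a # ms @ [b])"
proof (cases ms)
  case Nil
  then show ?thesis
    unfolding path_iff_theta[OF T'(1)] using T'(2) markers theta_ab
    by (auto simp: less_Suc_eq nth_Cons')
next
  case (Cons c cs)
  then have ms: "ms = [c]" using length_ms by auto
  have "theta T' a c = 0" "theta T' c b = 0" "theta T' a b = -1"
    using ms theta_ms_ab[of c] theta_ab theta_sym[OF T'(1), of a c] T'(2) by auto
  then show ?thesis
    unfolding path_iff_theta[OF T'(1)] ms using T'(2) markers ms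
    by (auto simp: less_Suc_eq nth_Cons' numeral_2_eq_2)
qed

text \<open>Vertices of \<open>X1\<close> are strongly anticomplete to \<open>C2\<close> and to the
  inner markers, and they see the ends of \<open>s\<close> as they see \<open>a\<close> and
  \<open>b\<close>. So \<open>pre\<close> and \<open>post\<close> attach to the marker path exactly
  as they attach to \<open>s\<close>.\<close>

lemma contracted_path:
  assumes p: "path T (pre @ s @ post)" and X: "set pre \<subseteq> X1" "set post \<subseteq> X1"
    and s: "side_path T A2 B2 C2 s"
  shows "path T' (map f pre @ (a # ms @ [b]) @ map f post)"
proof -
  let ?m = "a # ms @ [b]"
  have s2: "s \<noteq> []" "hd s \<in> A2" "last s \<in> B2" using s unfolding side_path_def path_def by auto
  \<comment> \<open>The two ends of \<open>s\<close> are different vertices, so the conditions on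
    the first and on the last position can be used independently.\<close>
  then have "length s \<noteq> 1" using X2(2) by (cases s) auto
  then obtain n where n: "length s = Suc (Suc n)"
    using s2(1) by (metis One_nat_def length_0_conv not0_implies_Suc)
  have s0: "s ! 0 \<in> A2" "s ! 0 \<in> X2" "s ! 0 \<notin> B2" "s ! (length s - 1) \<in> B2"
    "s ! (length s - 1) \<in> X2" "s ! (length s - 1) \<notin> A2"
    using s2 X2 by (auto simp: hd_conv_nth last_conv_nth)
  have p1: "set pre \<inter> set (s @ post) = {}" "linked T pre (s @ post)" "path T (s @ post)"
    "pre \<noteq> [] \<Longrightarrow> path T pre"
    using p s2(1) unfolding path_append_iff[OF T(1), of pre] by auto
  then have p2: "set s \<inter> set post = {}" "linked T s post" "post \<noteq> [] \<Longrightarrow> path T post"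
    unfolding path_append_iff[OF T(1), of s] by auto
  have compat: "compatible T T' f S" if "S \<subseteq> X1" for S
  proof -
    have "f u \<noteq> f v \<and> theta T' (f u) (f v) = theta T u v" if "u \<in> S" "v \<in> S" "u \<noteq> v" for u v
      using theta_f[of u v] f(1) that \<open>S \<subseteq> X1\<close> by (auto dest: inj_onD)
    then show ?thesis using T'(2) that unfolding compatible_def by blast
  qed
  have pre': "map f pre \<noteq> [] \<longrightarrow> path T' (map f pre)"
    using path_map_compatible[OF T(1) T'(1) p1(4) compat[OF X(1)]] by auto
  have post': "map f post \<noteq> [] \<longrightarrow> path T' (map f post)"
    using path_map_compatible[OF T(1) T'(1) p2(3) compat[OF X(2)]] by auto
  have m_nth: "?m ! j \<in> (if j = 0 then {a} else if j = Suc (length ms) then {b} else set ms)"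
    if "j < length ?m" for j
    using that by (auto simp: nth_Cons' nth_append)
  have link2: "linked T' ?m (map f post)" unfolding linked_def
  proof (intro allI impI)
    fix i j assume i: "i < length ?m" and j: "j < length (map f post)"
    have y: "post ! j \<in> X1" using X(2) j by auto
    have c0: "theta T (s ! 0) (post ! j) \<noteq> 1" and
      c1: "theta T (s ! (length s - 1)) (post ! j) \<noteq> (if j = 0 then -1 else 1)"
      using p2(2)[unfolded linked_def, rule_format, of 0 j]
        p2(2)[unfolded linked_def, rule_format, of "length s - 1" j] n j by auto
    have "post ! j \<notin> A1" using c0 cross'[OF y s0(2)] s0 by auto
    moreover have "post ! j \<in> B1 \<longleftrightarrow> j = 0" using c1 cross'[OF y s0(5)] s0 by (auto split: if_splits)
    ultimately show "theta T' (?m ! i) (map f post ! j) \<noteq> (if Suc i = length ?m \<and> j = 0 then -1 else 1)"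
      using m_nth[OF i] i j theta_a[OF y] theta_b[OF y] theta_ms[of "?m ! i", OF _ y]
      by (auto split: if_splits)
  qed
  have link1: "linked T' (map f pre) (?m @ map f post)" unfolding linked_def
  proof (intro allI impI)
    fix i j assume i: "i < length (map f pre)" and j: "j < length (?m @ map f post)"
    have x: "pre ! i \<in> X1" using X(1) i by auto
    have c0: "theta T (pre ! i) (s ! 0) \<noteq> (if Suc i = length pre then -1 else 1)" and
      c1: "theta T (pre ! i) (s ! (length s - 1)) \<noteq> 1"
      using p1(2)[unfolded linked_def, rule_format, of i 0]
        p1(2)[unfolded linked_def, rule_format, of i "length s - 1"] n i s2(1)
      by (auto simp: nth_append)
    have "pre ! i \<notin> B1" using c1 cross[OF x s0(5)] s0 by auto
    moreover have "pre ! i \<in> A1 \<longleftrightarrow> Suc i = length pre"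
      using c0 cross[OF x s0(2)] s0 by (auto split: if_splits)
    moreover have "theta T' (f (pre ! i)) (f (post ! l)) \<noteq> 1" if l: "l < length post" for l
    proof -
      have "theta T (pre ! i) (post ! l) \<noteq> 1"
        using p1(2)[unfolded linked_def, rule_format, of i "length s + l"] i l s2(1)
        by (auto simp: nth_append)
      moreover have "pre ! i \<noteq> post ! l" using p1(1) i l by (auto dest!: nth_mem)
      moreover have "post ! l \<in> X1" using X(2) l by auto
      ultimately show ?thesis using theta_f[OF x, of "post ! l"] by auto
    qed
    ultimately show "theta T' (map f pre ! i) ((?m @ map f post) ! j) \<noteq>
        (if Suc i = length (map f pre) \<and> j = 0 then -1 else 1)"
      using m_nth[of j] i j theta_a'[OF x] theta_b'[OF x] theta_ms'[of "?m ! j", OF _ x]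
      by (cases "j < length ?m") (auto simp del: append_Cons simp: nth_append[of ?m] split: if_splits)
  qed
  have disj: "set (map f pre) \<inter> set (?m @ map f post) = {}" "set ?m \<inter> set (map f post) = {}"
  proof -
    have "f ` set pre \<inter> f ` set post = {}"
      using p1(1) X f(1) by (auto dest!: inj_onD)
    moreover have "set ?m \<inter> f ` X1 = {}" using f(2-4) by auto
    ultimately show "set (map f pre) \<inter> set (?m @ map f post) = {}" "set ?m \<inter> set (map f post) = {}"
      using X by (simp only: set_map set_append, blast)+
  qed
  have "path T' (?m @ map f post)"
    unfolding path_append_iff[OF T'(1), of ?m] using path_markers post' disj(2) link2 by simp
  then show ?thesis
    unfolding path_append_iff[OF T'(1), of "map f pre"] using pre' disj(1) link1 by simp
qed

text \<open>All neighbours of \<open>C2\<close> are in \<open>X2\<close>, so the vertices that bound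
  a maximal run through \<open>C2\<close> are in \<open>A2 \<union> B2\<close>.\<close>

lemma C2_run:
  assumes p: "path T p" "p ! 0 \<notin> C2" "p ! (length p - 1) \<notin> C2" and m: "m < length p" "p ! m \<in> C2"
  obtains i j where "i < m" "m < j" "j < length p" "p ! i \<in> A2 \<union> B2" "p ! j \<in> A2 \<union> B2"
    "\<And>k. i < k \<Longrightarrow> k < j \<Longrightarrow> p ! k \<in> C2"
proof -
  have nb: "p ! k \<in> X2" if "k < length p" "l < length p" "l = Suc k \<or> k = Suc l" "p ! l \<in> C2" for k l
  proof -
    have "theta T (p ! k) (p ! l) \<noteq> -1" using path_not_consecutive[OF T(1) p(1) that(1,2)] that(3) by auto
    then have "p ! k \<notin> X1" using theta_X1_C2[of "p ! k" "p ! l"] that(4) by auto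
    then show ?thesis using path_nth_in_verts[OF p(1) that(1)] verts_T by auto
  qed
  define I where "I = {k. k < m \<and> p ! k \<notin> C2}"
  define J where "J = {k. m < k \<and> k < length p \<and> p ! k \<notin> C2}"
  have "m \<noteq> 0" using m(2) p(2) by (cases m) auto
  moreover have "m \<noteq> length p - 1" using m(2) p(3) by auto
  ultimately have "0 \<in> I" "length p - 1 \<in> J" using p(2,3) m(1) unfolding I_def J_def by auto
  moreover have fin: "finite I" "finite J" unfolding I_def J_def by auto
  ultimately have IJ: "Max I \<in> I" "Min J \<in> J" using Max_in Min_in by blast+
  have run: "p ! k \<in> C2" if k: "Max I < k" "k < Min J" for k
  proof -
    have "k \<notin> I" "k \<notin> J" using k fin Max_ge Min_le by (metis leD)+
    moreover have "k < length p" using k IJ(2) unfolding J_def by auto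
    ultimately show ?thesis unfolding I_def J_def using m(2) by (cases "k = m") auto
  qed
  have lt: "Max I < m" "p ! Max I \<notin> C2" "m < Min J" "Min J < length p" "p ! Min J \<notin> C2"
    using IJ unfolding I_def J_def by auto
  have "p ! Max I \<in> X2" using nb[of "Max I" "Suc (Max I)"] run[of "Suc (Max I)"] lt m(1) by auto
  moreover have "p ! Min J \<in> X2" using nb[of "Min J" "Min J - 1"] run[of "Min J - 1"] lt by auto
  ultimately show ?thesis
    using that[of "Max I" "Min J"] lt run X2(1) by auto
qed

definition pull :: "'b set \<Rightarrow> 'a set" where
  "pull R = {x \<in> verts T. phi x \<in> R}"

text \<open>The run from \<open>i\<close> to \<open>j\<close> is a side path and everything else
  lies in \<open>X1\<close>, so exchanging the run for the marker path keeps the parity and the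
  sides of all vertices.\<close>

lemma contract_span_oriented:
  assumes p: "odd_span T (pull P) (pull Q) p" and ms: "set ms \<subseteq> P"
    and unique: "\<And>x y. x \<in> set p \<inter> A2 \<Longrightarrow> y \<in> set p \<inter> A2 \<Longrightarrow> x = y"
      "\<And>x y. x \<in> set p \<inter> B2 \<Longrightarrow> y \<in> set p \<inter> B2 \<Longrightarrow> x = y"
    and ends: "p ! 0 \<notin> C2" "p ! (length p - 1) \<notin> C2" "p ! 0 \<in> X1 \<or> p ! (length p - 1) \<in> X1"
    and ij: "i < j" "j < length p" "p ! i \<in> A2" "p ! j \<in> B2" "\<And>k. i < k \<Longrightarrow> k < j \<Longrightarrow> p ! k \<in> C2"
  shows "\<exists>p'. odd_span T' P Q p'"
proof -
  have pp: "path T p" "even (length p)" "4 \<le> length p" "hd p \<in> pull Q" "last p \<in> pull Q"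
    "set p - {hd p, last p} \<subseteq> pull P" using p unfolding odd_span_iff_Diff by auto
  define pre s post where "pre = take i p" and "s = take (Suc (j - i)) (drop i p)"
    and "post = drop (Suc j) p"
  have split: "p = pre @ s @ post"
  proof -
    have "s @ post = drop i p"
    proof -
      have "drop (Suc j) p = drop (Suc (j - i)) (drop i p)" using ij(1) by simp
      then show ?thesis unfolding s_def post_def by (metis append_take_drop_id)
    qed
    then show ?thesis unfolding pre_def by simp
  qed
  have ls: "length s = Suc (j - i)" using ij unfolding s_def by auto
  have s_nth: "s ! k = p ! (i + k)" if "k \<le> j - i" for k using that ij unfolding s_def by simp
  have path_s: "path T s" unfolding s_def using path_take_drop[OF pp(1)] ij by simp
  have "s \<noteq> []" using ls by auto
  then have s_ends: "hd s = p ! i" "last s = p ! j" "s \<noteq> []"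
    using ls s_nth[of 0] s_nth[of "j - i"] ij(1) hd_conv_nth[of s] last_conv_nth[of s] by auto
  have "interior s \<subseteq> C2" unfolding interior_subset_iff
  proof (intro allI impI)
    fix k assume "0 < k \<and> k < length s - 1"
    then show "s ! k \<in> C2" using s_nth[of k] ij(5)[of "i + k"] ls by auto
  qed
  then have side: "side_path T A2 B2 C2 s"
    unfolding side_path_def using path_s s_ends ij by simp
  have X1: "p ! k \<in> X1" if k: "k < length p" "k < i \<or> j < k" for k
  proof (rule ccontr)
    assume "p ! k \<notin> X1"
    then have k2: "p ! k \<in> A2 \<union> B2 \<union> C2" using path_nth_in_verts[OF pp(1) k(1)] verts_T X2(1) by auto
    have ij_eq: "l = i \<or> l = j" if "l < length p" "p ! l \<in> A2 \<union> B2" for l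
      using that unique[of "p ! l" "p ! i"] unique(2)[of "p ! l" "p ! j"] ij
        path_nth_eq[OF pp(1), of l i] path_nth_eq[OF pp(1), of l j] by auto
    \<comment> \<open>Another visit to \<open>X2\<close> would be a run through \<open>C2\<close>,
      bounded on both sides by vertices of \<open>A2 \<union> B2\<close>; but those occur only at
      \<open>i\<close> and \<open>j\<close>, which are not on opposite sides of
      \<open>k\<close>.\<close>
    then have "p ! k \<in> C2" using k2 k ij(1) by (metis Un_iff less_irrefl less_trans)
    then obtain i' j' where "i' < k" "k < j'" "j' < length p" "p ! i' \<in> A2 \<union> B2" "p ! j' \<in> A2 \<union> B2"
      using C2_run[OF pp(1) ends(1,2) k(1)] by metis
    then have "i' = i \<or> i' = j" "j' = i \<or> j' = j" using ij_eq by auto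
    then show False using \<open>i' < k\<close> \<open>k < j'\<close> k(2) ij(1) by auto
  qed
  have pre1: "set pre \<subseteq> X1"
    unfolding pre_def using X1 ij(1,2) by (auto simp: in_set_conv_nth)
  have post1: "set post \<subseteq> X1"
    unfolding post_def using X1 ij(1,2) by (auto simp: in_set_conv_nth)
  define p' where "p' = map f pre @ (a # ms @ [b]) @ map f post"
  have path': "path T' p'"
    unfolding p'_def using contracted_path[OF _ pre1 post1 side] pp(1) split by simp
  have phi_pre: "map f pre = map phi pre" and phi_post: "map f post = map phi post"
    using pre1 post1 by auto
  have hd': "hd p' = phi (hd p)"
    using split s_ends ij(3) unfolding p'_def phi_pre by (cases pre) (auto simp: hd_append)
  have last': "last p' = phi (last p)"
    using split s_ends ij(4) unfolding p'_def phi_post by (cases post rule: rev_cases) auto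
  have "even (length s) = even (length ms)" by (rule parity[OF side])
  then have even': "even (length p')" using pp(2) unfolding p'_def split by auto
  \<comment> \<open>If \<open>p\<close> were just the side path, the result could be
    \<open>[a, b]\<close>, which is too short. An end in \<open>X1\<close> guarantees a third
    vertex, and an even length above two is at least four.\<close>
  have "pre \<noteq> [] \<or> post \<noteq> []"
  proof (rule ccontr)
    assume "\<not> ?thesis"
    then have "p = s" using split by simp
    then have "p ! 0 \<in> A2" "p ! (length p - 1) \<in> B2"
      using s_ends ij hd_conv_nth[of s] last_conv_nth[of s] by auto
    then show False using ends(3) X12 X2(1) by auto
  qed
  then have "length p' \<noteq> 2" "2 \<le> length p'" unfolding p'_def by auto
  then have "4 \<le> length p'" using even' by presburger
  moreover have "y \<in> P" if y: "y \<in> set p' - {hd p', last p'}" for y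
  proof (cases "y \<in> set ms")
    case False
    have "a = phi (p ! i)" "b = phi (p ! j)" "p ! i \<in> set p" "p ! j \<in> set p" using ij by auto
    moreover have "y = a \<or> y = b \<or> y \<in> phi ` set pre \<or> y \<in> phi ` set post"
      using y False unfolding p'_def phi_pre phi_post by auto
    moreover have "set pre \<subseteq> set p" "set post \<subseteq> set p" unfolding split by auto
    ultimately obtain x where "x \<in> set p" "y = phi x" by blast
    then show ?thesis using y pp(6) unfolding hd' last' pull_def by auto
  qed (use ms in auto)
  ultimately have "odd_span T' P Q p'"
    unfolding odd_span_iff_Diff using path' even' hd' last' pp(4,5) unfolding pull_def by auto
  then show ?thesis by blast
qed

lemma contract_span:
  assumes p: "odd_span T (pull P) (pull Q) p" and ms: "set ms \<subseteq> P"
    and unique: "\<And>x y. x \<in> set p \<inter> A2 \<Longrightarrow> y \<in> set p \<inter> A2 \<Longrightarrow> x = y"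
      "\<And>x y. x \<in> set p \<inter> B2 \<Longrightarrow> y \<in> set p \<inter> B2 \<Longrightarrow> x = y"
    and ends: "p ! 0 \<notin> C2" "p ! (length p - 1) \<notin> C2" "p ! 0 \<in> X1 \<or> p ! (length p - 1) \<in> X1"
  shows "\<exists>p'. odd_span T' P Q p'"
proof -
  have pp: "path T p" "4 \<le> length p" and ne: "p \<noteq> []"
    using p unfolding odd_span_def path_def by auto
  show ?thesis
  proof (cases "set p \<inter> C2 = {}")
    case True
    have "compatible T T' phi (set p)"
      using compatible_phi[OF _ True unique] pp unfolding path_def by auto
    then have "odd_span T' P Q (map phi p)"
      using odd_span_map[OF T(1) T'(1) p] unfolding pull_def by auto
    then show ?thesis by blast
  next
    case False
    then obtain m where "m < length p" "p ! m \<in> C2" by (metis disjoint_iff in_set_conv_nth)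
    then obtain i j where ij: "i < m" "m < j" "j < length p" "p ! i \<in> A2 \<union> B2" "p ! j \<in> A2 \<union> B2"
      "\<And>k. i < k \<Longrightarrow> k < j \<Longrightarrow> p ! k \<in> C2"
      using C2_run[OF pp(1) ends(1,2)] by metis
    have "p ! i \<noteq> p ! j" using path_nth_eq[OF pp(1), of i j] ij by auto
    then consider "p ! i \<in> A2" "p ! j \<in> B2" | "p ! i \<in> B2" "p ! j \<in> A2"
      using unique[of "p ! i" "p ! j"] unique(2)[of "p ! i" "p ! j"] ij by fastforce
    then show ?thesis
    proof cases
      case 1
      then show ?thesis using contract_span_oriented[OF p ms unique ends, of i j] ij by auto
    next
      case 2
      let ?i = "length p - Suc j" and ?j = "length p - Suc i"
      have r: "rev p ! ?i = p ! j" "rev p ! ?j = p ! i" "?i < ?j" "?j < length (rev p)"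
        using ij by (auto simp: rev_nth)
      have "rev p ! k \<in> C2" if "?i < k" "k < ?j" for k
      proof -
        have "i < length p - Suc k" "length p - Suc k < j" using that ij by linarith+
        then show ?thesis using ij(6) that by (simp add: rev_nth)
      qed
      moreover have "rev p ! 0 = p ! (length p - 1)" "rev p ! (length (rev p) - 1) = p ! 0"
        using rev_nth_0[OF ne] rev_nth_last[OF ne] by auto
      ultimately show ?thesis
        using contract_span_oriented[OF odd_span_rev[OF T(1) p] ms, of ?i ?j] unique ends 2 r by auto
    qed
  qed
qed

section \<open>Paths whose ends allow a contraction, and those with both ends in
  \<open>B2\<close>\<close>

lemma entry_unique:
  assumes z: "z \<in> X1" and y: "y \<in> X2" "theta T z y \<noteq> -1"
    and only: "\<forall>l<length p. p ! l \<in> X2 \<longrightarrow> theta T z (p ! l) = 1 \<longrightarrow> l = i"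
  shows "y \<in> A2 \<and> (\<forall>k<length p. p ! k \<in> A2 \<longrightarrow> k = i) \<or>
    y \<in> B2 \<and> (\<forall>k<length p. p ! k \<in> B2 \<longrightarrow> k = i)"
proof -
  \<comment> \<open>In either case \<open>z\<close> is strongly complete to the class of
    \<open>y\<close>.\<close>
  have "z \<in> A1 \<and> y \<in> A2 \<or> z \<in> B1 \<and> y \<in> B2"
    using cross[OF z y(1)] y(2) by (auto split: if_splits)
  then show ?thesis using only theta_X1_A2[OF z] theta_X1_B2[OF z] X2(1) by auto
qed

lemma first_X2:
  assumes p: "path T p" "p ! 0 \<in> X1" and k: "k < length p" "p ! k \<in> X2"
  obtains i where "i < length p" "\<forall>k<i. p ! k \<notin> X2"
    "p ! i \<in> A2 \<and> (\<forall>k<length p. p ! k \<in> A2 \<longrightarrow> k = i) \<or>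
     p ! i \<in> B2 \<and> (\<forall>k<length p. p ! k \<in> B2 \<longrightarrow> k = i)"
proof -
  have "p ! 0 \<notin> X2" using p(2) X12 by auto
  then obtain i where i: "0 < i" "i < length p" "p ! i \<in> X2" "\<forall>l<i. p ! l \<notin> X2"
    "theta T (p ! (i - 1)) (p ! i) \<noteq> -1"
    "\<forall>l<length p. p ! l \<in> X2 \<longrightarrow> theta T (p ! (i - 1)) (p ! l) = 1 \<longrightarrow> l = i"
    by (rule first_entry[OF T(1) p(1) _ k]) (rule that)
  have "p ! (i - 1) \<in> X1" using path_nth_in_verts[OF p(1), of "i - 1"] i(1,2,4) verts_T by auto
  then show ?thesis using that[OF i(2,4)] entry_unique[OF _ i(3,5,6)] by blast
qed

lemma last_X2:
  assumes p: "path T p" "p ! (length p - 1) \<in> X1" and k: "k < length p" "p ! k \<in> X2"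
  obtains j where "j < length p" "\<forall>k<length p. j < k \<longrightarrow> p ! k \<notin> X2"
    "p ! j \<in> A2 \<and> (\<forall>k<length p. p ! k \<in> A2 \<longrightarrow> k = j) \<or>
     p ! j \<in> B2 \<and> (\<forall>k<length p. p ! k \<in> B2 \<longrightarrow> k = j)"
proof -
  have "p ! (length p - 1) \<notin> X2" using p(2) X12 by auto
  then obtain j where j: "Suc j < length p" "p ! j \<in> X2" "\<forall>l<length p. j < l \<longrightarrow> p ! l \<notin> X2"
    "theta T (p ! Suc j) (p ! j) \<noteq> -1"
    "\<forall>l<length p. p ! l \<in> X2 \<longrightarrow> theta T (p ! Suc j) (p ! l) = 1 \<longrightarrow> l = j"
    by (rule last_entry[OF T(1) p(1) _ k]) (rule that)
  have "p ! Suc j \<in> X1" using path_nth_in_verts[OF p(1) j(1)] j(1,3) verts_T by auto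
  moreover have "j < length p" using j(1) by simp
  ultimately show ?thesis using that[OF _ j(3)] entry_unique[OF _ j(2,4,5)] by blast
qed

text \<open>The first and the last vertex in \<open>X2\<close> are each alone in their class on the
  path. If they belong to the same class, they coincide and the path meets \<open>X2\<close> once;
  otherwise they settle one class each.\<close>

lemma unique_X1_X1:
  assumes p: "path T p" "p ! 0 \<in> X1" "p ! (length p - 1) \<in> X1"
  shows "\<And>x y. x \<in> set p \<inter> A2 \<Longrightarrow> y \<in> set p \<inter> A2 \<Longrightarrow> x = y"
    and "\<And>x y. x \<in> set p \<inter> B2 \<Longrightarrow> y \<in> set p \<inter> B2 \<Longrightarrow> x = y"
proof -
  have "k = l" if kl: "k < length p" "l < length p" "p ! k \<in> A2 \<and> p ! l \<in> A2 \<or> p ! k \<in> B2 \<and> p ! l \<in> B2"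
    for k l
  proof -
    have kX: "p ! k \<in> X2" "p ! l \<in> X2" using kl X2(1) by auto
    obtain i where i: "i < length p" "\<forall>k<i. p ! k \<notin> X2"
      "p ! i \<in> A2 \<and> (\<forall>k<length p. p ! k \<in> A2 \<longrightarrow> k = i) \<or>
       p ! i \<in> B2 \<and> (\<forall>k<length p. p ! k \<in> B2 \<longrightarrow> k = i)"
      by (rule first_X2[OF p(1,2) kl(1) kX(1)]) (rule that)
    obtain j where j: "j < length p" "\<forall>k<length p. j < k \<longrightarrow> p ! k \<notin> X2"
      "p ! j \<in> A2 \<and> (\<forall>k<length p. p ! k \<in> A2 \<longrightarrow> k = j) \<or>
       p ! j \<in> B2 \<and> (\<forall>k<length p. p ! k \<in> B2 \<longrightarrow> k = j)"
      by (rule last_X2[OF p(1,3) kl(1) kX(1)]) (rule that)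
    have "i \<le> k" "i \<le> l" "k \<le> j" "l \<le> j" using i(2) j(2) kX kl by (metis not_le)+
    then show ?thesis using i(1,3) j(1,3) kl by (metis le_antisym)
  qed
  then show "\<And>x y. x \<in> set p \<inter> A2 \<Longrightarrow> y \<in> set p \<inter> A2 \<Longrightarrow> x = y"
    and "\<And>x y. x \<in> set p \<inter> B2 \<Longrightarrow> y \<in> set p \<inter> B2 \<Longrightarrow> x = y"
    by (metis IntE in_set_conv_nth)+
qed

text \<open>The end is the only vertex in \<open>B2\<close>. If \<open>A2\<close> is met as well,
  the first entry into \<open>X2\<close> comes before the end, so it is in \<open>A2\<close> and
  alone there.\<close>

lemma unique_X1_B2:
  assumes p: "path T p" "p ! 0 \<in> X1" "p ! (length p - 1) \<in> B2"
    and inner: "\<And>k. 0 < k \<Longrightarrow> k < length p - 1 \<Longrightarrow> p ! k \<notin> B2"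
  shows "\<And>x y. x \<in> set p \<inter> A2 \<Longrightarrow> y \<in> set p \<inter> A2 \<Longrightarrow> x = y"
    and "\<And>x y. x \<in> set p \<inter> B2 \<Longrightarrow> y \<in> set p \<inter> B2 \<Longrightarrow> x = y"
proof -
  have ne: "length p - 1 < length p" using p(1) unfolding path_def by auto
  have nX: "p ! (length p - 1) \<in> X2" using p(3) X2(1) by auto
  have B: "k = length p - 1" if "k < length p" "p ! k \<in> B2" for k
  proof (rule ccontr)
    assume "k \<noteq> length p - 1"
    then have "k = 0" using inner[of k] that by linarith
    then show False using that p(2) X12 X2(1) by auto
  qed
  obtain i where i: "i < length p" "\<forall>k<i. p ! k \<notin> X2"
      "p ! i \<in> A2 \<and> (\<forall>k<length p. p ! k \<in> A2 \<longrightarrow> k = i) \<or>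
       p ! i \<in> B2 \<and> (\<forall>k<length p. p ! k \<in> B2 \<longrightarrow> k = i)"
    by (rule first_X2[OF p(1,2) ne nX]) (rule that)
  have A: "k = i" if "k < length p" "p ! k \<in> A2" for k
  proof -
    have "k \<noteq> length p - 1" "p ! k \<in> X2" using that p(3) X2(1,2) by auto
    then have "i \<noteq> length p - 1" using i(2)[rule_format, of k] that by linarith
    then show ?thesis using i(1,3) B that by blast
  qed
  show "\<And>x y. x \<in> set p \<inter> A2 \<Longrightarrow> y \<in> set p \<inter> A2 \<Longrightarrow> x = y"
    using A by (metis IntE in_set_conv_nth)
  show "\<And>x y. x \<in> set p \<inter> B2 \<Longrightarrow> y \<in> set p \<inter> B2 \<Longrightarrow> x = y"
    using B by (metis IntE in_set_conv_nth)
qed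

text \<open>If such a path stays in \<open>X2\<close>, a vertex of \<open>B1\<close> closes it to an odd hole; otherwise it leaves
  \<open>X2\<close> through a single vertex of \<open>A1\<close> and splits into two side paths of the same parity.\<close>

lemma no_odd_span_B2_B2:
  assumes p: "odd_span T P Q p" and ends: "p ! 0 \<in> B2" "p ! (length p - 1) \<in> B2" and P: "P \<inter> B2 = {}"
  shows False
proof -
  define n where "n = length p"
  have pp: "path T p" "even n" "4 \<le> n" and inner: "\<And>k. 0 < k \<Longrightarrow> k < n - 1 \<Longrightarrow> p ! k \<notin> B2"
    using p P unfolding odd_span_def n_def by auto
  have in_verts: "p ! k \<in> X1 \<union> X2" if "k < n" for k
    using path_nth_in_verts[OF pp(1)] that verts_T n_def by auto
  have e0: "p ! 0 \<in> X2" "p ! 0 \<notin> X1" and en: "p ! (n - 1) \<in> X2" "p ! (n - 1) \<notin> X1"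
    using ends X2(1) X12 n_def by auto
  note cons = path_consecutive[OF T(1) pp(1), folded n_def]
  note ncons = path_not_consecutive[OF T(1) pp(1), folded n_def]
  show False
  proof (cases "set p \<subseteq> X2")
    case True
    obtain v where v: "v \<in> B1" using X1(5) by auto
    then have vX: "v \<in> X1" "v \<notin> A1" using X1 by auto
    have th: "theta T v y = (if y \<in> B2 then 1 else -1)" if "y \<in> set p" for y
      using cross[OF vX(1), of y] v vX that True by auto
    have "p ! k \<in> set p" if "k < n" for k using that n_def by auto
    then show False
      using Berge_no_closing_vertex[OF T p, of v] th ends inner vX(1) verts_T True X12 pp(3)
      unfolding n_def[symmetric] by fastforce
  next
    case False
    then obtain k where k: "k < n" "p ! k \<in> X1" using in_verts n_def
      by (metis UnE in_set_conv_nth subsetI)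
    define K where "K = {k. k < n \<and> p ! k \<in> X1}"
    have K: "finite K" "k \<in> K" unfolding K_def using k by auto
    define i j where "i = Min K" and "j = Max K"
    have iK: "i \<in> K" "j \<in> K" "i \<le> j" unfolding i_def j_def 
      using Min_in[OF K(1)] Max_in[OF K(1)] Max_ge[OF K] Min_le[OF K] K(2) by auto
    then have i: "i < n" "p ! i \<in> X1" "j < n" "p ! j \<in> X1" unfolding K_def by auto
    have out: "p ! l \<in> X2" if "l < i \<or> j < l" "l < n" for l
    proof -
      have "l \<notin> K" using that K(1) unfolding i_def j_def by (metis Max_ge Min_le leD)
      then show ?thesis using in_verts[of l] that unfolding K_def by auto
    qed
    have "i \<noteq> 0" "j \<noteq> n - 1" using i e0(2) en(2) by metis+
    then have ij0: "0 < i" "j < n - 1" using i by auto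
    \<comment> \<open>A vertex of \<open>X1\<close> next to one end would be in \<open>B1\<close>,
      hence strongly adjacent to the other end too. So the path leaves \<open>X2\<close> and returns
      through \<open>A2\<close> on both sides.\<close>
    have "i \<noteq> 1"
    proof
      assume i1: "i = 1"
      then have "theta T (p ! i) (p ! 0) \<noteq> -1" using ncons[of 1 0] i by auto
      then have "p ! i \<in> B1" using cross[OF i(2) e0(1)] ends X2(2) by (auto split: if_splits)
      then have "theta T (p ! i) (p ! (n - 1)) = 1" using cross[OF i(2) en(1)] ends n_def by auto
      then show False using cons[of i "n - 1"] i1 pp(3) by linarith
    qed
    moreover have "j \<noteq> n - 2"
    proof
      assume j1: "j = n - 2"
      then have jn: "Suc j = n - 1" using pp(3) by auto
      then have "theta T (p ! j) (p ! (n - 1)) \<noteq> -1" using ncons[of j "n - 1"] i by auto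
      then have "p ! j \<in> B1" using cross[OF i(4) en(1)] ends X2(2) n_def by (auto split: if_splits)
      then have "theta T (p ! j) (p ! 0) = 1" using cross[OF i(4) e0(1)] ends n_def by auto
      then show False using cons[of j 0] j1 pp(3) by linarith
    qed
    ultimately have ij1: "1 < i" "j < n - 2" "i - 1 < n" "Suc j < n" using ij0 i by auto
    have ij2: "0 < i - 1" "i - 1 < n - 1" "Suc j < n - 1" using ij1 i by linarith+
    have a1: "p ! (i - 1) \<in> X2" "p ! (i - 1) \<notin> B2" "p ! Suc j \<in> X2" "p ! Suc j \<notin> B2"
      using out[of "i - 1"] out[of "Suc j"] inner[of "i - 1"] inner[of "Suc j"] ij1 ij2 by auto
    have "theta T (p ! i) (p ! (i - 1)) \<noteq> -1" using ncons[of i "i - 1"] ij1 i by auto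
    then have iA: "p ! i \<in> A1" "p ! (i - 1) \<in> A2" using cross[OF i(2) a1(1)] a1 by (auto split: if_splits)
    have "theta T (p ! j) (p ! Suc j) \<noteq> -1" using ncons[of j "Suc j"] ij1 i by auto
    then have jA: "p ! j \<in> A1" "p ! Suc j \<in> A2" using cross[OF i(4) a1(3)] a1 by (auto split: if_splits)
    \<comment> \<open>The vertex \<open>p ! i\<close> of \<open>A1\<close> is strongly adjacent to
      \<open>p ! Suc j\<close> in \<open>A2\<close>, so these are consecutive and the path has just
      one vertex in \<open>X1\<close>.\<close>
    have "theta T (p ! i) (p ! Suc j) = 1" using cross[OF i(2) a1(3)] iA jA by auto
    then have ij: "j = i" using cons[of i "Suc j"] i ij1 iK(3) by auto
    have only: "l = i - 1 \<or> l = Suc i" if "l < n" "p ! l \<in> A2" for l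
    proof -
      have "p ! l \<in> X2" using that X2 by auto
      then have "theta T (p ! i) (p ! l) = 1" "l \<noteq> i" using cross[OF i(2)] iA that i X12 by auto
      then show ?thesis using cons[of i l] i that by auto
    qed
    have C2: "p ! l \<in> C2" if "0 < l" "l < n - 1" "l \<noteq> i" "l \<noteq> i - 1" "l \<noteq> Suc i" for l
    proof -
      have "l < n" "l < i \<or> j < l" using ij that by linarith+
      then have "p ! l \<in> X2" "l < n" using out by auto
      then show ?thesis using only[of l] inner[of l] that X2(1) by auto
    qed
    define s where "s = take (Suc (i - 1 - 0)) (drop 0 p)"
    define t where "t = take (Suc ((n - 1) - Suc i)) (drop (Suc i) p)"
    have s: "path T s" "length s = i" unfolding s_def using path_take_drop[OF pp(1), of 0 "i - 1"] ij1 n_def by auto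
    have t: "path T t" "length t = n - 1 - i" unfolding t_def using path_take_drop[OF pp(1), of "Suc i" "n - 1"] ij1 ij n_def by auto
    have s_nth: "rev s ! l = p ! (i - 1 - l)" if "l < i" for l
      using that s(2) ij1 unfolding s_def by (simp add: rev_nth)
    have t_nth: "t ! l = p ! (Suc i + l)" if "l < n - 1 - i" for l using that t(2) ij1 ij unfolding t_def n_def by simp
    have "side_path T A2 B2 C2 (rev s)" unfolding side_path_def interior_subset_iff
    proof (intro conjI allI impI)
      have ne: "s \<noteq> []" using s(2) ij1 by auto
      show "path T (rev s)" by (rule path_rev[OF T(1) s(1)])
      show "hd (rev s) \<in> A2" using s_nth[of 0] iA ij1 ne by (simp add: hd_conv_nth)
      show "last (rev s) \<in> B2" using s_nth[of "i - 1"] ends ij1 ne s(2) by (simp add: last_conv_nth)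
      fix l assume l: "0 < l \<and> l < length (rev s) - 1"
      then have "p ! (i - 1 - l) \<in> C2" using C2[of "i - 1 - l"] s(2) ij1 i by auto
      then show "rev s ! l \<in> C2" using s_nth[of l] l s(2) by auto
    qed
    moreover have "side_path T A2 B2 C2 t" unfolding side_path_def interior_subset_iff
    proof (intro conjI allI impI)
      have ne: "t \<noteq> []" using t(2) ij1 ij by auto
      show "path T t" by (rule t(1))
      show "hd t \<in> A2" using t_nth[of 0] jA ij ij1 ne by (simp add: hd_conv_nth)
      have "Suc i + (n - 1 - i - 1) = n - 1" using ij1 ij by auto
      then show "last t \<in> B2" using t_nth[of "n - 1 - i - 1"] ends ij1 ij ne t(2) n_def by (simp add: last_conv_nth)
      fix l assume l: "0 < l \<and> l < length t - 1"
      then have "p ! (Suc i + l) \<in> C2" using C2[of "Suc i + l"] t(2) ij1 i by auto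
      then show "t ! l \<in> C2" using t_nth[of l] l t(2) by auto
    qed
    \<comment> \<open>The two side paths have \<open>i\<close> and \<open>n - 1 - i\<close>
      vertices; the sum \<open>n - 1\<close> is odd.\<close>
    ultimately have "even i = even (n - 1 - i)" using parity[of "rev s"] parity[of t] s(2) t(2) by auto
    then show False using pp(2,3) i(1) ij1 by presburger
  qed
qed

text \<open>As \<open>a\<close> is in \<open>P\<close>, the ends lie in \<open>X1\<close> or
  \<open>B2\<close>. With an end in \<open>X1\<close> the path can be contracted; with both ends in
  \<open>B2\<close> they share the marker \<open>b\<close>, and the contradiction comes from
  \<open>T\<close>.\<close>

lemma no_odd_span_pull:
  assumes no: "\<nexists>p'. odd_span T' P Q p'" and disj: "P \<inter> Q = {}" and a: "a \<in> P" and ms: "set ms \<subseteq> P"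
  shows "\<not> odd_span T (pull P) (pull Q) p"
proof
  assume p: "odd_span T (pull P) (pull Q) p"
  have key: False if p: "odd_span T (pull P) (pull Q) p" and X: "p ! 0 \<in> X1" for p
  proof -
    have pp: "path T p" "p ! (length p - 1) \<in> pull Q" "\<And>i. 0 < i \<Longrightarrow> i < length p - 1 \<Longrightarrow> p ! i \<in> pull P"
      using p unfolding odd_span_def by auto
    have C: "p ! 0 \<notin> C2" "p ! (length p - 1) \<notin> C2" "p ! (length p - 1) \<notin> A2"
      using X X12 X2(1) pp(2) a disj unfolding pull_def by auto
    then consider "p ! (length p - 1) \<in> X1" | "p ! (length p - 1) \<in> B2"
      using pp(2) verts_T X2(1) unfolding pull_def by auto
    then show False
    proof cases
      case 1
      then show False
        using contract_span[OF p ms unique_X1_X1[OF pp(1) X 1] C(1,2)] X no by blast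
    next
      case 2
      then have "b \<in> Q" using pp(2) unfolding pull_def by auto
      then have "p ! k \<notin> B2" if "0 < k" "k < length p - 1" for k
        using pp(3)[OF that] disj unfolding pull_def by auto
      then show False
        using contract_span[OF p ms unique_X1_B2[OF pp(1) X 2] C(1,2)] X no by blast
    qed
  qed
  have pp: "path T p" "4 \<le> length p" "p ! 0 \<in> pull Q" "p ! (length p - 1) \<in> pull Q"
    and ne: "p \<noteq> []" using p unfolding odd_span_def path_def by auto
  show False
  proof (cases "p ! 0 \<in> X1 \<or> p ! (length p - 1) \<in> X1")
    case True
    then show False using key[OF p] key[OF odd_span_rev[OF T(1) p]] rev_nth_0[OF ne] by auto
  next
    case False
    then have B: "p ! 0 \<in> B2" "p ! (length p - 1) \<in> B2"
      using pp(3,4) verts_T X2(1) a disj unfolding pull_def by auto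
    then have "b \<in> Q" using pp(3) unfolding pull_def by auto
    then have "pull P \<inter> B2 = {}" using disj unfolding pull_def by auto
    then show False using no_odd_span_B2_B2[OF p B] by blast
  qed
qed

section \<open>Antipaths in the presence of a 2-join\<close>

lemma antipath_not_C2:
  assumes q: "path (complement T) q" "q ! 0 \<in> C2" and i: "1 < i" "i < length q" "q ! i \<in> X1"
  shows False
proof -
  have "0 < length q" using i by linarith
  \<comment> \<open>In the complement a vertex of \<open>C2\<close> is strongly adjacent to all of
    \<open>X1\<close>, so on an antipath a vertex of \<open>X1\<close> must be next to it.\<close>
  then show False
    using path_consecutive[OF trigraph_complement[OF T(1)] q(1), of 0 i] theta_X1_C2[OF i(3) q(2)] i
    by auto
qed

text \<open>\<open>A2\<close> and \<open>C2\<close> can occur only at position \<open>0\<close>, and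
  the last vertex in \<open>X1\<close> is too far away for \<open>C2\<close> there. The vertex after
  the last one in \<open>B2\<close> lies in \<open>X1\<close> and is antiadjacent to it, hence
  strongly antiadjacent to all of \<open>B2\<close>; every vertex of \<open>B2\<close> must then be
  next to it, and only one precedes it.\<close>

lemma antispan_unique_oriented:
  assumes q: "path (complement T) q" "4 \<le> length q" "q ! (length q - 1) \<in> X1" "q ! 0 \<notin> B2"
    and inner: "\<And>i. 0 < i \<Longrightarrow> i < length q - 1 \<Longrightarrow> q ! i \<in> X1 \<union> B2"
  shows "set q \<inter> C2 = {}"
    and "\<And>x y. x \<in> set q \<inter> A2 \<Longrightarrow> y \<in> set q \<inter> A2 \<Longrightarrow> x = y"
    and "\<And>x y. x \<in> set q \<inter> B2 \<Longrightarrow> y \<in> set q \<inter> B2 \<Longrightarrow> x = y"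
proof -
  define n where "n = length q"
  note cons = path_consecutive[OF trigraph_complement[OF T(1)] q(1), folded n_def]
  note ncons = path_not_consecutive[OF trigraph_complement[OF T(1)] q(1), folded n_def]
  have n: "4 \<le> n" using q(2) n_def by simp
  have "1 < n - 1" "n - 1 < n" using n by linarith+
  then have "q ! 0 \<notin> C2" using antipath_not_C2[OF q(1), of "n - 1"] q(3) n_def by auto
  have X: "q ! i \<in> X1 \<union> B2" if "0 < i" "i < n" for i
    using inner[of i] q(3) that n_def by (cases "i = n - 1") auto
  have zero: "i = 0" if "i < n" "q ! i \<in> A2 \<union> C2" for i
    using X[of i] that X12 X2 by (cases "i = 0") auto
  show "set q \<inter> C2 = {}"
    using zero \<open>q ! 0 \<notin> C2\<close> n_def by (metis UnCI disjoint_iff in_set_conv_nth)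
  show "\<And>x y. x \<in> set q \<inter> A2 \<Longrightarrow> y \<in> set q \<inter> A2 \<Longrightarrow> x = y"
    using zero n_def by (metis IntE UnCI in_set_conv_nth)
  define J where "J = {j. j < n \<and> q ! j \<in> B2}"
  have "i = Max J" if i: "i < n" "q ! i \<in> B2" for i
  proof -
    have fin: "finite J" "i \<in> J" using i unfolding J_def by auto
    define j where "j = Max J"
    have j: "j \<in> J" "i \<le> j" unfolding j_def using fin Max_in Max_ge by auto
    then have jn: "j < n" "q ! j \<in> B2" unfolding J_def by auto
    have "j \<noteq> n - 1" using jn q(3) X12 X2(1) n_def by auto
    then have j1: "Suc j < n" using jn(1) by linarith
    have "Suc j \<notin> J" using fin(1) Max_ge[of J "Suc j"] unfolding j_def by (meson not_less_eq_eq order_refl)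
    then have x: "q ! Suc j \<in> X1" using X[of "Suc j"] j1 unfolding J_def by auto
    have th: "theta T (q ! Suc j) y = (if q ! Suc j \<in> B1 then 1 else -1)" if "y \<in> B2" for y
      using cross[OF x, of y] that X2 by auto
    have "theta T (q ! Suc j) (q ! j) \<noteq> 1" using ncons[of "Suc j" j] j1 jn by auto
    then have "q ! Suc j \<notin> B1" using th[OF jn(2)] by auto
    then have "theta T (q ! Suc j) (q ! i) = -1" using th[OF i(2)] by auto
    then have "i = Suc (Suc j) \<or> Suc j = Suc i" using cons[of "Suc j" i] j1 i(1) j(2) by auto
    then show ?thesis using j(2) unfolding j_def by auto
  qed
  then show "\<And>x y. x \<in> set q \<inter> B2 \<Longrightarrow> y \<in> set q \<inter> B2 \<Longrightarrow> x = y"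
    using n_def by (metis IntE in_set_conv_nth)
qed

text \<open>Only the ends can lie in \<open>X2\<close>. They are in different classes because
  \<open>q ! 1\<close>, in \<open>X1\<close>, is antiadjacent to the first and adjacent to the
  last.\<close>

lemma antispan_unique_inner_X1:
  assumes q: "path (complement T) q" "4 \<le> length q"
    and inner: "\<And>i. 0 < i \<Longrightarrow> i < length q - 1 \<Longrightarrow> q ! i \<in> X1"
  shows "set q \<inter> C2 = {}"
    and "\<And>x y. x \<in> set q \<inter> A2 \<Longrightarrow> y \<in> set q \<inter> A2 \<Longrightarrow> x = y"
    and "\<And>x y. x \<in> set q \<inter> B2 \<Longrightarrow> y \<in> set q \<inter> B2 \<Longrightarrow> x = y"
proof -
  define n where "n = length q"
  have n: "4 \<le> n" "q \<noteq> []" using q(2) n_def by auto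
  note cons = path_consecutive[OF trigraph_complement[OF T(1)] q(1), folded n_def]
  note ncons = path_not_consecutive[OF trigraph_complement[OF T(1)] q(1), folded n_def]
  have c0: "q ! 0 \<notin> C2" using antipath_not_C2[OF q(1), of 2] n inner[of 2] n_def by auto
  have cn: "q ! (n - 1) \<notin> C2"
  proof
    assume "q ! (n - 1) \<in> C2"
    then have "rev q ! 0 \<in> C2" using rev_nth_0[OF n(2)] n_def by simp
    moreover have "rev q ! 2 = q ! (n - 3)" using n n_def by (simp add: rev_nth eval_nat_numeral)
    then have "rev q ! 2 \<in> X1" using inner[of "n - 3"] n n_def by auto
    ultimately show False
      using antipath_not_C2[OF path_rev[OF trigraph_complement[OF T(1)] q(1)], of 2] n n_def by auto
  qed
  have ends: "i = 0 \<or> i = n - 1" if "i < n" "q ! i \<in> X2" for i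
  proof (rule ccontr)
    assume "\<not> ?thesis"
    then have "q ! i \<in> X1" using inner[of i] that n_def by auto
    then show False using that X12 by auto
  qed
  show "set q \<inter> C2 = {}"
    using ends c0 cn n_def X2(1) by (metis UnCI disjoint_iff in_set_conv_nth)
  have x: "q ! 1 \<in> X1" using inner[of 1] n n_def by auto
  have not_both: "\<not> (q ! 0 \<in> A2 \<and> q ! (n - 1) \<in> A2)" "\<not> (q ! 0 \<in> B2 \<and> q ! (n - 1) \<in> B2)"
  proof -
    have eq: "theta T (q ! 1) (q ! 0) \<noteq> theta T (q ! 1) (q ! (n - 1))"
      if "q ! 0 \<in> X2" "q ! (n - 1) \<in> X2"
    proof
      assume e: "theta T (q ! 1) (q ! 0) = theta T (q ! 1) (q ! (n - 1))"
      have "theta T (q ! 1) (q ! 0) \<noteq> 1" using ncons[of 1 0] n by auto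
      then have "theta T (q ! 1) (q ! 0) = -1" using cross[OF x that(1)] by (auto split: if_splits)
      then have "theta (complement T) (q ! 1) (q ! (n - 1)) = 1" using e by simp
      then show False using cons[of 1 "n - 1"] n(1) by linarith
    qed
    then show "\<not> (q ! 0 \<in> A2 \<and> q ! (n - 1) \<in> A2)" "\<not> (q ! 0 \<in> B2 \<and> q ! (n - 1) \<in> B2)"
      using theta_X1_A2[OF x] theta_X1_B2[OF x] X2(1) by (metis UnCI)+
  qed
  then show "\<And>x y. x \<in> set q \<inter> A2 \<Longrightarrow> y \<in> set q \<inter> A2 \<Longrightarrow> x = y"
    and "\<And>x y. x \<in> set q \<inter> B2 \<Longrightarrow> y \<in> set q \<inter> B2 \<Longrightarrow> x = y"
    using ends n_def X2(1) by (metis IntE UnCI in_set_conv_nth)+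
qed

text \<open>If the interior or an end is in \<open>X1\<close>, the uniqueness lemmas give an
  antipath of the block. Otherwise the ends are in \<open>A2 \<union> C2\<close>, and the interior
  meets \<open>B2\<close> and therefore lies in \<open>pull Q1\<close>. A vertex of
  \<open>pull Q2\<close>, being in \<open>B1\<close>, is strongly complete to the interior and
  strongly anticomplete to the ends, so it closes an odd antihole.\<close>

lemma no_odd_antispan_pull:
  assumes no: "\<nexists>p'. odd_span (complement T') Q P p'" and disj: "P \<inter> Q = {}" and a: "a \<in> P"
    and Q: "Q = Q1 \<union> Q2" "Q1 \<inter> Q2 = {}" "separated (complement T) (pull Q1) (pull Q2)"
    and b: "b \<in> P \<or> b \<in> Q1 \<and> pull Q2 \<subseteq> B1"
  shows "\<not> odd_span (complement T) (pull Q) (pull P) q"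
proof
  assume q: "odd_span (complement T) (pull Q) (pull P) q"
  note cT = trigraph_complement[OF T(1)]
  have transfer: False if "odd_span (complement T) (pull Q) (pull P) r" "set r \<inter> C2 = {}"
    "\<And>x y. x \<in> set r \<inter> A2 \<Longrightarrow> y \<in> set r \<inter> A2 \<Longrightarrow> x = y"
    "\<And>x y. x \<in> set r \<inter> B2 \<Longrightarrow> y \<in> set r \<inter> B2 \<Longrightarrow> x = y" for r
  proof -
    have "set r \<subseteq> verts T" using that(1) unfolding odd_span_def path_def by auto
    then have "compatible (complement T) (complement T') phi (set r)"
      using compatible_complement[OF compatible_phi[OF _ that(2-4)]] by blast
    then have "odd_span (complement T') Q P (map phi r)"
      using odd_span_map[OF cT trigraph_complement[OF T'(1)] that(1)] unfolding pull_def by blast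
    then show False using no by blast
  qed
  have qq: "path (complement T) q" "4 \<le> length q" "q ! 0 \<in> pull P" "q ! (length q - 1) \<in> pull P"
    "\<And>i. 0 < i \<Longrightarrow> i < length q - 1 \<Longrightarrow> q ! i \<in> pull Q" and ne: "q \<noteq> []"
    using q unfolding odd_span_def path_def by auto
  have pullQ: "pull Q \<subseteq> X1 \<union> B2"
    using a disj verts_T X2(1) unfolding pull_def by auto
  show False
  proof (cases "\<forall>i. 0 < i \<and> i < length q - 1 \<longrightarrow> q ! i \<in> X1")
    case True
    then show False using transfer[OF q] antispan_unique_inner_X1[OF qq(1,2)] by blast
  next
    case False
    then obtain m where m: "0 < m" "m < length q - 1" "q ! m \<in> B2" using qq(5) pullQ by blast
    have "b \<in> Q" using qq(5)[OF m(1,2)] m(3) unfolding pull_def by auto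
    then have bP: "b \<notin> P" "b \<in> Q1" "pull Q2 \<subseteq> B1" using b disj by auto
    have PB: "pull P \<inter> B2 = {}" using bP unfolding pull_def by auto
    show False
    proof (cases "q ! 0 \<in> X1 \<or> q ! (length q - 1) \<in> X1")
      case True
      have key: False if r: "odd_span (complement T) (pull Q) (pull P) r" "r ! (length r - 1) \<in> X1" for r
      proof -
        have rr: "path (complement T) r" "4 \<le> length r" "r ! 0 \<notin> B2"
          "\<And>i. 0 < i \<Longrightarrow> i < length r - 1 \<Longrightarrow> r ! i \<in> X1 \<union> B2"
          using r(1) PB pullQ unfolding odd_span_def by auto
        show False using transfer[OF r(1)] antispan_unique_oriented[OF rr(1,2) r(2) rr(3,4)] by blast
      qed
      show False using True key[OF q] key[OF odd_span_rev[OF cT q]] rev_nth_last[OF ne] by auto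
    next
      case False
      then have ends: "q ! 0 \<in> X2" "q ! 0 \<notin> B2" "q ! (length q - 1) \<in> X2" "q ! (length q - 1) \<notin> B2"
        using qq(3,4) PB verts_T unfolding pull_def by auto
      have pQ: "pull Q = pull Q1 \<union> pull Q2" unfolding pull_def Q(1) by auto
      have "q ! m \<notin> pull Q2" using m(3) bP(3) X1(2) X12 X2(1) by auto
      then have inn: "q ! i \<in> pull Q1" if "0 < i" "i < length q - 1" for i
        using odd_span_interior_in_part[OF cT q pQ] Q(3) m(1,2) that
        unfolding separated_def pull_def by auto
      obtain v where v: "v \<in> pull Q2" using Q(3) unfolding separated_def by auto
      then have vB: "v \<in> B1" "v \<in> X1" "v \<notin> A1" using bP(3) X1 by auto
      have th: "theta T v x = 1" if "x \<in> pull Q1" for x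
        using Q(3) that v theta_sym[OF T(1), of v x] unfolding separated_def pull_def by auto
      have thX: "theta T v y = -1" if "y \<in> X2" "y \<notin> B2" for y
        using cross[OF vB(2) that(1)] vB that by auto
      have "v \<notin> set q"
      proof
        assume "v \<in> set q"
        then obtain i where i: "i < length q" "q ! i = v" by (metis in_set_conv_nth)
        then have "i \<noteq> 0" "i \<noteq> length q - 1" using ends vB(2) X12 by auto
        then have "v \<in> pull Q1" using inn[of i] i by auto
        then show False using v Q(2) unfolding pull_def by auto
      qed
      then show False
        using Berge_no_closing_vertex[OF cT Berge_complement[OF T(2)] q, of v]
          th[OF inn] thX ends vB(2) verts_T by auto
    qed
  qed
qed

section \<open>Pulling back a partition of the block of a 2-join\<close>

lemma pull_Un: "pull (R \<union> S) = pull R \<union> pull S"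
  unfolding pull_def by auto

lemma balanced_skew_partition_pull:
  assumes bsp: "balanced_skew_partition T' P Q" and a: "a \<in> P"
  shows "has_balanced_skew_partition T"
proof -
  note cT' = trigraph_complement[OF T'(1)]
  have PQ: "P \<union> Q = verts T'" "P \<inter> Q = {}" "\<nexists>p. odd_span T' P Q p" "\<nexists>p. odd_span (complement T') Q P p"
    using bsp unfolding balanced_skew_partition_iff[OF T'(1)] by auto
  obtain P1 P2 where P: "P = P1 \<union> P2" "separated T' P1 P2" "a \<in> P1"
    using bsp a separated_commute[OF T'(1)] unfolding balanced_skew_partition_iff[OF T'(1)]
    by (metis Un_commute Un_iff sup_ge1)
  obtain Q1 Q2 where Q: "Q = Q1 \<union> Q2" "separated (complement T') Q1 Q2" "b \<in> Q \<Longrightarrow> b \<in> Q1"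
    using bsp separated_commute[OF cT'] unfolding balanced_skew_partition_iff[OF T'(1)]
    by (metis Un_commute Un_iff sup_ge2 verts_complement)
  have sepP: "theta T' u v = -1" if "u \<in> P1" "v \<in> P2" for u v
    using P(2) that unfolding separated_def by blast
  have sepQ: "theta T' u v = 1" if "u \<in> Q1" "v \<in> Q2" for u v
  proof -
    have "theta (complement T') u v = -1" using Q(2) that unfolding separated_def by blast
    then show ?thesis by simp
  qed
  have sym: "theta T' u v = theta T' v u" if "u \<in> P \<union> Q" "v \<in> P \<union> Q" for u v
    using theta_sym[OF T'(1)] that PQ(1) by blast
  have ne: "P2 \<noteq> {}" "Q1 \<noteq> {}" "Q2 \<noteq> {}" and dj: "P1 \<inter> P2 = {}" "Q1 \<inter> Q2 = {}"
    using P(2) Q(2) unfolding separated_def by auto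
  \<comment> \<open>An inner marker has no strong neighbour, so it cannot be in \<open>Q\<close>,
    whose parts are nonempty and strongly complete to each other. Being switchable with
    \<open>a\<close>, it lies in the part of \<open>a\<close>.\<close>
  have ms: "m \<in> P1" if m: "m \<in> set ms" for m
  proof -
    have "ms = [m]" using m length_ms by (cases ms) auto
    then have no1: "theta T' m v \<noteq> 1" if "v \<in> verts T'" "v \<noteq> m" for v
      using that T'(2) theta_ms[of m] theta_ms_ab[of m] by auto
    have mv: "m \<in> P \<union> Q" using m T'(2) PQ(1) by auto
    have "m \<notin> Q"
    proof
      assume "m \<in> Q"
      then consider "m \<in> Q1" | "m \<in> Q2" using Q(1) by auto
      then show False
      proof cases
        case 1
        obtain v where v: "v \<in> Q2" using ne by auto
        then show False using sepQ[OF 1 v] no1[of v] dj 1 Q(1) PQ(1) by auto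
      next
        case 2
        obtain v where v: "v \<in> Q1" using ne by auto
        then have "theta T' m v = 1" using sepQ[OF v 2] sym[of v m] Q(1) mv by auto
        then show False using no1[of v] dj 2 v Q(1) PQ(1) by auto
      qed
    qed
    moreover have "m \<notin> P2" using sepP[OF P(3), of m] theta_ms_ab[OF m] sym[of a m] a mv by auto
    ultimately show ?thesis using mv P(1) by auto
  qed
  \<comment> \<open>Switchable pairs tie \<open>b\<close> to \<open>a\<close>, directly in the odd
    case and through the inner marker in the even case. Hence all markers in \<open>P\<close> are in
    \<open>P1\<close>, and \<open>P2\<close> comes from \<open>X1\<close>.\<close>
  have bP1: "b \<in> P1" if "b \<in> P"
  proof (rule ccontr)
    assume "b \<notin> P1"
    then have b2: "b \<in> P2" using that P(1) by auto
    show False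
    proof (cases ms)
      case Nil
      then show False using sepP[OF P(3) b2] theta_ab by auto
    next
      case (Cons m ms')
      then have "m \<in> set ms" by auto
      then show False using sepP[OF ms b2] theta_ms_ab by auto
    qed
  qed
  have P2f: "x \<in> f ` X1" if "x \<in> P2" for x
  proof -
    have "x \<in> f ` X1 \<union> {a, b} \<union> set ms" using that PQ(1) P(1) T'(2) by blast
    moreover have "x \<notin> P1" "x \<in> P" using that dj P(1) by auto
    ultimately show ?thesis using P(3) ms bP1 by blast
  qed
  have QX: "x \<in> f ` X1" if "x \<in> Q" "x \<noteq> b" for x
  proof -
    have "x \<in> f ` X1 \<union> {a, b} \<union> set ms" using that PQ(1) T'(2) by blast
    moreover have "x \<notin> P" using that PQ(2) by auto
    ultimately show ?thesis using that a ms P(1) by blast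
  qed
  have pullP2: "pull P2 \<subseteq> X1"
  proof
    fix x assume x: "x \<in> pull P2"
    show "x \<in> X1"
    proof (rule ccontr)
      assume "x \<notin> X1"
      then have "phi x = a \<or> phi x = b" unfolding phi_def by auto
      then show False using x P2f[of "phi x"] f unfolding pull_def by auto
    qed
  qed
  have pullQ2: "pull Q2 \<subseteq> X1"
  proof
    fix x assume x: "x \<in> pull Q2"
    show "x \<in> X1"
    proof (rule ccontr)
      assume "x \<notin> X1"
      then have "phi x = a \<or> phi x = b" unfolding phi_def by auto
      then show False using x Q dj(2) a PQ(2) unfolding pull_def by auto
    qed
  qed
  have Q2B1: "pull Q2 \<subseteq> B1" if "b \<in> Q"
  proof
    fix x assume x: "x \<in> pull Q2"
    then have "x \<in> X1" "f x \<in> Q2" using pullQ2 unfolding pull_def by auto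
    then show "x \<in> B1" using sepQ[OF Q(3)[OF that], of "f x"] theta_b[of x] by (auto split: if_splits)
  qed
  have P2A1: "x \<notin> A1" "b \<in> P \<Longrightarrow> x \<notin> B1" if x: "x \<in> pull P2" for x
  proof -
    have "x \<in> X1" "f x \<in> P2" using x pullP2 unfolding pull_def by auto
    then show "x \<notin> A1" "b \<in> P \<Longrightarrow> x \<notin> B1"
      using sepP[OF P(3), of "f x"] sepP[OF bP1, of "f x"] theta_a[of x] theta_b[of x] by auto
  qed
  have 1: "separated T (pull P1) (pull P2)"
  proof -
    have "theta T u v = -1" if u: "u \<in> pull P1" and v: "v \<in> pull P2" for u v
    proof (cases "u \<in> X1")
      case True
      have "v \<in> X1" "u \<noteq> v" using v pullP2 u dj unfolding pull_def by auto
      then show ?thesis using theta_f[of u v] True sepP[of "f u" "f v"] u v unfolding pull_def by auto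
    next
      case False
      then have uX: "u \<in> X2" using u verts_T unfolding pull_def by auto
      moreover have "u \<in> B2 \<Longrightarrow> b \<in> P" using u P(1) unfolding pull_def by auto
      moreover have "v \<in> X1" using pullP2 v by auto
      ultimately show ?thesis using cross'[of v u] P2A1[OF v] by auto
    qed
    moreover have "pull P1 \<noteq> {}"
    proof -
      obtain x where "x \<in> A2" using X2 by auto
      then have "x \<in> pull P1" using P(3) verts_T X2(1) unfolding pull_def by auto
      then show ?thesis by auto
    qed
    moreover have "pull P2 \<noteq> {}"
    proof -
      obtain x where "x \<in> X1" "f x \<in> P2" using ne(1) P2f by blast
      then have "x \<in> pull P2" using verts_T unfolding pull_def by auto
      then show ?thesis by auto
    qed
    moreover have "pull P1 \<inter> pull P2 = {}" using dj unfolding pull_def by auto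
    ultimately show ?thesis unfolding separated_def by blast
  qed
  have 2: "separated (complement T) (pull Q1) (pull Q2)"
  proof -
    have "theta T u v = 1" if u: "u \<in> pull Q1" and v: "v \<in> pull Q2" for u v
    proof (cases "u \<in> X1")
      case True
      have "v \<in> X1" "u \<noteq> v" using v pullQ2 u dj unfolding pull_def by auto
      then show ?thesis using theta_f[of u v] True sepQ[of "f u" "f v"] u v unfolding pull_def by auto
    next
      case False
      then have uX: "u \<in> X2" "u \<in> B2" using u verts_T X2(1) Q(1) PQ(2) a unfolding pull_def by auto
      then have "b \<in> Q" using u Q(1) unfolding pull_def by auto
      then have "v \<in> B1" "v \<in> X1" using Q2B1 v X1 by auto
      then show ?thesis using cross'[of v u] uX by auto
    qed
    moreover have "pull Q1 \<noteq> {}"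
    proof (cases "b \<in> Q1")
      case True
      obtain x where "x \<in> B2" using X2 by auto
      then have "x \<in> pull Q1" using True verts_T X2(1) unfolding pull_def by auto
      then show ?thesis by auto
    next
      case False
      obtain y where y: "y \<in> Q1" using ne by auto
      then obtain x where "x \<in> X1" "y = f x" using QX[of y] False Q(1) by blast
      then have "x \<in> pull Q1" using y verts_T unfolding pull_def by auto
      then show ?thesis by auto
    qed
    moreover have "pull Q2 \<noteq> {}"
    proof -
      obtain y where y: "y \<in> Q2" using ne by auto
      then have "y \<noteq> b" "y \<in> Q" using Q(1,3) dj by auto
      then obtain x where "x \<in> X1" "y = f x" using QX[of y] by blast
      then have "x \<in> pull Q2" using y verts_T unfolding pull_def by auto
      then show ?thesis by auto
    qed
    moreover have "pull Q1 \<inter> pull Q2 = {}" using dj unfolding pull_def by auto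
    ultimately show ?thesis unfolding separated_def by auto
  qed
  have cover: "pull P \<union> pull Q = verts T" "pull P \<inter> pull Q = {}"
  proof -
    have "phi x \<in> verts T'" if "x \<in> verts T" for x using that T'(2) unfolding phi_def by auto
    then show "pull P \<union> pull Q = verts T" "pull P \<inter> pull Q = {}"
      using PQ(1,2) unfolding pull_def by auto
  qed
  have "b \<in> P \<or> b \<in> Q1 \<and> pull Q2 \<subseteq> B1" using PQ(1) T'(2) Q(3) Q2B1 by auto
  then have anti: "\<nexists>q. odd_span (complement T) (pull Q) (pull P) q"
    using no_odd_antispan_pull[OF PQ(4,2) a Q(1) dj(2) 2] by blast
  have "set ms \<subseteq> P" using ms P(1) by auto
  then have "\<nexists>p. odd_span T (pull P) (pull Q) p" using no_odd_span_pull[OF PQ(3,2) a] by blast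
  then have "balanced_skew_partition T (pull P) (pull Q)"
    unfolding balanced_skew_partition_iff[OF T(1)] using cover anti 1 2 P(1) Q(1) pull_Un by metis
  then show ?thesis unfolding has_balanced_skew_partition_def by blast
qed

text \<open>Since \<open>a\<close> and \<open>b\<close> are not strongly adjacent, they would lie in
  the same part of \<open>Q\<close>. A vertex of the other part would be strongly adjacent to both,
  but \<open>A1\<close> and \<open>B1\<close> are disjoint.\<close>

lemma not_both_in_Q:
  assumes bsp: "balanced_skew_partition T' P Q"
  shows "a \<in> P \<or> b \<in> P"
proof (rule ccontr)
  assume "\<not> ?thesis"
  moreover have PQ: "P \<union> Q = verts T'"
    using bsp unfolding balanced_skew_partition_iff[OF T'(1)] by auto
  ultimately have ab: "a \<in> Q" "b \<in> Q" using T'(2) by auto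
  obtain Q1 Q2 where Q: "Q = Q1 \<union> Q2" "separated (complement T') Q1 Q2" "a \<in> Q1"
    using bsp ab separated_commute[OF trigraph_complement[OF T'(1)]]
    unfolding balanced_skew_partition_iff[OF T'(1)]
    by (metis Un_commute Un_iff sup_ge2 verts_complement)
  have sepQ: "theta T' u v = 1" if "u \<in> Q1" "v \<in> Q2" for u v
  proof -
    have "theta (complement T') u v = -1" using Q(2) that unfolding separated_def by blast
    then show ?thesis by simp
  qed
  have b: "b \<in> Q1" using sepQ[OF Q(3), of b] theta_ab ab(2) Q(1) by (auto split: if_splits)
  obtain y where y: "y \<in> Q2" "y \<noteq> a" "y \<noteq> b"
    using Q(2,3) b unfolding separated_def by blast
  have ya: "theta T' a y = 1" "theta T' b y = 1" using sepQ Q(3) b y by auto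
  have "y \<notin> set ms"
  proof
    assume m: "y \<in> set ms"
    then have "theta T' a y = 0" using theta_ms_ab[of y] theta_sym[OF T'(1), of a y] T'(2) by auto
    then show False using ya by simp
  qed
  then obtain x where "x \<in> X1" "y = f x" using y Q(1) PQ T'(2) by auto
  then show False using ya theta_a[of x] theta_b[of x] X1(3) by (auto split: if_splits)
qed

lemma has_balanced_skew_partition_pull:
  assumes "has_balanced_skew_partition T'"
  shows "has_balanced_skew_partition T"
proof -
  obtain P Q where bsp: "balanced_skew_partition T' P Q"
    using assms unfolding has_balanced_skew_partition_def by auto
  then show ?thesis
    using not_both_in_Q[OF bsp] balanced_skew_partition_pull[OF bsp]
      two_join_block.balanced_skew_partition_pull[OF swapped bsp] by blast
qed

end

section \<open>Blocks of homogeneous pairs\<close>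

text \<open>The conditions are stated by values so that they are visibly stable under two
  symmetries: complementation, which exchanges \<open>C\<close> with \<open>D\<close> and
  \<open>E\<close> with \<open>F\<close>, and the exchange of \<open>A\<close> with \<open>B\<close>
  together with \<open>C\<close> and \<open>D\<close>. These supply the antipath cases and the
  remaining placements of the markers.\<close>

locale homogeneous_pair =
  fixes T :: "'a trigraph" and A B C D E F X :: "'a set"
  assumes T: "trigraph T" "Berge T"
    and verts_T: "verts T = A \<union> B \<union> X" and X: "X = C \<union> D \<union> E \<union> F"
    and disjoint: "A \<inter> B = {}" "A \<inter> X = {}" "B \<inter> X = {}"
      "C \<inter> D = {}" "C \<inter> E = {}" "C \<inter> F = {}" "D \<inter> E = {}" "D \<inter> F = {}" "E \<inter> F = {}"
    and nonempty: "A \<noteq> {}" "B \<noteq> {}" "C \<noteq> {}" "D \<noteq> {}"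
    and theta_A: "\<And>x z. x \<in> A \<Longrightarrow> z \<in> X \<Longrightarrow> theta T x z = (if z \<in> C \<union> E then 1 else -1)"
    and theta_B: "\<And>x z. x \<in> B \<Longrightarrow> z \<in> X \<Longrightarrow> theta T x z = (if z \<in> D \<union> E then 1 else -1)"
    and neighbours: "\<And>x. x \<in> A \<Longrightarrow> \<exists>y\<in>B. theta T x y \<noteq> -1" "\<And>x. x \<in> A \<Longrightarrow> \<exists>y\<in>B. theta T x y \<noteq> 1"
      "\<And>y. y \<in> B \<Longrightarrow> \<exists>x\<in>A. theta T y x \<noteq> -1" "\<And>y. y \<in> B \<Longrightarrow> \<exists>x\<in>A. theta T y x \<noteq> 1"
begin

lemma complemented: "homogeneous_pair (complement T) A B D C F E X"
proof
  show "theta (complement T) x z = (if z \<in> D \<union> F then 1 else -1)" if "x \<in> A" "z \<in> X" for x z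
    using theta_A[OF that] that(2) X disjoint by (auto split: if_splits)
  show "theta (complement T) x z = (if z \<in> C \<union> F then 1 else -1)" if "x \<in> B" "z \<in> X" for x z
    using theta_B[OF that] that(2) X disjoint by (auto split: if_splits)
  show "\<exists>y\<in>B. theta (complement T) x y \<noteq> -1" "\<exists>y\<in>B. theta (complement T) x y \<noteq> 1" if "x \<in> A" for x
    using neighbours(1,2)[OF that] by (metis add.inverse_inverse theta_complement)+
  show "\<exists>x\<in>A. theta (complement T) y x \<noteq> -1" "\<exists>x\<in>A. theta (complement T) y x \<noteq> 1" if "y \<in> B" for y
    using neighbours(3,4)[OF that] by (metis add.inverse_inverse theta_complement)+
qed (use trigraph_complement Berge_complement T verts_T X disjoint nonempty in auto)

lemma swapped: "homogeneous_pair T B A D C E F X"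
  by unfold_locales (use T verts_T X disjoint nonempty theta_A theta_B neighbours in auto)

lemma theta_A': "x \<in> A \<Longrightarrow> z \<in> X \<Longrightarrow> theta T z x = (if z \<in> C \<union> E then 1 else -1)"
  using theta_A[of x z] theta_sym[OF T(1), of x z] verts_T by auto

lemma theta_B': "x \<in> B \<Longrightarrow> z \<in> X \<Longrightarrow> theta T z x = (if z \<in> D \<union> E then 1 else -1)"
  using theta_B[of x z] theta_sym[OF T(1), of x z] verts_T by auto

end

section \<open>The block on \<open>A \<union> B\<close>\<close>

locale homogeneous_pair_inside = homogeneous_pair T A B C D E F X
  for T :: "'a trigraph" and A B C D E F X :: "'a set" +
  fixes T' :: "'b trigraph" and f :: "'a \<Rightarrow> 'b" and c d :: 'b
  assumes T': "trigraph T'" "verts T' = f ` (A \<union> B) \<union> {c, d}"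
    and f: "inj_on f (A \<union> B)" "c \<notin> f ` (A \<union> B)" "d \<notin> f ` (A \<union> B)" and cd: "c \<noteq> d" "theta T' c d = 0"
    and theta_f: "\<And>u v. u \<in> A \<union> B \<Longrightarrow> v \<in> A \<union> B \<Longrightarrow> u \<noteq> v \<Longrightarrow> theta T' (f u) (f v) = theta T u v"
    and theta_c: "\<And>u. u \<in> A \<union> B \<Longrightarrow> theta T' c (f u) = (if u \<in> A then 1 else -1)"
    and theta_d: "\<And>u. u \<in> A \<union> B \<Longrightarrow> theta T' d (f u) = (if u \<in> B then 1 else -1)"
begin

lemma theta_dc: "theta T' d c = 0"
  using cd theta_sym[OF T'(1), of c d] T'(2) by auto

text \<open>In the complement it is \<open>d\<close> that is strongly complete to \<open>A\<close>,
  so the markers change places.\<close>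

lemma inside_complemented:
  "homogeneous_pair_inside (complement T) A B D C F E X (complement T') f d c"
proof (intro homogeneous_pair_inside.intro homogeneous_pair_inside_axioms.intro complemented)
  show "theta (complement T') d (f u) = (if u \<in> A then 1 else -1)" if "u \<in> A \<union> B" for u
    using theta_d[OF that] that disjoint by auto
  show "theta (complement T') c (f u) = (if u \<in> B then 1 else -1)" if "u \<in> A \<union> B" for u
    using theta_c[OF that] that disjoint by auto
qed (use trigraph_complement[OF T'(1)] T'(2) f cd theta_f theta_dc in auto)

lemma inside_swapped: "homogeneous_pair_inside T B A D C E F X T' f d c"
  by (intro homogeneous_pair_inside.intro homogeneous_pair_inside_axioms.intro swapped)
    (use T' f cd theta_f theta_c theta_d theta_dc in \<open>auto simp: Un_commute\<close>)

text \<open>Meant for \<open>c \<in> P\<close> and \<open>d \<in> Q\<close>. On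
  \<open>A \<union> B\<close> the sets \<open>C\<close> and \<open>D\<close> behave like
  \<open>c\<close> and \<open>d\<close>. The set \<open>F\<close>, strongly anticomplete to
  \<open>A \<union> B\<close>, does no harm in \<open>P\<close>, and \<open>E\<close>, strongly
  complete to it, does none in \<open>Q\<close>; their images only record the side.\<close>

definition phi :: "'a \<Rightarrow> 'b" where
  "phi x = (if x \<in> A \<union> B then f x else if x \<in> C \<union> F then c else d)"

lemma phi_simps [simp]:
  "x \<in> A \<Longrightarrow> phi x = f x" "x \<in> B \<Longrightarrow> phi x = f x" "x \<in> C \<Longrightarrow> phi x = c" "x \<in> F \<Longrightarrow> phi x = c"
  "x \<in> D \<Longrightarrow> phi x = d" "x \<in> E \<Longrightarrow> phi x = d"
  using disjoint X unfolding phi_def by auto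

lemma compatible_phi:
  assumes S: "S \<subseteq> A \<union> B \<union> C \<union> D"
    and unique: "\<And>x y. x \<in> S \<inter> C \<Longrightarrow> y \<in> S \<inter> C \<Longrightarrow> x = y" "\<And>x y. x \<in> S \<inter> D \<Longrightarrow> y \<in> S \<inter> D \<Longrightarrow> x = y"
  shows "compatible T T' phi S"
proof -
  have theta_c': "theta T' (f u) c = (if u \<in> A then 1 else -1)"
    and theta_d': "theta T' (f u) d = (if u \<in> B then 1 else -1)" if "u \<in> A \<union> B" for u
    using theta_c[OF that] theta_d[OF that] theta_sym[OF T'(1), of "f u" c]
      theta_sym[OF T'(1), of "f u" d] T'(2) that by auto
  have C: "theta T u z = (if u \<in> A then 1 else -1)" "theta T z u = (if u \<in> A then 1 else -1)"
    if "u \<in> A \<union> B" "z \<in> C" for u z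
    using that theta_A[of u z] theta_A'[of u z] theta_B[of u z] theta_B'[of u z] X disjoint by auto
  have D: "theta T u z = (if u \<in> B then 1 else -1)" "theta T z u = (if u \<in> B then 1 else -1)"
    if "u \<in> A \<union> B" "z \<in> D" for u z
    using that theta_A[of u z] theta_A'[of u z] theta_B[of u z] theta_B'[of u z] X disjoint by auto
  have "phi u \<noteq> phi v \<and> (theta T' (phi u) (phi v) = theta T u v \<or> theta T' (phi u) (phi v) = 0)"
    if uv: "u \<in> S" "v \<in> S" "u \<noteq> v" for u v
  proof -
    have ff: "phi x = f x" if "x \<in> A \<union> B" for x using that by auto
    consider "u \<in> A \<union> B" "v \<in> A \<union> B" | "u \<in> A \<union> B" "v \<in> C" | "u \<in> A \<union> B" "v \<in> D" | "u \<in> C" "v \<in> A \<union> B"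
      | "u \<in> D" "v \<in> A \<union> B" | "u \<in> C" "v \<in> D" | "u \<in> D" "v \<in> C"
      using unique uv S by blast
    then show ?thesis
    proof cases
      case 1 then show ?thesis using theta_f uv f(1) ff by (auto dest: inj_onD)
    next
      case 2 then show ?thesis using C[OF 2] theta_c'[OF 2(1)] f(2) ff[OF 2(1)] by auto
    next
      case 3 then show ?thesis using D[OF 3] theta_d'[OF 3(1)] f(3) ff[OF 3(1)] by auto
    next
      case 4 then show ?thesis using C[OF 4(2,1)] theta_c[OF 4(2)] f(2) ff[OF 4(2)] by auto
    next
      case 5 then show ?thesis using D[OF 5(2,1)] theta_d[OF 5(2)] f(3) ff[OF 5(2)] by auto
    qed (use cd theta_dc in auto)
  qed
  moreover have "phi u \<in> verts T'" for u unfolding phi_def using T'(2) by auto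
  ultimately show ?thesis unfolding compatible_def by blast
qed

text \<open>An edge from \<open>A \<union> B\<close> to \<open>C \<union> F\<close> joins
  \<open>A\<close> to \<open>C\<close>. The vertex of \<open>A\<close> before the first entry into
  \<open>X\<close> is strongly complete to \<open>C\<close>, so the last vertex in \<open>X\<close>,
  also in \<open>C\<close>, equals the first: the path meets \<open>X\<close> at most once.\<close>

lemma inside_ends:
  assumes p: "odd_span T P Q p" and P: "P \<subseteq> A \<union> B \<union> C \<union> F"
    and ends: "p ! 0 \<in> A \<union> B" "p ! (length p - 1) \<in> A \<union> B"
  shows "compatible T T' phi (set p)"
proof -
  have pp: "path T p" "\<And>i. 0 < i \<Longrightarrow> i < length p - 1 \<Longrightarrow> p ! i \<in> P"
    using p unfolding odd_span_def by auto
  have XAB: "X \<inter> (A \<union> B) = {}" using disjoint by auto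
  have inn: "p ! i \<in> C \<union> F" if "i < length p" "p ! i \<in> X" for i
  proof -
    have "i \<noteq> 0" "i \<noteq> length p - 1" using that ends XAB by (metis disjoint_iff)+
    then have "p ! i \<in> P" using pp(2)[of i] that by linarith
    then show ?thesis using P that XAB by auto
  qed
  have AC: "z \<in> A \<and> y \<in> C" if "z \<in> A \<union> B" "y \<in> C \<union> F" "theta T z y \<noteq> -1" for y z
    using theta_A[of z y] theta_B[of z y] that X disjoint by (auto split: if_splits)
  have AC1: "theta T z y = 1" if "z \<in> A" "y \<in> C" for y z using theta_A[of z y] that X by auto
  have single: "k = l" "p ! k \<in> C" if k: "k < length p" "p ! k \<in> X" and l: "l < length p" "p ! l \<in> X" for k l
  proof -
    have e: "p ! 0 \<notin> X" "p ! (length p - 1) \<notin> X" using ends XAB by auto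
    obtain i where i: "0 < i" "i < length p" "p ! i \<in> X" "\<forall>l<i. p ! l \<notin> X"
      "theta T (p ! (i - 1)) (p ! i) \<noteq> -1"
      "\<forall>l<length p. p ! l \<in> X \<longrightarrow> theta T (p ! (i - 1)) (p ! l) = 1 \<longrightarrow> l = i"
      by (rule first_entry[OF T(1) pp(1) e(1) k]) (rule that)
    obtain j where j: "Suc j < length p" "p ! j \<in> X" "\<forall>l<length p. j < l \<longrightarrow> p ! l \<notin> X"
      "theta T (p ! Suc j) (p ! j) \<noteq> -1"
      by (rule last_entry[OF T(1) pp(1) e(2) k]) (rule that)
    have "p ! (i - 1) \<in> A \<union> B" using path_nth_in_verts[OF pp(1), of "i - 1"] i(1,2,4) verts_T by auto
    then have iA: "p ! (i - 1) \<in> A" "p ! i \<in> C" using AC inn[OF i(2,3)] i(5) by auto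
    have j': "j < length p" using j(1) by simp
    have "p ! Suc j \<in> A \<union> B" using path_nth_in_verts[OF pp(1) j(1)] j(1,3) verts_T by auto
    then have "p ! j \<in> C" using AC inn[OF j' j(2)] j(4) by auto
    then have "j = i" using i(6) AC1[OF iA(1)] j' j(2) by auto
    moreover have "i \<le> k" "i \<le> l" "k \<le> j" "l \<le> j" using i(4) j(3) k l by (metis not_le)+
    ultimately show "k = l" "p ! k \<in> C" using iA(2) by auto
  qed
  show ?thesis
  proof (rule compatible_phi)
    show "set p \<subseteq> A \<union> B \<union> C \<union> D"
    proof
      fix x assume "x \<in> set p"
      then obtain k where k: "k < length p" "p ! k = x" by (metis in_set_conv_nth)
      then show "x \<in> A \<union> B \<union> C \<union> D"
        using single(2)[of k k] path_nth_in_verts[OF pp(1) k(1)] verts_T by auto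
    qed
  qed (use single(1) X in \<open>metis IntE UnCI in_set_conv_nth\<close>)+
qed

text \<open>Such a path is either \<open>D\<close> followed by vertices of \<open>A \<union> B\<close> and at most one vertex of \<open>C\<close>, or it
  is of the form \<open>D, F, \<dots>, F, C, A\<close>; in the second case a neighbour in \<open>B\<close> of its last vertex closes
  it to an odd hole.\<close>

lemma mixed_ends:
  assumes p: "odd_span T P Q p" and P: "P \<subseteq> A \<union> B \<union> C \<union> F"
    and ends: "p ! 0 \<in> D \<union> E" "p ! (length p - 1) \<in> A \<union> B"
  shows "compatible T T' phi (set p)"
proof -
  define n where "n = length p"
  have pp: "path T p" "4 \<le> n" and inn: "\<And>i. 0 < i \<Longrightarrow> i < n - 1 \<Longrightarrow> p ! i \<in> A \<union> B \<union> C \<union> F"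
    using p P unfolding odd_span_def n_def by auto
  note cons = path_consecutive[OF T(1) pp(1), folded n_def]
  note ncons = path_not_consecutive[OF T(1) pp(1), folded n_def]
  have lt: "0 < n" "n - 1 < n" using pp(2) by linarith+
  \<comment> \<open>The ends are not consecutive, hence not strongly adjacent. This excludes
    \<open>E\<close> for the first, since \<open>E\<close> is strongly complete to
    \<open>A \<union> B\<close>, and \<open>B\<close> for the last, since \<open>B\<close> is
    strongly complete to \<open>D\<close>.\<close>
  have far: "theta T (p ! (n - 1)) (p ! 0) \<noteq> 1" using cons[of "n - 1" 0] pp(2) by linarith
  have e: "p ! 0 \<in> D" "p ! (n - 1) \<in> A"
    using far ends theta_A[of "p ! (n - 1)" "p ! 0"] theta_B[of "p ! (n - 1)" "p ! 0"] X disjoint n_def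
    by (auto split: if_splits)
  \<comment> \<open>The last vertex, in \<open>A\<close>, is strongly complete to \<open>C\<close>,
    so only its predecessor can be in \<open>C\<close>.\<close>
  have C: "i = n - 2" if i: "i < n" "p ! i \<in> C" for i
  proof -
    have "theta T (p ! (n - 1)) (p ! i) = 1" "n - 1 \<noteq> i"
      using theta_A[OF e(2), of "p ! i"] i(2) X e(2) disjoint by auto
    then have "i = Suc (n - 1) \<or> n - 1 = Suc i" using cons[of "n - 1" i] lt i by blast
    then show ?thesis using i by linarith
  qed
  have D: "i = 0" if i: "i < n" "p ! i \<in> D \<union> E" for i
  proof (rule ccontr)
    assume "i \<noteq> 0"
    moreover have "i \<noteq> n - 1" using i e(2) X disjoint by auto
    ultimately have "p ! i \<in> A \<union> B \<union> C \<union> F" using inn[of i] i by linarith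
    then show False using i X disjoint by auto
  qed
  have F_nb: "p ! k \<notin> A \<union> B" if "k < n" "l < n" "l = Suc k \<or> k = Suc l" "p ! l \<in> F" for k l
  proof -
    have "theta T (p ! k) (p ! l) \<noteq> -1" using ncons[OF that(1,2)] that(3) by auto
    moreover have "p ! l \<in> X" "p ! l \<notin> C \<union> D \<union> E" using that(4) X disjoint by auto
    ultimately show ?thesis using theta_A[of "p ! k" "p ! l"] theta_B[of "p ! k" "p ! l"] by auto
  qed
  have noF: "p ! m \<notin> F" if m: "m < n" for m
  proof
    assume mF: "p ! m \<in> F"
    have F_inner: "0 < l \<and> l < n - 1" if "l < n" "p ! l \<in> F" for l
    proof -
      have "l \<noteq> 0" "l \<noteq> n - 1" using that e X disjoint by auto
      then show ?thesis using that by linarith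
    qed
    define L where "L = {l. l < n \<and> p ! l \<in> F}"
    have fin: "finite L" "m \<in> L" unfolding L_def using m mF by auto
    define l where "l = Max L"
    have "l \<in> L" using fin Max_in unfolding l_def by blast
    then have l: "l < n" "p ! l \<in> F" unfolding L_def by auto
    have l': "0 < l" "l < n - 1" using F_inner[OF l] by auto
    then have sl: "Suc l < n" by linarith
    \<comment> \<open>The successor of the last vertex in \<open>F\<close> is outside
      \<open>F\<close>, and outside \<open>A \<union> B\<close> because \<open>F\<close> has no
      neighbour there. It is therefore in \<open>C\<close> and is the last but one vertex.\<close>
    have "Suc l \<notin> L" using Max_ge[OF fin(1), of "Suc l"] unfolding l_def by (meson not_less_eq_eq order_refl)
    then have "p ! Suc l \<notin> F" using sl unfolding L_def by auto
    moreover have nAB: "p ! Suc l \<notin> A \<union> B" using F_nb[OF sl l(1) _ l(2)] by auto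
    moreover have "Suc l \<noteq> n - 1" using nAB e(2) by auto
    ultimately have "p ! Suc l \<in> C" using inn[of "Suc l"] sl by fastforce
    then have ln: "Suc l = n - 2" using C[OF sl] by simp
    \<comment> \<open>Walking back from \<open>l\<close>, the path cannot enter
      \<open>A \<union> B\<close> from \<open>F\<close>, and \<open>C\<close> occurs only at
      \<open>n - 2\<close>.\<close>
    have FF: "p ! (l - k) \<in> F" if "k < l" for k
      using that
    proof (induction k)
      case 0
      then show ?case using l by simp
    next
      case (Suc k)
      then have F: "p ! (l - k) \<in> F" by simp
      have k: "l - Suc k < n" "l - k < n" "l - k = Suc (l - Suc k)" "0 < l - Suc k" "l - Suc k < n - 1"
        using Suc.prems l(1) l' by linarith+
      have "p ! (l - Suc k) \<notin> A \<union> B" using F_nb[OF k(1,2) _ F] k(3) by blast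
      moreover have "p ! (l - Suc k) \<notin> C" using C[OF k(1)] ln by linarith
      ultimately show ?case using inn[OF k(4,5)] by auto
    qed
    have all: "p ! i \<in> C \<union> F" if "0 < i" "i < n - 1" for i
    proof (cases "i = n - 2")
      case True
      then show ?thesis using \<open>p ! Suc l \<in> C\<close> ln by simp
    next
      case False
      then have "i = l - (l - i)" "l - i < l" using that ln by linarith+
      then show ?thesis using FF[of "l - i"] by auto
    qed
    obtain y where y: "y \<in> B" "theta T (p ! (n - 1)) y \<noteq> -1" using neighbours(1)[OF e(2)] by auto
    have "p ! (n - 1) \<in> verts T" "y \<in> verts T" using e(2) y(1) verts_T by auto
    then have y2: "theta T y (p ! (n - 1)) \<noteq> -1" using y(2) theta_sym[OF T(1)] by metis
    have y0: "theta T y (p ! 0) = 1" using theta_B[OF y(1), of "p ! 0"] e(1) X by auto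
    have yi: "theta T y (p ! i) = -1" if "0 < i" "i < n - 1" for i
      using theta_B[OF y(1), of "p ! i"] all[OF that] X disjoint by auto
    have "y \<notin> set p"
    proof
      assume "y \<in> set p"
      then obtain i where i: "i < n" "p ! i = y" unfolding n_def by (metis in_set_conv_nth)
      have "i \<noteq> 0" "i \<noteq> n - 1" using i y(1) e X disjoint by auto
      then have "y \<in> C \<union> F" using all[of i] i by fastforce
      then show False using y(1) X disjoint by auto
    qed
    then show False
      using Berge_no_closing_vertex[OF T p, of y] y0 y2 yi y(1) verts_T unfolding n_def by auto
  qed
  show ?thesis
  proof (rule compatible_phi)
    show "set p \<subseteq> A \<union> B \<union> C \<union> D"
    proof
      fix x assume "x \<in> set p"
      then obtain k where k: "k < n" "p ! k = x" unfolding n_def by (metis in_set_conv_nth)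
      then show "x \<in> A \<union> B \<union> C \<union> D"
        using noF[of k] inn[of k] e by (cases "k = 0"; cases "k = n - 1") auto
    qed
  qed (use C D n_def in \<open>metis IntE UnCI in_set_conv_nth\<close>)+
qed

text \<open>The marker \<open>c\<close> is strongly complete to \<open>A\<close>, which keeps
  \<open>A\<close> out of the part separated from \<open>c\<close>.\<close>

lemma part_in_B:
  assumes "separated T' P1 P2" "P1 \<union> P2 \<subseteq> verts T'" "c \<in> P1" "d \<notin> P1 \<union> P2"
  shows "\<And>y. y \<in> P2 \<Longrightarrow> \<exists>x\<in>B. y = f x" "\<And>x. x \<in> A \<union> B \<Longrightarrow> f x \<in> P2 \<Longrightarrow> x \<in> B"
proof -
  show *: "x \<in> B" if "x \<in> A \<union> B" "f x \<in> P2" for x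
    using assms(1,3) that theta_c[OF that(1)] unfolding separated_def by (auto split: if_splits)
  show "\<exists>x\<in>B. y = f x" if "y \<in> P2" for y
  proof -
    have "y \<noteq> c" "y \<noteq> d" using assms that unfolding separated_def by auto
    then have "y \<in> f ` (A \<union> B)" using assms(2) that T'(2) by blast
    then obtain x where "x \<in> A \<union> B" "y = f x" by blast
    then show ?thesis using * that by blast
  qed
qed

text \<open>The second part lies in \<open>B\<close>, and \<open>B\<close> is strongly anticomplete
  to \<open>C \<union> F\<close>, so this set can join the first part.\<close>

lemma separated_inside:
  assumes "separated T' P1 P2" "P1 \<union> P2 \<subseteq> verts T'" "c \<in> P1" "d \<notin> P1 \<union> P2"
  shows "separated T ((A \<union> B) \<inter> f -` P1 \<union> C \<union> F) ((A \<union> B) \<inter> f -` P2)"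
proof -
  have sep: "P2 \<noteq> {}" "P1 \<inter> P2 = {}" "\<And>u v. u \<in> P1 \<Longrightarrow> v \<in> P2 \<Longrightarrow> theta T' u v = -1"
    using assms(1) unfolding separated_def by auto
  note inB = part_in_B[OF assms]
  have "theta T u v = -1" if u: "u \<in> (A \<union> B) \<inter> f -` P1 \<union> C \<union> F" and v: "v \<in> (A \<union> B) \<inter> f -` P2" for u v
  proof (cases "u \<in> C \<union> F")
    case True
    then show ?thesis using theta_B'[of v u] inB(2)[of v] v X disjoint by auto
  next
    case False
    then have "u \<in> A \<union> B" "f u \<in> P1" "v \<in> A \<union> B" "f v \<in> P2" "u \<noteq> v" using u v sep(2) by auto
    then show ?thesis using theta_f[of u v] sep(3)[of "f u" "f v"] by simp
  qed
  moreover have "(A \<union> B) \<inter> f -` P2 \<noteq> {}" using sep(1) inB(1) by fastforce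
  moreover have "((A \<union> B) \<inter> f -` P1 \<union> C \<union> F) \<inter> ((A \<union> B) \<inter> f -` P2) = {}" using sep(2) X disjoint by auto
  ultimately show ?thesis using nonempty unfolding separated_def by auto
qed

lemma no_odd_span_inside:
  assumes no: "\<nexists>p'. odd_span T' P Q p'" and disj: "P \<inter> Q = {}"
    and P: "P = P1 \<union> P2" "separated T' P1 P2" "P \<subseteq> verts T'" "c \<in> P1" and d: "d \<in> Q"
  shows "\<not> odd_span T ((A \<union> B) \<inter> f -` P \<union> C \<union> F) ((A \<union> B) \<inter> f -` Q \<union> D \<union> E) p"
proof
  let ?P = "(A \<union> B) \<inter> f -` P \<union> C \<union> F" and ?Q = "(A \<union> B) \<inter> f -` Q \<union> D \<union> E"
  let ?P1 = "(A \<union> B) \<inter> f -` P1 \<union> C \<union> F" and ?P2 = "(A \<union> B) \<inter> f -` P2"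
  assume p: "odd_span T ?P ?Q p"
  have P12: "P1 \<union> P2 \<subseteq> verts T'" "d \<notin> P1 \<union> P2" using P d disj by auto
  note inB = part_in_B[OF P(2) P12(1) P(4) P12(2)]
  note sep = separated_inside[OF P(2) P12(1) P(4) P12(2)]
  have transfer: False if "compatible T T' phi (set p)"
  proof -
    have "phi x \<in> P" if "x \<in> ?P" for x using that P(1,4) by auto
    moreover have "phi x \<in> Q" if "x \<in> ?Q" for x using that d by auto
    ultimately show False using odd_span_map[OF T(1) T'(1) p that] no by blast
  qed
  define n where "n = length p"
  have pp: "path T p" "4 \<le> n" "p ! 0 \<in> ?Q" "p ! (n - 1) \<in> ?Q" "p \<noteq> []"
    using p unfolding odd_span_def n_def path_def by auto
  have union: "?P = ?P1 \<union> ?P2" using P(1) by auto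
  have sub: "?P \<subseteq> verts T" using verts_T X by auto
  have theta: "\<forall>u\<in>?P1. \<forall>v\<in>?P2. theta T u v = -1" using sep unfolding separated_def by (elim conjE)
  have "(\<forall>i. 0 < i \<and> i < n - 1 \<longrightarrow> p ! i \<in> ?P1) \<or> (\<forall>i. 0 < i \<and> i < n - 1 \<longrightarrow> p ! i \<in> ?P2)"
    unfolding n_def by (rule odd_span_interior_in_part[OF T(1) p union sub theta])
  then show False
  proof
    assume 1: "\<forall>i. 0 < i \<and> i < n - 1 \<longrightarrow> p ! i \<in> ?P1"
    show False
    proof (cases "p ! 0 \<in> D \<union> E \<and> p ! (n - 1) \<in> D \<union> E")
      case True
      \<comment> \<open>Any \<open>w\<close> in the second part is in \<open>B\<close>, hence
        strongly complete to \<open>D \<union> E\<close>, and it is strongly anticomplete to the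
        interior: it closes an odd hole.\<close>
      obtain w where w: "w \<in> ?P2" "w \<in> B" using sep inB(2) unfolding separated_def by blast
      have wv: "w \<in> verts T" using w(2) verts_T by auto
      have DE: "theta T w y = 1" if "y \<in> D \<union> E" for y using theta_B[OF w(2), of y] that X by auto
      have P1: "theta T w y = -1" if "y \<in> ?P1" for y
      proof -
        have "theta T y w = -1" using sep that w(1) unfolding separated_def by blast
        moreover have "y \<in> verts T" using that verts_T X by auto
        ultimately show ?thesis using theta_sym[OF T(1) wv, of y] by simp
      qed
      have "w \<notin> set p"
      proof
        assume "w \<in> set p"
        then obtain i where i: "i < n" "p ! i = w" unfolding n_def by (metis in_set_conv_nth)
        have "i \<noteq> 0" "i \<noteq> n - 1" using i True w(2) X disjoint by auto
        then have "w \<in> ?P1" using 1 i by fastforce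
        then show False using w(1) sep unfolding separated_def by blast
      qed
      then show False
        using Berge_no_closing_vertex[OF T p wv] DE P1 1 True unfolding n_def by fastforce
    next
      case False
      have PP: "?P \<subseteq> A \<union> B \<union> C \<union> F" by auto
      consider "p ! 0 \<in> A \<union> B" "p ! (n - 1) \<in> A \<union> B" | "p ! 0 \<in> D \<union> E" "p ! (n - 1) \<in> A \<union> B"
        | "p ! (n - 1) \<in> D \<union> E" "p ! 0 \<in> A \<union> B"
        using False pp(3,4) by auto
      then show False
      proof cases
        case 1
        then show False using transfer inside_ends[OF p PP] n_def by auto
      next
        case 2
        then show False using transfer mixed_ends[OF p PP] n_def by auto
      next
        case 3
        then show False
          using transfer mixed_ends[OF odd_span_rev[OF T(1) p] PP]
            rev_nth_0[OF pp(5)] rev_nth_last[OF pp(5)] n_def by auto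
      qed
    qed
  next
    assume 2: "\<forall>i. 0 < i \<and> i < n - 1 \<longrightarrow> p ! i \<in> ?P2"
    \<comment> \<open>An end in \<open>D \<union> E\<close> would be strongly adjacent to the
      interior vertex at distance two, which is in \<open>B\<close>. So both ends are in
      \<open>A \<union> B\<close>.\<close>
    have B: "p ! i \<in> B" if "0 < i" "i < n - 1" for i using 2 that inB(2) by auto
    have i2: "p ! 2 \<in> B" "p ! (n - 3) \<in> B" using B[of 2] B[of "n - 3"] pp(2) by auto
    have "theta T (p ! 2) (p ! 0) \<noteq> 1"
      using path_consecutive[OF T(1) pp(1), of 2 0] pp(2) n_def by linarith
    then have "p ! 0 \<in> A \<union> B" using pp(3) theta_B[OF i2(1), of "p ! 0"] X by auto
    moreover have "theta T (p ! (n - 3)) (p ! (n - 1)) \<noteq> 1"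
      using path_consecutive[OF T(1) pp(1), of "n - 3" "n - 1"] pp(2) n_def by linarith
    then have "p ! (n - 1) \<in> A \<union> B" using pp(4) theta_B[OF i2(2), of "p ! (n - 1)"] X by auto
    ultimately show False using transfer inside_ends[OF p] n_def by auto
  qed
qed

lemma balanced_skew_partition_inside:
  assumes bsp: "balanced_skew_partition T' P Q" and cP: "c \<in> P" and dQ: "d \<in> Q"
  shows "has_balanced_skew_partition T"
proof -
  note cT' = trigraph_complement[OF T'(1)]
  have PQ: "P \<union> Q = verts T'" "P \<inter> Q = {}" "\<nexists>p. odd_span T' P Q p" "\<nexists>p. odd_span (complement T') Q P p"
    using bsp unfolding balanced_skew_partition_iff[OF T'(1)] by auto
  obtain P1 P2 where P: "P = P1 \<union> P2" "separated T' P1 P2" "c \<in> P1"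
    using bsp cP separated_commute[OF T'(1)] unfolding balanced_skew_partition_iff[OF T'(1)]
    by (metis Un_commute Un_iff sup_ge1)
  obtain Q1 Q2 where Q: "Q = Q1 \<union> Q2" "separated (complement T') Q1 Q2" "d \<in> Q1"
    using bsp dQ separated_commute[OF cT'] unfolding balanced_skew_partition_iff[OF T'(1)]
    by (metis Un_commute Un_iff sup_ge2 verts_complement)
  \<comment> \<open>In the complemented configuration \<open>d\<close> and \<open>Q\<close> play the
    roles of \<open>c\<close> and \<open>P\<close>, so the statements about paths also settle the
    antipaths.\<close>
  interpret co: homogeneous_pair_inside "complement T" A B D C F E X "complement T'" f d c
    by (rule inside_complemented)
  let ?P = "(A \<union> B) \<inter> f -` P \<union> C \<union> F" and ?Q = "(A \<union> B) \<inter> f -` Q \<union> D \<union> E"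
  let ?P1 = "(A \<union> B) \<inter> f -` P1 \<union> C \<union> F" and ?P2 = "(A \<union> B) \<inter> f -` P2"
  let ?Q1 = "(A \<union> B) \<inter> f -` Q1 \<union> D \<union> E" and ?Q2 = "(A \<union> B) \<inter> f -` Q2"
  have "separated T ?P1 ?P2" using separated_inside[OF P(2) _ P(3)] P(1) PQ dQ by auto
  moreover have "separated (complement T) ?Q1 ?Q2"
    using co.separated_inside[OF Q(2) _ Q(3)] Q(1) PQ cP by auto
  moreover have "?P = ?P1 \<union> ?P2" "?Q = ?Q1 \<union> ?Q2" using P(1) Q(1) by auto
  moreover have "\<nexists>p. odd_span T ?P ?Q p"
    using no_odd_span_inside[OF PQ(3,2) P(1,2) _ P(3) dQ] PQ(1) by blast
  moreover have "\<nexists>p. odd_span (complement T) ?Q ?P p"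
    using co.no_odd_span_inside[OF PQ(4) _ Q(1,2) _ Q(3) cP] PQ(1,2) by auto
  moreover have "?P \<union> ?Q = verts T"
  proof -
    have "f x \<in> P \<union> Q" if "x \<in> A \<union> B" for x using that PQ(1) T'(2) by auto
    then show ?thesis using verts_T X by auto
  qed
  moreover have "?P \<inter> ?Q = {}" using PQ(2) X disjoint by auto
  ultimately have "balanced_skew_partition T ?P ?Q"
    unfolding balanced_skew_partition_iff[OF T(1)] by blast
  then show ?thesis unfolding has_balanced_skew_partition_def by blast
qed

text \<open>The switchable pair puts both markers into one part, but every vertex of
  \<open>A \<union> B\<close> is strongly adjacent to \<open>c\<close> or to \<open>d\<close>, and
  nothing is left for the other part.\<close>

lemma markers_not_both_in_P:
  assumes bsp: "balanced_skew_partition T' P Q"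
  shows "\<not> (c \<in> P \<and> d \<in> P)"
proof
  assume cdP: "c \<in> P \<and> d \<in> P"
  then obtain P1 P2 where P: "P = P1 \<union> P2" "separated T' P1 P2" "c \<in> P1"
    using bsp separated_commute[OF T'(1)] unfolding balanced_skew_partition_iff[OF T'(1)]
    by (metis Un_commute Un_iff sup_ge1)
  have PQ: "P \<subseteq> verts T'" using bsp unfolding balanced_skew_partition_iff[OF T'(1)] by auto
  have sep: "P2 \<noteq> {}" "P1 \<inter> P2 = {}" "\<And>u v. u \<in> P1 \<Longrightarrow> v \<in> P2 \<Longrightarrow> theta T' u v = -1"
    using P(2) unfolding separated_def by auto
  have d: "d \<in> P1" using sep(3)[OF P(3), of d] cd(2) cdP P(1) by auto
  obtain y where y: "y \<in> P2" "y \<noteq> c" "y \<noteq> d" using sep P(3) d by blast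
  then have "y \<in> f ` (A \<union> B)" using PQ P(1) T'(2) by blast
  then obtain x where "x \<in> A \<union> B" "y = f x" by blast
  then show False using sep(3)[OF P(3) y(1)] sep(3)[OF d y(1)] theta_c[of x] theta_d[of x]
    by (auto split: if_splits)
qed

lemma has_balanced_skew_partition_inside:
  assumes "has_balanced_skew_partition T'"
  shows "has_balanced_skew_partition T"
proof -
  obtain P Q where bsp: "balanced_skew_partition T' P Q"
    using assms unfolding has_balanced_skew_partition_def by auto
  have "P \<union> Q = verts T'" using bsp unfolding balanced_skew_partition_iff[OF T'(1)] by auto
  moreover have "\<not> (c \<in> P \<and> d \<in> P)" by (rule markers_not_both_in_P[OF bsp])
  moreover have "\<not> (d \<in> Q \<and> c \<in> Q)"
    by (rule homogeneous_pair_inside.markers_not_both_in_P[OF inside_complemented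
        balanced_skew_partition_complement[OF T'(1) bsp]])
  ultimately have "c \<in> P \<and> d \<in> Q \<or> d \<in> P \<and> c \<in> Q" using T'(2) by auto
  then show ?thesis
    using balanced_skew_partition_inside[OF bsp]
      homogeneous_pair_inside.balanced_skew_partition_inside[OF inside_swapped bsp] by blast
qed

end

section \<open>The block on the vertices outside \<open>A \<union> B\<close>\<close>

locale homogeneous_pair_outside = homogeneous_pair T A B C D E F X
  for T :: "'a trigraph" and A B C D E F X :: "'a set" +
  fixes T' :: "'b trigraph" and f :: "'a \<Rightarrow> 'b" and a b :: 'b
  assumes T': "trigraph T'" "verts T' = f ` X \<union> {a, b}"
    and f: "inj_on f X" "a \<notin> f ` X" "b \<notin> f ` X" and ab: "a \<noteq> b" "theta T' a b = 0"
    and theta_f: "\<And>u v. u \<in> X \<Longrightarrow> v \<in> X \<Longrightarrow> u \<noteq> v \<Longrightarrow> theta T' (f u) (f v) = theta T u v"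
    and theta_a: "\<And>u. u \<in> X \<Longrightarrow> theta T' a (f u) = (if u \<in> C \<union> E then 1 else -1)"
    and theta_b: "\<And>u. u \<in> X \<Longrightarrow> theta T' b (f u) = (if u \<in> D \<union> E then 1 else -1)"
begin

lemma theta_ba: "theta T' b a = 0"
  using ab theta_sym[OF T'(1), of a b] T'(2) by auto

text \<open>Here \<open>a\<close> and \<open>b\<close> stand for \<open>A\<close> and
  \<open>B\<close> themselves, so complementation does not exchange them.\<close>

lemma outside_complemented:
  "homogeneous_pair_outside (complement T) A B D C F E X (complement T') f a b"
proof (intro homogeneous_pair_outside.intro homogeneous_pair_outside_axioms.intro complemented)
  show "theta (complement T') a (f u) = (if u \<in> D \<union> F then 1 else -1)" if "u \<in> X" for u
    using theta_a[OF that] that X disjoint by (auto split: if_splits)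
  show "theta (complement T') b (f u) = (if u \<in> C \<union> F then 1 else -1)" if "u \<in> X" for u
    using theta_b[OF that] that X disjoint by (auto split: if_splits)
qed (use trigraph_complement[OF T'(1)] T'(2) f ab theta_f in auto)

lemma outside_swapped: "homogeneous_pair_outside T B A D C E F X T' f b a"
  by (intro homogeneous_pair_outside.intro homogeneous_pair_outside_axioms.intro swapped)
    (use T' f ab theta_f theta_a theta_b theta_ba in auto)

definition phi :: "'a \<Rightarrow> 'b" where
  "phi x = (if x \<in> X then f x else if x \<in> A then a else b)"

lemma phi_simps [simp]: "x \<in> X \<Longrightarrow> phi x = f x" "x \<in> A \<Longrightarrow> phi x = a" "x \<in> B \<Longrightarrow> phi x = b"
  using disjoint unfolding phi_def by auto

lemma compatible_phi:
  assumes S: "S \<subseteq> verts T"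
    and unique: "\<And>x y. x \<in> S \<inter> A \<Longrightarrow> y \<in> S \<inter> A \<Longrightarrow> x = y" "\<And>x y. x \<in> S \<inter> B \<Longrightarrow> y \<in> S \<inter> B \<Longrightarrow> x = y"
  shows "compatible T T' phi S"
proof -
  have theta_a': "theta T' (f u) a = (if u \<in> C \<union> E then 1 else -1)"
    and theta_b': "theta T' (f u) b = (if u \<in> D \<union> E then 1 else -1)" if "u \<in> X" for u
    using theta_a[OF that] theta_b[OF that] theta_sym[OF T'(1), of "f u" a]
      theta_sym[OF T'(1), of "f u" b] T'(2) that by auto
  have "phi u \<noteq> phi v \<and> (theta T' (phi u) (phi v) = theta T u v \<or> theta T' (phi u) (phi v) = 0)"
    if uv: "u \<in> S" "v \<in> S" "u \<noteq> v" for u v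
  proof -
    consider "u \<in> X" "v \<in> X" | "u \<in> X" "v \<in> A" | "u \<in> X" "v \<in> B" | "u \<in> A" "v \<in> X"
      | "u \<in> B" "v \<in> X" | "u \<in> A" "v \<in> B" | "u \<in> B" "v \<in> A"
      using unique uv S verts_T by blast
    then show ?thesis
    proof cases
      case 1 then show ?thesis using theta_f uv f(1) by (auto dest: inj_onD)
    next
      case 2 then show ?thesis using theta_A'[OF 2(2,1)] theta_a'[OF 2(1)] f(2) by auto
    next
      case 3 then show ?thesis using theta_B'[OF 3(2,1)] theta_b'[OF 3(1)] f(3) by auto
    next
      case 4 then show ?thesis using theta_A[OF 4] theta_a[OF 4(2)] f(2) by auto
    next
      case 5 then show ?thesis using theta_B[OF 5] theta_b[OF 5(2)] f(3) by auto
    qed (use ab theta_ba in auto)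
  qed
  moreover have "phi u \<in> verts T'" for u unfolding phi_def using T'(2) by auto
  ultimately show ?thesis unfolding compatible_def by blast
qed

text \<open>Each vertex of \<open>X\<close> treats all of \<open>A\<close> alike and all of
  \<open>B\<close> alike. So the first and the last vertex in \<open>A \<union> B\<close> are each
  alone in their class, and if the classes agree, the two positions agree.\<close>

lemma compatible_X_ends:
  assumes p: "path T p" "p ! 0 \<in> X" "p ! (length p - 1) \<in> X"
  shows "compatible T T' phi (set p)"
proof -
  let ?H = "A \<union> B"
  have e: "p ! 0 \<notin> ?H" "p ! (length p - 1) \<notin> ?H" using p(2,3) disjoint by auto
  have entry: "y \<in> A \<and> (\<forall>k<length p. p ! k \<in> A \<longrightarrow> k = i) \<or> y \<in> B \<and> (\<forall>k<length p. p ! k \<in> B \<longrightarrow> k = i)"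
    if z: "z \<in> X" and y: "y \<in> ?H" "theta T z y \<noteq> -1"
      and only: "\<forall>l<length p. p ! l \<in> ?H \<longrightarrow> theta T z (p ! l) = 1 \<longrightarrow> l = i" for z y i
  proof (cases "y \<in> A")
    case True
    then have "theta T z x = 1" if "x \<in> A" for x
      using theta_A'[OF True z] theta_A'[OF that z] y(2) by (auto split: if_splits)
    then show ?thesis using True only by auto
  next
    case False
    then have yB: "y \<in> B" using y(1) by auto
    then have "theta T z x = 1" if "x \<in> B" for x
      using theta_B'[OF yB z] theta_B'[OF that z] y(2) by (auto split: if_splits)
    then show ?thesis using yB only by auto
  qed
  have "k = l" if k: "k < length p" "l < length p" "p ! k \<in> A \<and> p ! l \<in> A \<or> p ! k \<in> B \<and> p ! l \<in> B" for k l
  proof -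
    have kH: "p ! k \<in> ?H" "p ! l \<in> ?H" using k by auto
    obtain i where i: "0 < i" "i < length p" "p ! i \<in> ?H" "\<forall>l<i. p ! l \<notin> ?H"
      "theta T (p ! (i - 1)) (p ! i) \<noteq> -1"
      "\<forall>l<length p. p ! l \<in> ?H \<longrightarrow> theta T (p ! (i - 1)) (p ! l) = 1 \<longrightarrow> l = i"
      by (rule first_entry[OF T(1) p(1) e(1) k(1) kH(1)]) (rule that)
    obtain j where j: "Suc j < length p" "p ! j \<in> ?H" "\<forall>l<length p. j < l \<longrightarrow> p ! l \<notin> ?H"
      "theta T (p ! Suc j) (p ! j) \<noteq> -1"
      "\<forall>l<length p. p ! l \<in> ?H \<longrightarrow> theta T (p ! Suc j) (p ! l) = 1 \<longrightarrow> l = j"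
      by (rule last_entry[OF T(1) p(1) e(2) k(1) kH(1)]) (rule that)
    have "p ! (i - 1) \<in> X" using path_nth_in_verts[OF p(1), of "i - 1"] i(1,2,4) verts_T by auto
    note I = entry[OF this i(3,5,6)]
    have "p ! Suc j \<in> X" using path_nth_in_verts[OF p(1) j(1)] j(1,3) verts_T by auto
    note J = entry[OF this j(2,4,5)]
    have "i \<le> k" "i \<le> l" "k \<le> j" "l \<le> j" using i(4) j(3) k kH by (metis not_le)+
    then show ?thesis using I J k i(2) j(1) by (metis le_antisym Suc_lessD)
  qed
  then show ?thesis
    using compatible_phi[of "set p"] p(1) unfolding path_def by (metis IntE in_set_conv_nth)
qed

text \<open>Only the ends can lie in \<open>A \<union> B\<close>, and \<open>q ! 1\<close> in
  \<open>X\<close> is antiadjacent to one of them and adjacent to the other, so they are not in the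
  same class.\<close>

lemma compatible_antipath_inner_X:
  assumes q: "path (complement T) q" "4 \<le> length q"
    and inner: "\<And>i. 0 < i \<Longrightarrow> i < length q - 1 \<Longrightarrow> q ! i \<in> X"
  shows "compatible T T' phi (set q)"
proof -
  define n where "n = length q"
  have n: "4 \<le> n" using q(2) n_def by auto
  have x: "q ! 1 \<in> X" using inner[of 1] n n_def by auto
  have "theta T (q ! 1) (q ! 0) \<noteq> 1"
  proof
    assume "theta T (q ! 1) (q ! 0) = 1"
    then have "theta (complement T) (q ! 1) (q ! 0) = -1" by simp
    then show False
      using path_not_consecutive[OF trigraph_complement[OF T(1)] q(1), of 1 0] n n_def by linarith
  qed
  moreover have "theta T (q ! 1) (q ! (n - 1)) \<noteq> -1"
  proof
    assume "theta T (q ! 1) (q ! (n - 1)) = -1"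
    then have "theta (complement T) (q ! 1) (q ! (n - 1)) = 1" by simp
    then show False
      using path_consecutive[OF trigraph_complement[OF T(1)] q(1), of 1 "n - 1"] n n_def by linarith
  qed
  ultimately have not_both: "\<not> (q ! 0 \<in> A \<and> q ! (n - 1) \<in> A)" "\<not> (q ! 0 \<in> B \<and> q ! (n - 1) \<in> B)"
    using theta_A'[OF _ x] theta_B'[OF _ x] by metis+
  have ends: "i = 0 \<or> i = n - 1" if "i < n" "q ! i \<in> A \<union> B" for i
  proof (rule ccontr)
    assume "\<not> ?thesis"
    then have "q ! i \<in> X" using inner[of i] that n_def by auto
    then show False using that disjoint by auto
  qed
  show ?thesis
  proof (rule compatible_phi)
    show "set q \<subseteq> verts T" using q(1) unfolding path_def by simp
  qed (use not_both ends n_def in \<open>metis IntE UnCI in_set_conv_nth\<close>)+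
qed

text \<open>The switchable pair puts \<open>b\<close> into the part of \<open>a\<close>, and
  \<open>A \<union> B\<close> follows them. All of \<open>Q\<close> is then in \<open>X\<close>, so
  ends of paths and interiors of antipaths are in \<open>X\<close>.\<close>

lemma balanced_skew_partition_outside_both:
  assumes bsp: "balanced_skew_partition T' P Q" and aP: "a \<in> P" and bP: "b \<in> P"
  shows "has_balanced_skew_partition T"
proof -
  have PQ: "P \<union> Q = verts T'" "P \<inter> Q = {}" "\<nexists>p. odd_span T' P Q p" "\<nexists>p. odd_span (complement T') Q P p"
    using bsp unfolding balanced_skew_partition_iff[OF T'(1)] by auto
  obtain P1 P2 where P: "P = P1 \<union> P2" "separated T' P1 P2" "a \<in> P1"
    using bsp aP separated_commute[OF T'(1)] unfolding balanced_skew_partition_iff[OF T'(1)]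
    by (metis Un_commute Un_iff sup_ge1)
  obtain Q1 Q2 where Q: "Q = Q1 \<union> Q2" "separated (complement T') Q1 Q2"
    using bsp unfolding balanced_skew_partition_iff[OF T'(1)] by blast
  let ?P = "X \<inter> f -` P \<union> A \<union> B" and ?Q = "X \<inter> f -` Q"
  let ?P1 = "X \<inter> f -` P1 \<union> A \<union> B" and ?P2 = "X \<inter> f -` P2"
  let ?Q1 = "X \<inter> f -` Q1" and ?Q2 = "X \<inter> f -` Q2"
  have sepP: "P2 \<noteq> {}" "P1 \<inter> P2 = {}" "\<And>u v. u \<in> P1 \<Longrightarrow> v \<in> P2 \<Longrightarrow> theta T' u v = -1"
    using P(2) unfolding separated_def by auto
  have b1: "b \<in> P1" using sepP(3)[OF P(3), of b] ab(2) bP P(1) by auto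
  have P2X: "\<exists>x\<in>X. y = f x" if "y \<in> P2" for y
  proof -
    have "y \<in> f ` X \<union> {a, b}" "y \<noteq> a" "y \<noteq> b" using that sepP(2) P(1,3) b1 PQ(1) T'(2) by blast+
    then show ?thesis by blast
  qed
  have QX: "\<exists>x\<in>X. y = f x" if "y \<in> Q" for y
  proof -
    have "y \<in> f ` X \<union> {a, b}" "y \<noteq> a" "y \<noteq> b" using that aP bP PQ(1,2) T'(2) by blast+
    then show ?thesis by blast
  qed
  have phi: "\<And>x. x \<in> ?P \<Longrightarrow> phi x \<in> P" "\<And>x. x \<in> ?Q \<Longrightarrow> phi x \<in> Q" using aP bP by auto
  have "separated T ?P1 ?P2"
  proof -
    have "theta T u v = -1" if u: "u \<in> ?P1" and v: "v \<in> ?P2" for u v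
    proof -
      have vX: "v \<in> X" "f v \<in> P2" using v by auto
      then have "v \<notin> C \<union> E" "v \<notin> D \<union> E"
        using sepP(3)[OF P(3) vX(2)] sepP(3)[OF b1 vX(2)] theta_a[OF vX(1)] theta_b[OF vX(1)]
        by (auto split: if_splits)
      moreover have "theta T u v = -1" if "u \<in> X" "f u \<in> P1"
      proof -
        have "u \<noteq> v" using sepP(2) vX that by auto
        then show ?thesis using theta_f[of u v] sepP(3)[OF that(2) vX(2)] vX that by simp
      qed
      ultimately show ?thesis using u theta_A[OF _ vX(1)] theta_B[OF _ vX(1)] by auto
    qed
    moreover have "?P2 \<noteq> {}" using sepP(1) P2X by fastforce
    moreover have "?P1 \<inter> ?P2 = {}" using sepP(2) disjoint by auto
    ultimately show ?thesis using nonempty(1) unfolding separated_def by auto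
  qed
  moreover have "separated (complement T) ?Q1 ?Q2"
  proof -
    have sepQ: "Q1 \<noteq> {}" "Q2 \<noteq> {}" "Q1 \<inter> Q2 = {}" "\<And>u v. u \<in> Q1 \<Longrightarrow> v \<in> Q2 \<Longrightarrow> theta T' u v = 1"
      using Q(2) unfolding separated_def by (auto simp: minus_equation_iff)
    have "theta T u v = 1" if "u \<in> ?Q1" "v \<in> ?Q2" for u v
      using theta_f[of u v] sepQ(3) sepQ(4)[of "f u" "f v"] that by auto
    moreover have "?Q1 \<noteq> {}" "?Q2 \<noteq> {}" using sepQ(1,2) QX Q(1) by fastforce+
    ultimately show ?thesis using sepQ(3) unfolding separated_def by auto
  qed
  moreover have "?P = ?P1 \<union> ?P2" "?Q = ?Q1 \<union> ?Q2" using P(1) Q(1) by auto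
  moreover have "\<nexists>p. odd_span T ?P ?Q p"
  proof
    assume "\<exists>p. odd_span T ?P ?Q p"
    then obtain p where p: "odd_span T ?P ?Q p" by blast
    then have "compatible T T' phi (set p)" using compatible_X_ends unfolding odd_span_def by blast
    then have "odd_span T' P Q (map phi p)" using odd_span_map[OF T(1) T'(1) p] phi by blast
    then show False using PQ(3) by blast
  qed
  moreover have "\<nexists>p. odd_span (complement T) ?Q ?P p"
  proof
    assume "\<exists>p. odd_span (complement T) ?Q ?P p"
    then obtain p where p: "odd_span (complement T) ?Q ?P p" by blast
    then have "compatible T T' phi (set p)" using compatible_antipath_inner_X unfolding odd_span_def by blast
    then have "odd_span (complement T') Q P (map phi p)"
      using odd_span_map[OF trigraph_complement[OF T(1)] trigraph_complement[OF T'(1)] p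
          compatible_complement] phi by blast
    then show False using PQ(4) by blast
  qed
  moreover have "?P \<union> ?Q = verts T"
  proof -
    have "f x \<in> P \<union> Q" if "x \<in> X" for x using that PQ(1) T'(2) by auto
    then show ?thesis using verts_T by auto
  qed
  moreover have "?P \<inter> ?Q = {}" using PQ(2) disjoint by auto
  ultimately have "balanced_skew_partition T ?P ?Q"
    unfolding balanced_skew_partition_iff[OF T(1)] by blast
  then show ?thesis unfolding has_balanced_skew_partition_def by blast
qed

lemma separated_outside:
  assumes P: "separated T' P1 P2" "P1 \<union> P2 \<subseteq> verts T'" "a \<in> P1" "b \<notin> P1 \<union> P2"
  shows "separated T (X \<inter> f -` P1 \<union> A) (X \<inter> f -` P2)"
proof -
  have sepP: "P2 \<noteq> {}" "P1 \<inter> P2 = {}" "\<And>u v. u \<in> P1 \<Longrightarrow> v \<in> P2 \<Longrightarrow> theta T' u v = -1"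
    using P(1) unfolding separated_def by auto
  have P2X: "\<exists>x\<in>X. y = f x" if "y \<in> P2" for y
  proof -
    have "y \<in> f ` X \<union> {a, b}" "y \<noteq> a" "y \<noteq> b" using that sepP(2) P(2-4) T'(2) by blast+
    then show ?thesis by blast
  qed
  have "theta T u v = -1" if u: "u \<in> X \<inter> f -` P1 \<union> A" and v: "v \<in> X \<inter> f -` P2" for u v
  proof -
    have vX: "v \<in> X" "f v \<in> P2" using v by auto
    then have "v \<notin> C \<union> E"
      using sepP(3)[OF P(3) vX(2)] theta_a[OF vX(1)] by (auto split: if_splits)
    moreover have "theta T u v = -1" if "u \<in> X" "f u \<in> P1"
    proof -
      have "u \<noteq> v" using sepP(2) vX that by auto
      then show ?thesis using theta_f[of u v] sepP(3)[OF that(2) vX(2)] vX that by simp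
    qed
    ultimately show ?thesis using u theta_A[OF _ vX(1)] by auto
  qed
  moreover have "X \<inter> f -` P2 \<noteq> {}" using sepP(1) P2X by fastforce
  moreover have "(X \<inter> f -` P1 \<union> A) \<inter> (X \<inter> f -` P2) = {}" using sepP(2) disjoint by auto
  ultimately show ?thesis using nonempty(1) unfolding separated_def by auto
qed

text \<open>A path inside \<open>A \<union> B\<close> is closed to an odd hole by any vertex of \<open>D\<close>; a path that leaves
  \<open>A \<union> B\<close> has length four.\<close>

lemma no_odd_span_B_B:
  assumes p: "odd_span T P Q p" and P: "P \<subseteq> A \<union> X"
    and ends: "p ! 0 \<in> B" "p ! (length p - 1) \<in> B"
  shows False
proof -
  define n where "n = length p"
  have pp: "path T p" "4 \<le> n" "even n" "\<And>i. 0 < i \<Longrightarrow> i < n - 1 \<Longrightarrow> p ! i \<in> A \<union> X" "p ! (n - 1) \<in> B"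
    using p P ends unfolding odd_span_def n_def by auto
  note cons = path_consecutive[OF T(1) pp(1), folded n_def]
  note ncons = path_not_consecutive[OF T(1) pp(1), folded n_def]
  have same: "theta T z x = theta T z y" if "z \<in> X" "x \<in> B" "y \<in> B" for x y z
    using theta_B'[OF that(2,1)] theta_B'[OF that(3,1)] by simp
  have pm: "theta T z x = 1 \<or> theta T z x = -1" if "z \<in> X" "x \<in> A \<union> B" for x z
    using theta_B'[of x z] theta_A'[of x z] that by (auto split: if_splits)
  have idx: "1 < n" "0 < n" "n - 1 < n" "n - 2 < n" "Suc (n - 2) = n - 1" "0 < n - 2" "n - 2 < n - 1" "1 < n - 1"
    using pp(2) by linarith+
  \<comment> \<open>A vertex of \<open>X\<close> next to one end in \<open>B\<close> would be
    strongly adjacent to the other end too.\<close>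
  have p1: "p ! 1 \<in> A"
  proof (rule ccontr)
    assume "p ! 1 \<notin> A"
    then have x: "p ! 1 \<in> X" using pp(4)[of 1] idx by auto
    have "theta T (p ! 1) (p ! 0) \<noteq> -1" using ncons[of 1 0] idx by auto
    then have "theta T (p ! 1) (p ! (n - 1)) = 1" using pm[OF x, of "p ! 0"] same[OF x ends(1) pp(5)] ends(1) by auto
    then show False using cons[of 1 "n - 1"] pp(2) by linarith
  qed
  have pn: "p ! (n - 2) \<in> A"
  proof (rule ccontr)
    assume "p ! (n - 2) \<notin> A"
    then have x: "p ! (n - 2) \<in> X" using pp(4)[of "n - 2"] idx by auto
    have "theta T (p ! (n - 2)) (p ! (n - 1)) \<noteq> -1" using ncons[of "n - 2" "n - 1"] idx by auto
    then have "theta T (p ! (n - 2)) (p ! 0) = 1"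
      using pm[OF x, of "p ! (n - 1)"] same[OF x ends(1) pp(5)] pp(5) by auto
    then show False using cons[of "n - 2" 0] pp(2) by linarith
  qed
  show False
  proof (cases "\<forall>i. 0 < i \<and> i < n - 1 \<longrightarrow> p ! i \<in> A")
    case True
    obtain w where w: "w \<in> D" using nonempty by auto
    have wX: "w \<in> X" "w \<in> verts T" "w \<notin> C \<union> E" using w X verts_T disjoint by auto
    have "w \<notin> set p"
    proof
      assume "w \<in> set p"
      then obtain i where i: "i < n" "p ! i = w" unfolding n_def by (metis in_set_conv_nth)
      have "i \<noteq> 0" "i \<noteq> n - 1" using i ends(1) pp(5) wX(1) disjoint by auto
      then have "w \<in> A" using True i by fastforce
      then show False using wX(1) disjoint by auto
    qed
    then show False
      using Berge_no_closing_vertex[OF T p wX(2)] True theta_B'[OF ends(1) wX(1)] theta_B'[OF pp(5) wX(1)]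
        theta_A'[OF _ wX(1)] w wX(3) unfolding n_def by auto
  next
    case False
    then obtain k where k: "0 < k" "k < n - 1" "p ! k \<in> X" using pp(4) by blast
    define i where "i = (LEAST k. 0 < k \<and> p ! k \<in> X)"
    have i: "0 < i" "p ! i \<in> X" "i \<le> k" unfolding i_def
      using LeastI[of "\<lambda>k. 0 < k \<and> p ! k \<in> X" k] Least_le[of "\<lambda>k. 0 < k \<and> p ! k \<in> X" k] k by auto
    have "i \<noteq> 1" using i(2) p1 disjoint by auto
    then have i1: "1 < i" "i < n" "i - 1 < n" "Suc (i - 1) = i" "0 < i - 1" "i - 1 < n - 1" "i - 1 < i"
      using i k pp(2) by linarith+
    have "p ! (i - 1) \<notin> X" using not_less_Least[of "i - 1" "\<lambda>k. 0 < k \<and> p ! k \<in> X"] i1 unfolding i_def by auto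
    then have iA: "p ! (i - 1) \<in> A" using pp(4)[of "i - 1"] i1 by auto
    have "theta T (p ! i) (p ! (i - 1)) \<noteq> -1" using ncons[of i "i - 1"] i1 by auto
    then have th: "theta T (p ! i) x = 1" if "x \<in> A" for x
      using theta_A'[OF iA i(2)] theta_A'[OF that i(2)] by (auto split: if_splits)
    \<comment> \<open>As \<open>p ! i\<close> is strongly complete to \<open>A\<close>, it is next
      to both position \<open>1\<close> and position \<open>n - 2\<close>, which forces
      \<open>n = 5\<close>; but \<open>n\<close> is even.\<close>
    have "i \<noteq> 1" "i \<noteq> n - 2" using i(2) p1 pn disjoint by auto
    then have "1 = Suc i \<or> i = Suc 1" "n - 2 = Suc i \<or> i = Suc (n - 2)"
      using cons[of i 1] cons[of i "n - 2"] th[OF p1] th[OF pn] i1 idx by blast+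
    then have "n = 5" using i k by linarith
    then show False using pp(3) by simp
  qed
qed

text \<open>\<open>B\<close> can occur only at position \<open>0\<close>. The vertex after the last
  one in \<open>A\<close> is in \<open>X\<close> and strongly complete to \<open>A\<close>, so there
  is no second vertex in \<open>A\<close>.\<close>

lemma compatible_X_end:
  assumes p: "odd_span T P Q p" and P: "P \<subseteq> A \<union> X"
    and ends: "p ! 0 \<in> B \<union> X" "p ! (length p - 1) \<in> X"
  shows "compatible T T' phi (set p)"
proof -
  define n where "n = length p"
  have pp: "path T p" "4 \<le> n" "\<And>i. 0 < i \<Longrightarrow> i < n - 1 \<Longrightarrow> p ! i \<in> A \<union> X"
    using p P unfolding odd_span_def n_def by auto
  have B: "i = 0" if "i < n" "p ! i \<in> B" for i
  proof (rule ccontr)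
    assume "i \<noteq> 0"
    moreover have "i \<noteq> n - 1" using that ends(2) disjoint n_def by auto
    ultimately have "p ! i \<in> A \<union> X" using pp(3)[of i] that by linarith
    then show False using that disjoint by auto
  qed
  have A: "k = l" if k: "k < length p" "p ! k \<in> A" and l: "l < length p" "p ! l \<in> A" for k l
  proof -
    have "p ! (length p - 1) \<notin> A" using ends(2) disjoint by auto
    then obtain j where j: "Suc j < length p" "p ! j \<in> A" "\<forall>l<length p. j < l \<longrightarrow> p ! l \<notin> A"
      "theta T (p ! Suc j) (p ! j) \<noteq> -1"
      "\<forall>l<length p. p ! l \<in> A \<longrightarrow> theta T (p ! Suc j) (p ! l) = 1 \<longrightarrow> l = j"
      by (rule last_entry[OF T(1) pp(1) _ k]) (rule that)
    have "p ! Suc j \<notin> B" using B[of "Suc j"] j(1) n_def by auto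
    then have x: "p ! Suc j \<in> X" using path_nth_in_verts[OF pp(1) j(1)] j(1,3) verts_T by auto
    have "theta T (p ! Suc j) y = 1" if "y \<in> A" for y
      using theta_A'[OF j(2) x] theta_A'[OF that x] j(4) by (auto split: if_splits)
    then show ?thesis using j(5) k l by metis
  qed
  show ?thesis
  proof (rule compatible_phi)
    show "set p \<subseteq> verts T" using pp(1) unfolding path_def by simp
    show "x = y" if "x \<in> set p \<inter> A" "y \<in> set p \<inter> A" for x y using that A by (metis IntE in_set_conv_nth)
    show "x = y" if "x \<in> set p \<inter> B" "y \<in> set p \<inter> B" for x y
      using that B n_def by (metis IntE in_set_conv_nth)
  qed
qed

lemma no_odd_span_outside:
  assumes no: "\<nexists>p'. odd_span T' P Q p'" and aP: "a \<in> P" and bQ: "b \<in> Q"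
  shows "\<not> odd_span T (X \<inter> f -` P \<union> A) (X \<inter> f -` Q \<union> B) p"
proof
  let ?P = "X \<inter> f -` P \<union> A" and ?Q = "X \<inter> f -` Q \<union> B"
  assume p: "odd_span T ?P ?Q p"
  have P: "?P \<subseteq> A \<union> X" by auto
  have key: False if r: "odd_span T ?P ?Q r" and e: "r ! (length r - 1) \<in> X" for r
  proof -
    have "r ! 0 \<in> B \<union> X" using r unfolding odd_span_def by auto
    then have "compatible T T' phi (set r)" using compatible_X_end[OF r P _ e] by blast
    moreover have "phi x \<in> P" if "x \<in> ?P" for x using that aP by auto
    moreover have "phi x \<in> Q" if "x \<in> ?Q" for x using that bQ by auto
    ultimately have "odd_span T' P Q (map phi r)" using odd_span_map[OF T(1) T'(1) r] by blast
    then show False using no by blast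
  qed
  have pp: "p \<noteq> []" "p ! 0 \<in> ?Q" "p ! (length p - 1) \<in> ?Q" using p unfolding odd_span_def path_def by auto
  then consider "p ! (length p - 1) \<in> X" | "p ! 0 \<in> X" | "p ! 0 \<in> B" "p ! (length p - 1) \<in> B" by auto
  then show False
  proof cases
    case 1
    then show False using key[OF p] by blast
  next
    case 2
    then show False using key[OF odd_span_rev[OF T(1) p]] rev_nth_last[OF pp(1)] by auto
  next
    case 3
    then show False using no_odd_span_B_B[OF p P] by blast
  qed
qed

lemma balanced_skew_partition_outside_mixed:
  assumes bsp: "balanced_skew_partition T' P Q" and aP: "a \<in> P" and bQ: "b \<in> Q"
  shows "has_balanced_skew_partition T"
proof -
  note cT' = trigraph_complement[OF T'(1)]
  have PQ: "P \<union> Q = verts T'" "P \<inter> Q = {}" "\<nexists>p. odd_span T' P Q p" "\<nexists>p. odd_span (complement T') Q P p"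
    using bsp unfolding balanced_skew_partition_iff[OF T'(1)] by auto
  obtain P1 P2 where P: "P = P1 \<union> P2" "separated T' P1 P2" "a \<in> P1"
    using bsp aP separated_commute[OF T'(1)] unfolding balanced_skew_partition_iff[OF T'(1)]
    by (metis Un_commute Un_iff sup_ge1)
  obtain Q1 Q2 where Q: "Q = Q1 \<union> Q2" "separated (complement T') Q1 Q2" "b \<in> Q1"
    using bsp bQ separated_commute[OF cT'] unfolding balanced_skew_partition_iff[OF T'(1)]
    by (metis Un_commute Un_iff sup_ge2 verts_complement)
  \<comment> \<open>Complementation turns \<open>Q\<close> into the disconnected side; the exchange
    of \<open>A\<close> and \<open>B\<close> makes \<open>b\<close> the marker in that side.\<close>
  interpret co: homogeneous_pair_outside "complement T" B A C D F E X "complement T'" f b a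
    by (rule homogeneous_pair_outside.outside_swapped[OF outside_complemented])
  let ?P = "X \<inter> f -` P \<union> A" and ?Q = "X \<inter> f -` Q \<union> B"
  let ?P1 = "X \<inter> f -` P1 \<union> A" and ?P2 = "X \<inter> f -` P2"
  let ?Q1 = "X \<inter> f -` Q1 \<union> B" and ?Q2 = "X \<inter> f -` Q2"
  have "separated T ?P1 ?P2" using separated_outside[OF P(2) _ P(3)] P(1) PQ bQ by auto
  moreover have "separated (complement T) ?Q1 ?Q2"
    using co.separated_outside[OF Q(2) _ Q(3)] Q(1) PQ aP by auto
  moreover have "?P = ?P1 \<union> ?P2" "?Q = ?Q1 \<union> ?Q2" using P(1) Q(1) by auto
  moreover have "\<nexists>p. odd_span T ?P ?Q p" using no_odd_span_outside[OF PQ(3) aP bQ] by blast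
  moreover have "\<nexists>p. odd_span (complement T) ?Q ?P p"
    using co.no_odd_span_outside[OF PQ(4) bQ aP] by blast
  moreover have "?P \<union> ?Q = verts T"
  proof -
    have "f x \<in> P \<union> Q" if "x \<in> X" for x using that PQ(1) T'(2) by auto
    then show ?thesis using verts_T by auto
  qed
  moreover have "?P \<inter> ?Q = {}" using PQ(2) disjoint by auto
  ultimately have "balanced_skew_partition T ?P ?Q"
    unfolding balanced_skew_partition_iff[OF T(1)] by blast
  then show ?thesis unfolding has_balanced_skew_partition_def by blast
qed

lemma has_balanced_skew_partition_outside:
  assumes "has_balanced_skew_partition T'"
  shows "has_balanced_skew_partition T"
proof -
  obtain P Q where bsp: "balanced_skew_partition T' P Q"
    using assms unfolding has_balanced_skew_partition_def by auto
  have "P \<union> Q = verts T'" using bsp unfolding balanced_skew_partition_iff[OF T'(1)] by auto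
  then consider "a \<in> P" "b \<in> P" | "a \<in> P" "b \<in> Q" | "b \<in> P" "a \<in> Q" | "a \<in> Q" "b \<in> Q"
    using T'(2) by auto
  then show ?thesis
  proof cases
    case 1
    then show ?thesis using balanced_skew_partition_outside_both[OF bsp] by blast
  next
    case 2
    then show ?thesis using balanced_skew_partition_outside_mixed[OF bsp] by blast
  next
    case 3
    then show ?thesis
      using homogeneous_pair_outside.balanced_skew_partition_outside_mixed[OF outside_swapped bsp] by blast
  next
    case 4
    then have "has_balanced_skew_partition (complement T)"
      using homogeneous_pair_outside.balanced_skew_partition_outside_both[OF outside_complemented
          balanced_skew_partition_complement[OF T'(1) bsp]] by blast
    then show ?thesis using has_balanced_skew_partition_complement[OF T(1)] by blast
  qed
qed

end

section \<open>Blocks as instances of the three configurations\<close>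

lemma class_F_D: "T \<in> class_F \<Longrightarrow> trigraph T \<and> Berge T"
  unfolding class_F_def by blast

lemma trigraph_add_markers:
  assumes "trigraph T" "finite M"
  shows "trigraph (add_markers T X M N Sw St)"
proof -
  have "marker_theta T N Sw St x y \<in> {-1, 0, 1} \<and> marker_theta T N Sw St x y = marker_theta T N Sw St y x"
    if xy: "x \<in> Inl ` (verts T \<inter> X) \<union> Inr ` M" "y \<in> Inl ` (verts T \<inter> X) \<union> Inr ` M" "x \<noteq> y" for x y
  proof (cases x)
    case (Inl u)
    show ?thesis
    proof (cases y)
      case y: (Inl v)
      have "u \<in> verts T" "v \<in> verts T" "u \<noteq> v" using xy Inl y by auto
      then have "theta T u v \<in> {-1, 0, 1} \<and> theta T u v = theta T v u"
        using assms(1) unfolding trigraph_def by blast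
      then show ?thesis using Inl y by auto
    qed (simp add: Inl)
  next
    case (Inr m)
    then show ?thesis by (cases y) (simp_all add: insert_commute)
  qed
  then show ?thesis using assms unfolding trigraph_def add_markers_def by simp
qed

lemma two_join_theta:
  assumes "two_join T X1 X2 A1 B1 C1 A2 B2 C2" "x \<in> X1" "y \<in> X2"
  shows "theta T x y = (if x \<in> A1 \<and> y \<in> A2 \<or> x \<in> B1 \<and> y \<in> B2 then 1 else -1)"
  using assms unfolding two_join_def strongly_complete_def strongly_adjacent_def strongly_antiadjacent_def
  by auto

lemma two_join_D:
  assumes "two_join T X1 X2 A1 B1 C1 A2 B2 C2"
  shows "verts T = X1 \<union> X2" "X1 \<inter> X2 = {}" "A1 \<subseteq> X1" "B1 \<subseteq> X1" "A1 \<inter> B1 = {}" "A1 \<noteq> {}" "B1 \<noteq> {}"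
    "X2 = A2 \<union> B2 \<union> C2" "A2 \<inter> B2 = {}" "A2 \<inter> C2 = {}" "B2 \<inter> C2 = {}" "A2 \<noteq> {}" "B2 \<noteq> {}"
    "X1 = A1 \<union> B1 \<union> C1" "A1 \<inter> C1 = {}" "B1 \<inter> C1 = {}"
  using assms unfolding two_join_def two_join_side_def by auto

lemma side_path_length: "side_path T A B C p \<Longrightarrow> length p = Suc (plength p)"
  unfolding side_path_def path_def plength_def by (cases p) auto

text \<open>The locale counts vertices, not edges: a side path of odd length has an even number of
  vertices, matching \<open>ms = []\<close>.\<close>

lemma odd_block:
  assumes T: "trigraph T" "Berge T" and tj: "two_join T X1 X2 A1 B1 C1 A2 B2 C2"
    and parity: "odd_split T A1 B1 C1 A2 B2 C2"
    and T': "trigraph T'" "verts T' = Inl ` X1 \<union> {Inr Ma, Inr Mb}"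
    and theta: "\<And>u v. u \<in> X1 \<Longrightarrow> v \<in> X1 \<Longrightarrow> theta T' (Inl u) (Inl v) = theta T u v"
      "\<And>u. u \<in> X1 \<Longrightarrow> theta T' (Inr Ma) (Inl u) = (if u \<in> A1 then 1 else -1)"
      "\<And>u. u \<in> X1 \<Longrightarrow> theta T' (Inr Mb) (Inl u) = (if u \<in> B1 then 1 else -1)"
      "theta T' (Inr Ma) (Inr Mb) = 0"
  shows "two_join_block T X1 A1 B1 X2 A2 B2 C2 T' Inl (Inr Ma) (Inr Mb) []"
proof
  show "even (length s) = even (length [])" if "side_path T A2 B2 C2 s" for s
    using parity that side_path_length[OF that] unfolding odd_split_def by auto
qed (use T two_join_D[OF tj] two_join_theta[OF tj] T' theta in auto)

lemma even_block:
  assumes T: "trigraph T" "Berge T" and tj: "two_join T X1 X2 A1 B1 C1 A2 B2 C2"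
    and parity: "even_split T A1 B1 C1 A2 B2 C2"
    and T': "trigraph T'" "verts T' = Inl ` X1 \<union> {Inr Ma, Inr Mb, Inr Mc}"
    and theta: "\<And>u v. u \<in> X1 \<Longrightarrow> v \<in> X1 \<Longrightarrow> theta T' (Inl u) (Inl v) = theta T u v"
      "\<And>u. u \<in> X1 \<Longrightarrow> theta T' (Inr Ma) (Inl u) = (if u \<in> A1 then 1 else -1)"
      "\<And>u. u \<in> X1 \<Longrightarrow> theta T' (Inr Mb) (Inl u) = (if u \<in> B1 then 1 else -1)"
      "\<And>u. u \<in> X1 \<Longrightarrow> theta T' (Inr Mc) (Inl u) = -1"
      "theta T' (Inr Mc) (Inr Ma) = 0" "theta T' (Inr Mc) (Inr Mb) = 0" "theta T' (Inr Ma) (Inr Mb) = -1"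
  shows "two_join_block T X1 A1 B1 X2 A2 B2 C2 T' Inl (Inr Ma) (Inr Mb) [Inr Mc]"
proof
  show "even (length s) = even (length [Inr Mc])" if "side_path T A2 B2 C2 s" for s
    using parity that side_path_length[OF that] unfolding even_split_def by auto
qed (use T two_join_D[OF tj] two_join_theta[OF tj] T' theta in auto)

lemma homogeneous_pair_of_proper:
  assumes T: "trigraph T" "Berge T" and hp: "proper_homogeneous_pair T A B"
    and split: "homogeneous_pair_split T A B C D E F"
  shows "homogeneous_pair T A B C D E F (C \<union> D \<union> E \<union> F)"
proof -
  have *: "A \<subseteq> verts T" "B \<subseteq> verts T" "A \<noteq> {}" "B \<noteq> {}" "A \<inter> B = {}"
    "complete_outside T A B A \<union> anticomplete_outside T A B A = verts T - (A \<union> B)"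
    "complete_outside T A B B \<union> anticomplete_outside T A B B = verts T - (A \<union> B)"
    "C \<noteq> {}" "D \<noteq> {}"
    "\<forall>a\<in>A. (\<exists>b\<in>B. adjacent T a b) \<and> (\<exists>b\<in>B. antiadjacent T a b)"
    "\<forall>b\<in>B. (\<exists>a\<in>A. adjacent T b a) \<and> (\<exists>a\<in>A. antiadjacent T b a)"
    using hp split unfolding proper_homogeneous_pair_def by blast+
  have cA: "theta T x z = 1" "theta T z x = 1" if "z \<in> complete_outside T A B S" "x \<in> S" for x z S
    using that theta_sym[OF T(1), of x z]
    unfolding complete_outside_def strongly_complete_def strongly_adjacent_def vpair_def by auto
  have aA: "theta T x z = -1" "theta T z x = -1" if "z \<in> anticomplete_outside T A B S" "x \<in> S" for x z S
    using that theta_sym[OF T(1), of x z]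
    unfolding anticomplete_outside_def strongly_anticomplete_def strongly_antiadjacent_def vpair_def by auto
  \<comment> \<open>A vertex of \<open>S\<close> is the witness that nothing is both strongly
    complete and strongly anticomplete to \<open>S\<close>; this makes \<open>C\<close>,
    \<open>D\<close>, \<open>E\<close>, \<open>F\<close> disjoint.\<close>
  have dj: "complete_outside T A B S \<inter> anticomplete_outside T A B S = {}" if ne: "S \<noteq> {}" for S
  proof -
    obtain x where x: "x \<in> S" using ne by auto
    have "z \<notin> anticomplete_outside T A B S" if "z \<in> complete_outside T A B S" for z
      using cA(1)[OF that x] aA(1)[of z S x] x by auto
    then show ?thesis by auto
  qed
  have X: "C \<union> D \<union> E \<union> F = verts T - (A \<union> B)"
    using split *(6,7) unfolding homogeneous_pair_split_def by blast
  show ?thesis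
  proof
    show "theta T x z = (if z \<in> C \<union> E then 1 else -1)" if "x \<in> A" "z \<in> C \<union> D \<union> E \<union> F" for x z
      using that split cA(1)[of z A x] aA(1)[of z A x] unfolding homogeneous_pair_split_def by auto
    show "theta T x z = (if z \<in> D \<union> E then 1 else -1)" if "x \<in> B" "z \<in> C \<union> D \<union> E \<union> F" for x z
      using that split cA(1)[of z B x] aA(1)[of z B x] unfolding homogeneous_pair_split_def by auto
    show "\<exists>y\<in>B. theta T x y \<noteq> -1" "\<exists>y\<in>B. theta T x y \<noteq> 1" if "x \<in> A" for x
      using *(10) that unfolding adjacent_iff_theta[OF T(1)] antiadjacent_iff_theta[OF T(1)] by blast+
    show "\<exists>x\<in>A. theta T y x \<noteq> -1" "\<exists>x\<in>A. theta T y x \<noteq> 1" if "y \<in> B" for y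
      using *(11) that unfolding adjacent_iff_theta[OF T(1)] antiadjacent_iff_theta[OF T(1)] by blast+
    show "C \<inter> D = {}" "C \<inter> E = {}" "C \<inter> F = {}" "D \<inter> E = {}" "D \<inter> F = {}" "E \<inter> F = {}"
      using split dj[OF *(3)] dj[OF *(4)] unfolding homogeneous_pair_split_def by blast+
    show "verts T = A \<union> B \<union> (C \<union> D \<union> E \<union> F)" using X *(1,2) by blast
    show "A \<inter> (C \<union> D \<union> E \<union> F) = {}" "B \<inter> (C \<union> D \<union> E \<union> F) = {}" using X by blast+
  qed (use T * in auto)
qed

theorem theorem9p2:
  fixes T :: "'a trigraph" and X :: "'a set" and T_X :: "('a + marker) trigraph"
  assumes "T \<in> class_F"
    and "\<not> has_balanced_skew_partition T"
    and "fragment T X"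
    and "block T X T_X"
  shows "\<not> has_balanced_skew_partition T_X"
proof -
  have T: "trigraph T" "Berge T" using class_F_D[OF assms(1)] by auto
  note cT = trigraph_complement[OF T(1)] Berge_complement[OF T(2)]
  have "has_balanced_skew_partition T" if bsp: "has_balanced_skew_partition T_X"
    using assms(4)
  proof cases
    case (odd_two_join X2 A1 B1 C1 A2 B2 C2)
    have tj: "two_join T X X2 A1 B1 C1 A2 B2 C2" using odd_two_join(2) unfolding proper_two_join_def by simp
    have T': "trigraph T_X" unfolding odd_two_join(1) by (rule trigraph_add_markers[OF T(1)]) auto
    have "two_join_block T X A1 B1 X2 A2 B2 C2 T_X Inl (Inr Ma) (Inr Mb) []"
      using T' unfolding odd_two_join(1)
      by (rule odd_block[OF T tj odd_two_join(3)])
        (use two_join_D(1)[OF tj] in \<open>auto simp: add_markers_def\<close>)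
    then show ?thesis using bsp by (rule two_join_block.has_balanced_skew_partition_pull)
  next
    case (even_two_join X2 A1 B1 C1 A2 B2 C2)
    have tj: "two_join T X X2 A1 B1 C1 A2 B2 C2" using even_two_join(2) unfolding proper_two_join_def by simp
    have T': "trigraph T_X" unfolding even_two_join(1) by (rule trigraph_add_markers[OF T(1)]) auto
    have "two_join_block T X A1 B1 X2 A2 B2 C2 T_X Inl (Inr Ma) (Inr Mb) [Inr Mc]"
      using T' unfolding even_two_join(1)
      by (rule even_block[OF T tj even_two_join(3)])
        (use two_join_D(1)[OF tj] in \<open>auto simp: add_markers_def doubleton_eq_iff\<close>)
    then show ?thesis using bsp by (rule two_join_block.has_balanced_skew_partition_pull)
  next
    case (odd_complement_two_join X2 A1 B1 C1 A2 B2 C2)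
    have tj: "two_join (complement T) X X2 A1 B1 C1 A2 B2 C2"
      using odd_complement_two_join(2) unfolding proper_complement_two_join_def proper_two_join_def by simp
    have T': "trigraph T_X" unfolding odd_complement_two_join(1) by (rule trigraph_add_markers[OF T(1)]) auto
    \<comment> \<open>Inside \<open>X\<close>, lying outside \<open>B1 \<union> C1\<close> means
      lying in \<open>A1\<close>. So in \<open>complement T_X\<close> the marker \<open>Ma\<close>
      is strongly complete to \<open>A1\<close>, likewise \<open>Mb\<close> to \<open>B1\<close>, as
      in the block of a 2-join of \<open>complement T\<close>.\<close>
    have "two_join_block (complement T) X A1 B1 X2 A2 B2 C2 (complement T_X) Inl (Inr Ma) (Inr Mb) []"
      using trigraph_complement[OF T'] unfolding odd_complement_two_join(1)
      by (rule odd_block[OF cT tj odd_complement_two_join(3)])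
        (use two_join_D[OF tj] in \<open>auto simp: add_markers_def\<close>)
    moreover have "has_balanced_skew_partition (complement T_X)"
      using bsp has_balanced_skew_partition_complement[OF T'] by blast
    ultimately have "has_balanced_skew_partition (complement T)"
      by (rule two_join_block.has_balanced_skew_partition_pull)
    then show ?thesis using has_balanced_skew_partition_complement[OF T(1)] by blast
  next
    case (even_complement_two_join X2 A1 B1 C1 A2 B2 C2)
    have tj: "two_join (complement T) X X2 A1 B1 C1 A2 B2 C2"
      using even_complement_two_join(2) unfolding proper_complement_two_join_def proper_two_join_def by simp
    have T': "trigraph T_X"
      unfolding even_complement_two_join(1) by (rule trigraph_add_markers[OF T(1)]) auto
    \<comment> \<open>In addition, complementation makes \<open>Mc\<close> strongly anticomplete to
      \<open>X\<close> and the pair of \<open>Ma\<close> and \<open>Mb\<close> strongly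
      antiadjacent, as the even case requires.\<close>
    have "two_join_block (complement T) X A1 B1 X2 A2 B2 C2 (complement T_X) Inl (Inr Ma) (Inr Mb) [Inr Mc]"
      using trigraph_complement[OF T'] unfolding even_complement_two_join(1)
      by (rule even_block[OF cT tj even_complement_two_join(3)])
        (use two_join_D[OF tj] in \<open>auto simp: add_markers_def doubleton_eq_iff\<close>)
    moreover have "has_balanced_skew_partition (complement T_X)"
      using bsp has_balanced_skew_partition_complement[OF T'] by blast
    ultimately have "has_balanced_skew_partition (complement T)"
      by (rule two_join_block.has_balanced_skew_partition_pull)
    then show ?thesis using has_balanced_skew_partition_complement[OF T(1)] by blast
  next
    case (homogeneous_pair_inside A B)
    obtain C D E F where split: "homogeneous_pair_split T A B C D E F"
      unfolding homogeneous_pair_split_def by blast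
    interpret homogeneous_pair T A B C D E F "C \<union> D \<union> E \<union> F"
      by (rule homogeneous_pair_of_proper[OF T homogeneous_pair_inside(3) split])
    have "trigraph T_X" unfolding homogeneous_pair_inside(2) by (rule trigraph_add_markers[OF T(1)]) auto
    then interpret homogeneous_pair_inside T A B C D E F "C \<union> D \<union> E \<union> F" T_X Inl "Inr Mc" "Inr Md"
      by unfold_locales
        (use verts_T disjoint(1) in \<open>auto simp: homogeneous_pair_inside(2) add_markers_def\<close>)
    show ?thesis by (rule has_balanced_skew_partition_inside[OF bsp])
  next
    case (homogeneous_pair_outside A B C D E F)
    interpret homogeneous_pair T A B C D E F "C \<union> D \<union> E \<union> F"
      by (rule homogeneous_pair_of_proper[OF T homogeneous_pair_outside(2,3)])
    have "trigraph T_X" unfolding homogeneous_pair_outside(1) by (rule trigraph_add_markers[OF T(1)]) auto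
    then interpret homogeneous_pair_outside T A B C D E F "C \<union> D \<union> E \<union> F" T_X Inl "Inr Ma" "Inr Mb"
      by unfold_locales
        (use verts_T in \<open>auto simp: homogeneous_pair_outside add_markers_def\<close>)
    show ?thesis by (rule has_balanced_skew_partition_outside[OF bsp])
  qed
  then show ?thesis using assms(2) by blast
qed

end
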